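(* Let $\delta\in\mathbf{C}$ and let $\mathcal{G}$ be the partition category over $\mathbf{C}$ with parameter $\delta$. Let $\mathcal{U}$ (resp. $\mathcal{D}$) be the wide subcategory of $\mathcal{G}$ whose Hom spaces are spanned by the upwards (resp. downwards) partition diagrams. Then $\mathcal{G}$, with $(\mathcal{U},\mathcal{D})$, is a triangular category.
   Context: Partition category. For finite sets $S,T$, a partition diagram from $S$ to $T$ is a partition of the set $S\amalg T$ into non-empty disjoint subsets (parts). Given partition diagrams $\alpha$ from $S$ to $T$ and $\beta$ from $T$ to $U$, let $\beta\Box\alpha$ be the partition of $S\amalg T\amalg U$ obtained by taking all parts of $\alpha$ and $\beta$ and merging those that meet (transitively). Let $\beta\bullet\alpha$ be the induced partition of $S\amalg U$ (intersect each part of $\beta\Box\alpha$ with $S\amalg U$ and discard empty sets), and let $c(\beta,\alpha)$ be the number of parts of $\beta\Box\alpha$ contained in $T$. The partition category $\mathcal{G}$ with parameter $\delta$ has finite sets as objects, $\mathrm{Hom}_{\mathcal{G}}(S,T)$ is the $\mathbf{C}$-vector space with basis the partition diagrams from $S$ to $T$, and composition is bilinear with $\beta\circ\alpha=\delta^{c(\beta,\alpha)}\,(\beta\bullet\alpha)$. A partition diagram from $S$ to $T$ is upwards if each part meets $T$ and meets $S$ in $0$ or $1$ elements; it is downwards if each part meets $S$ and meets $T$ in $0$ or $1$ elements. Triangular categories. Let $\mathbf{k}$ be an algebraically closed field (here $\mathbf{k}=\mathbf{C}$). A subcategory is wide if it contains all objects. Write $|\mathcal{G}|$ for the set of isomorphism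 classes of objects. Given a partial order $\le$ on $|\mathcal G|$, a wide subcategory is upwards (resp. downwards) if existence of a non-zero morphism $x\to y$ in it implies $x\le y$ (resp. $x\ge y$). A triangular category is a $\mathbf{k}$-linear category $\mathcal{G}$ together with a pair $(\mathcal{U},\mathcal{D})$ of wide subcategories such that: (T0) $\mathcal{G}$ is essentially small and all Hom spaces are finite dimensional; (T1) $\mathrm{End}_{\mathcal{U}}(x)=\mathrm{End}_{\mathcal{D}}(x)$ for all objects $x$, and this ring is semi-simple; (T2) there is a partial order $\le$ on $|\mathcal{G}|$ such that for every $x$ there are only finitely many $y\le x$, $\mathcal{U}$ is upwards, and $\mathcal{D}$ is downwards; (T3) for all $x,z\in\mathcal{G}$ the map $\bigoplus_{y\in|\mathcal{G}|}\mathrm{Hom}_{\mathcal{U}}(y,z)\otimes_{\mathrm{End}_{\mathcal{U}}(y)}\mathrm{Hom}_{\mathcal{D}}(x,y)\to\mathrm{Hom}_{\mathcal{G}}(x,z)$ induced by composition is an isomorphism. *)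

theory Defs
  imports
    "HOL-Algebra.AbelCoset"
    "HOL-Algebra.Free_Abelian_Groups"
    "HOL-Library.Disjoint_Sets"
    "HOL-Library.Infinite_Typeclass"
    "HOL-Library.Poly_Mapping"
    "HOL-Computational_Algebra.Computational_Algebra"
begin

section \<open>Linear categories\<close>

text \<open>
  The morphisms of a linear category are elements of one ambient vector space, and every Hom space
  is a subspace of it. Hom spaces of different pairs of objects may overlap (they share at least 0),
  so composition takes the objects as arguments: \<open>Comp G x y z g f\<close> is the composite
  of \<open>f : x \<rightarrow> y\<close> and \<open>g : y \<rightarrow> z\<close>.
\<close>

record ('k, 'o, 'm) lincat =
  Obj :: "'o set"
  Hom :: "'o \<Rightarrow> 'o \<Rightarrow> 'm set"
  Scale :: "'k \<Rightarrow> 'm \<Rightarrow> 'm"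
  Comp :: "'o \<Rightarrow> 'o \<Rightarrow> 'o \<Rightarrow> 'm \<Rightarrow> 'm \<Rightarrow> 'm"
  Ide :: "'o \<Rightarrow> 'm"

locale linear_category =
  fixes G :: "('k::field, 'o, 'm::ab_group_add) lincat"
  assumes vector_space_Scale: "vector_space (Scale G)"
    and subspace_Hom: "\<lbrakk>x \<in> Obj G; y \<in> Obj G\<rbrakk> \<Longrightarrow> module.subspace (Scale G) (Hom G x y)"
    and Comp_closed:
      "\<lbrakk>x \<in> Obj G; y \<in> Obj G; z \<in> Obj G; f \<in> Hom G x y; g \<in> Hom G y z\<rbrakk>
        \<Longrightarrow> Comp G x y z g f \<in> Hom G x z"
    and Comp_add_left:
      "\<lbrakk>x \<in> Obj G; y \<in> Obj G; z \<in> Obj G; f \<in> Hom G x y; g \<in> Hom G y z; g' \<in> Hom G y z\<rbrakk>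
        \<Longrightarrow> Comp G x y z (g + g') f = Comp G x y z g f + Comp G x y z g' f"
    and Comp_add_right:
      "\<lbrakk>x \<in> Obj G; y \<in> Obj G; z \<in> Obj G; f \<in> Hom G x y; f' \<in> Hom G x y; g \<in> Hom G y z\<rbrakk>
        \<Longrightarrow> Comp G x y z g (f + f') = Comp G x y z g f + Comp G x y z g f'"
    and Comp_Scale_left:
      "\<lbrakk>x \<in> Obj G; y \<in> Obj G; z \<in> Obj G; f \<in> Hom G x y; g \<in> Hom G y z\<rbrakk>
        \<Longrightarrow> Comp G x y z (Scale G c g) f = Scale G c (Comp G x y z g f)"
    and Comp_Scale_right:
      "\<lbrakk>x \<in> Obj G; y \<in> Obj G; z \<in> Obj G; f \<in> Hom G x y; g \<in> Hom G y z\<rbrakk>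
        \<Longrightarrow> Comp G x y z g (Scale G c f) = Scale G c (Comp G x y z g f)"
    and Comp_assoc:
      "\<lbrakk>w \<in> Obj G; x \<in> Obj G; y \<in> Obj G; z \<in> Obj G;
        f \<in> Hom G w x; g \<in> Hom G x y; h \<in> Hom G y z\<rbrakk>
        \<Longrightarrow> Comp G w y z h (Comp G w x y g f) = Comp G w x z (Comp G x y z h g) f"
    and Ide_closed: "x \<in> Obj G \<Longrightarrow> Ide G x \<in> Hom G x x"
    and Ide_left:
      "\<lbrakk>x \<in> Obj G; y \<in> Obj G; f \<in> Hom G x y\<rbrakk> \<Longrightarrow> Comp G x y y (Ide G y) f = f"
    and Ide_right:
      "\<lbrakk>x \<in> Obj G; y \<in> Obj G; f \<in> Hom G x y\<rbrakk> \<Longrightarrow> Comp G x x y f (Ide G x) = f"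

text \<open>
  A wide (linear) subcategory is determined by its Hom spaces, so we represent it by them.
\<close>

locale wide_subcategory = linear_category G
  for G :: "('k::field, 'o, 'm::ab_group_add) lincat" and U :: "'o \<Rightarrow> 'o \<Rightarrow> 'm set" +
  assumes sub_subset: "\<lbrakk>x \<in> Obj G; y \<in> Obj G\<rbrakk> \<Longrightarrow> U x y \<subseteq> Hom G x y"
    and sub_subspace: "\<lbrakk>x \<in> Obj G; y \<in> Obj G\<rbrakk> \<Longrightarrow> module.subspace (Scale G) (U x y)"
    and sub_Ide: "x \<in> Obj G \<Longrightarrow> Ide G x \<in> U x x"
    and sub_Comp:
      "\<lbrakk>x \<in> Obj G; y \<in> Obj G; z \<in> Obj G; f \<in> U x y; g \<in> U y z\<rbrakk>
        \<Longrightarrow> Comp G x y z g f \<in> U x z"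

definition isomorphic_in ::
    "('k, 'o, 'm::ab_group_add) lincat \<Rightarrow> 'o \<Rightarrow> 'o \<Rightarrow> bool" where
  "isomorphic_in G x y \<longleftrightarrow>
     (\<exists>f \<in> Hom G x y. \<exists>g \<in> Hom G y x. Comp G x y x g f = Ide G x \<and> Comp G y x y f g = Ide G y)"

definition iso_class :: "('k, 'o, 'm::ab_group_add) lincat \<Rightarrow> 'o \<Rightarrow> 'o set" where
  "iso_class G x = {y \<in> Obj G. isomorphic_in G x y}"

definition iso_classes :: "('k, 'o, 'm::ab_group_add) lincat \<Rightarrow> 'o set set" where
  "iso_classes G = iso_class G ` Obj G"

definition iso_representatives :: "('k, 'o, 'm::ab_group_add) lincat \<Rightarrow> 'o set \<Rightarrow> bool" where
  "iso_representatives G R \<longleftrightarrow>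
     R \<subseteq> Obj G \<and> (\<forall>x \<in> Obj G. \<exists>!y. y \<in> R \<and> isomorphic_in G x y)"

text \<open>
  The objects of a category whose object collection is a HOL set always form a "small" collection.
  To give the notion content, smallness is measured by a type \<open>'s\<close> unrelated to the type of
  objects: up to isomorphism, the objects form a family indexed by \<open>'s\<close>.
\<close>

definition essentially_small ::
    "'s itself \<Rightarrow> ('k, 'o, 'm::ab_group_add) lincat \<Rightarrow> bool" where
  "essentially_small s G \<longleftrightarrow>
     (\<exists>F :: 's \<Rightarrow> 'o. \<forall>x \<in> Obj G. \<exists>i. F i \<in> Obj G \<and> isomorphic_in G (F i) x)"

definition finite_dim_Hom :: "('k::field, 'o, 'm::ab_group_add) lincat \<Rightarrow> 'o \<Rightarrow> 'o \<Rightarrow> bool" where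
  "finite_dim_Hom G x y \<longleftrightarrow> (\<exists>B. finite B \<and> module.span (Scale G) B = Hom G x y)"


section \<open>Semisimple rings\<close>

definition left_ideal :: "'a set \<Rightarrow> ('a, 'b) ring_scheme \<Rightarrow> bool" where
  "left_ideal I R \<longleftrightarrow>
     additive_subgroup I R \<and> (\<forall>r \<in> carrier R. \<forall>a \<in> I. r \<otimes>\<^bsub>R\<^esub> a \<in> I)"

text \<open>
  The left regular module is semisimple: each of its submodules is a direct summand.
\<close>

definition semisimple_ring :: "('a, 'b) ring_scheme \<Rightarrow> bool" where
  "semisimple_ring R \<longleftrightarrow>
     ring R \<and>
     (\<forall>I. left_ideal I R \<longrightarrow>
        (\<exists>J. left_ideal J R \<and> I \<inter> J = {\<zero>\<^bsub>R\<^esub>} \<and> I <+>\<^bsub>R\<^esub> J = carrier R))"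

definition End_ring ::
    "('k, 'o, 'm::ab_group_add) lincat \<Rightarrow> ('o \<Rightarrow> 'o \<Rightarrow> 'm set) \<Rightarrow> 'o \<Rightarrow> 'm ring" where
  "End_ring G U x =
     \<lparr>carrier = U x x, monoid.mult = Comp G x x x, one = Ide G x, ring.zero = 0, ring.add = (+)\<rparr>"


section \<open>Tensor products over a non-commutative ring\<close>

text \<open>
  \<open>M\<close> is a right module with action \<open>ra m r\<close> and \<open>N\<close> a left module with action \<open>la r n\<close> over a
  ring with carrier \<open>A\<close>. The tensor product is the quotient of the free abelian group
  on \<open>M \<times> N\<close> by the usual relations.
\<close>

definition tensor_relators ::
    "'r set \<Rightarrow> 'm::ab_group_add set \<Rightarrow> ('m \<Rightarrow> 'r \<Rightarrow> 'm) \<Rightarrow>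
     'n::ab_group_add set \<Rightarrow> ('r \<Rightarrow> 'n \<Rightarrow> 'n) \<Rightarrow> ('m \<times> 'n \<Rightarrow>\<^sub>0 int) set" where
  "tensor_relators A M ra N la =
     {frag_of (m + m', n) - frag_of (m, n) - frag_of (m', n) | m m' n.
        m \<in> M \<and> m' \<in> M \<and> n \<in> N} \<union>
     {frag_of (m, n + n') - frag_of (m, n) - frag_of (m, n') | m n n'.
        m \<in> M \<and> n \<in> N \<and> n' \<in> N} \<union>
     {frag_of (ra m r, n) - frag_of (m, la r n) | m r n.
        m \<in> M \<and> r \<in> A \<and> n \<in> N}"

definition tensor_null ::
    "'r set \<Rightarrow> 'm::ab_group_add set \<Rightarrow> ('m \<Rightarrow> 'r \<Rightarrow> 'm) \<Rightarrow>
     'n::ab_group_add set \<Rightarrow> ('r \<Rightarrow> 'n \<Rightarrow> 'n) \<Rightarrow> ('m \<times> 'n \<Rightarrow>\<^sub>0 int) set" where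
  "tensor_null A M ra N la =
     generate (free_Abelian_group (M \<times> N)) (tensor_relators A M ra N la)"

definition tensor_product ::
    "'r set \<Rightarrow> 'm::ab_group_add set \<Rightarrow> ('m \<Rightarrow> 'r \<Rightarrow> 'm) \<Rightarrow>
     'n::ab_group_add set \<Rightarrow> ('r \<Rightarrow> 'n \<Rightarrow> 'n) \<Rightarrow> ('m \<times> 'n \<Rightarrow>\<^sub>0 int) set monoid" where
  "tensor_product A M ra N la = free_Abelian_group (M \<times> N) Mod tensor_null A M ra N la"

definition pure_tensor ::
    "'r set \<Rightarrow> 'm::ab_group_add set \<Rightarrow> ('m \<Rightarrow> 'r \<Rightarrow> 'm) \<Rightarrow>
     'n::ab_group_add set \<Rightarrow> ('r \<Rightarrow> 'n \<Rightarrow> 'n) \<Rightarrow> 'm \<Rightarrow> 'n \<Rightarrow> ('m \<times> 'n \<Rightarrow>\<^sub>0 int) set" where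
  "pure_tensor A M ra N la m n =
     tensor_null A M ra N la #>\<^bsub>free_Abelian_group (M \<times> N)\<^esub> frag_of (m, n)"


section \<open>Triangular categories\<close>

definition Hom_group :: "('k, 'o, 'm::ab_group_add) lincat \<Rightarrow> 'o \<Rightarrow> 'o \<Rightarrow> 'm monoid" where
  "Hom_group G x z = \<lparr>carrier = Hom G x z, monoid.mult = (+), one = 0\<rparr>"

definition triangular_tensor ::
    "('k, 'o, 'm::ab_group_add) lincat \<Rightarrow> ('o \<Rightarrow> 'o \<Rightarrow> 'm set) \<Rightarrow> ('o \<Rightarrow> 'o \<Rightarrow> 'm set) \<Rightarrow>
     'o \<Rightarrow> 'o \<Rightarrow> 'o \<Rightarrow> ('m \<times> 'm \<Rightarrow>\<^sub>0 int) set monoid" where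
  "triangular_tensor G U D x z y =
     tensor_product (U y y) (U y z) (Comp G y y z) (D x y) (Comp G x y y)"

definition triangular_pure ::
    "('k, 'o, 'm::ab_group_add) lincat \<Rightarrow> ('o \<Rightarrow> 'o \<Rightarrow> 'm set) \<Rightarrow> ('o \<Rightarrow> 'o \<Rightarrow> 'm set) \<Rightarrow>
     'o \<Rightarrow> 'o \<Rightarrow> 'o \<Rightarrow> 'm \<Rightarrow> 'm \<Rightarrow> ('m \<times> 'm \<Rightarrow>\<^sub>0 int) set" where
  "triangular_pure G U D x z y =
     pure_tensor (U y y) (U y z) (Comp G y y z) (D x y) (Comp G x y y)"

text \<open>
  In (T3), \<open>R\<close> is any system of representatives for the isomorphism classes. The elements
  \<open>g \<otimes> f\<close>, placed in the summand of \<open>y\<close>, generate the direct sum, so the additive map \<open>\<phi>\<close>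
  sending them to the composites \<open>g \<circ> f\<close> is unique; it is automatically linear for the scalar
  action \<open>c (g \<otimes> f) = (c g) \<otimes> f\<close>, hence is an isomorphism of vector spaces as soon as it is
  bijective.
\<close>

locale triangular_category =
  linear_category G + U: wide_subcategory G U + D: wide_subcategory G D
  for small :: "'s itself"
    and G :: "('k::alg_closed_field, 'o, 'm::ab_group_add) lincat"
    and U D :: "'o \<Rightarrow> 'o \<Rightarrow> 'm set" +
  assumes T0_small: "essentially_small small G"
    and T0_finite_dim: "\<lbrakk>x \<in> Obj G; y \<in> Obj G\<rbrakk> \<Longrightarrow> finite_dim_Hom G x y"
    and T1_eq: "x \<in> Obj G \<Longrightarrow> U x x = D x x"
    and T1_semisimple: "x \<in> Obj G \<Longrightarrow> semisimple_ring (End_ring G U x)"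
    and T2:
      "\<exists>r. partial_order_on (iso_classes G) r \<and>
           (\<forall>X \<in> iso_classes G. finite {Y \<in> iso_classes G. (Y, X) \<in> r}) \<and>
           (\<forall>x \<in> Obj G. \<forall>y \<in> Obj G.
              (\<exists>f \<in> U x y. f \<noteq> 0) \<longrightarrow> (iso_class G x, iso_class G y) \<in> r) \<and>
           (\<forall>x \<in> Obj G. \<forall>y \<in> Obj G.
              (\<exists>f \<in> D x y. f \<noteq> 0) \<longrightarrow> (iso_class G y, iso_class G x) \<in> r)"
    and T3:
      "\<lbrakk>iso_representatives G R; x \<in> Obj G; z \<in> Obj G\<rbrakk> \<Longrightarrow>
        \<exists>\<phi> \<in> iso (sum_group R (triangular_tensor G U D x z)) (Hom_group G x z).
          \<forall>y \<in> R. \<forall>g \<in> U y z. \<forall>f \<in> D x y.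
            \<phi> (\<lambda>w \<in> R. if w = y then triangular_pure G U D x z y g f
                       else \<one>\<^bsub>triangular_tensor G U D x z w\<^esub>)
            = Comp G x y z g f"


section \<open>The partition category\<close>

text \<open>
  The disjoint union of \<open>S\<close> and \<open>T\<close> is \<open>Sum_Type.Plus S T\<close> (\<open>Inl\<close> for the source, \<open>Inr\<close> for the target),
  and that of \<open>S\<close>, \<open>T\<close>, \<open>U\<close> is \<open>Sum_Type.Plus S (Sum_Type.Plus T U)\<close>.
\<close>

type_synonym 'a diagram = "('a + 'a) set set"

definition partition_diagrams :: "'a set \<Rightarrow> 'a set \<Rightarrow> 'a diagram set" where
  "partition_diagrams S T = {\<alpha>. partition_on (Sum_Type.Plus S T) \<alpha>}"

definition merge_meeting :: "'b set set \<Rightarrow> 'b set set" where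
  "merge_meeting P = Union ` (P // {(p, q). p \<in> P \<and> q \<in> P \<and> p \<inter> q \<noteq> {}}\<^sup>+)"

text \<open>
  \<open>stack \<beta> \<alpha>\<close> is the partition of the three-fold union obtained by merging the parts
  of \<open>\<alpha>\<close> (first and second summand) and of \<open>\<beta>\<close> (second and third summand).
\<close>

definition stack :: "'a diagram \<Rightarrow> 'a diagram \<Rightarrow> ('a + 'a + 'a) set set" where
  "stack \<beta> \<alpha> = merge_meeting ((`) (map_sum id Inl) ` \<alpha> \<union> (`) Inr ` \<beta>)"

text \<open>
  The outer two summands are embedded by \<open>map_sum id Inr\<close>, so intersecting with them is
  taking preimages.
\<close>

definition diagram_comp :: "'a diagram \<Rightarrow> 'a diagram \<Rightarrow> 'a diagram" where
  "diagram_comp \<beta> \<alpha> = (vimage (map_sum id Inr) ` stack \<beta> \<alpha>) - {{}}"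

definition middle_count :: "'a set \<Rightarrow> 'a diagram \<Rightarrow> 'a diagram \<Rightarrow> nat" where
  "middle_count T \<beta> \<alpha> = card {p \<in> stack \<beta> \<alpha>. p \<subseteq> Inr ` Inl ` T}"

definition partition_comp ::
    "complex \<Rightarrow> 'a set \<Rightarrow> 'a set \<Rightarrow> 'a set \<Rightarrow>
     ('a diagram \<Rightarrow>\<^sub>0 complex) \<Rightarrow> ('a diagram \<Rightarrow>\<^sub>0 complex) \<Rightarrow> ('a diagram \<Rightarrow>\<^sub>0 complex)" where
  "partition_comp \<delta> S T U g f =
     (\<Sum>\<beta> \<in> Poly_Mapping.keys g. \<Sum>\<alpha> \<in> Poly_Mapping.keys f.
        Poly_Mapping.single (diagram_comp \<beta> \<alpha>)
          (Poly_Mapping.lookup g \<beta> * Poly_Mapping.lookup f \<alpha> * \<delta> ^ middle_count T \<beta> \<alpha>))"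

text \<open>
  The objects are the finite subsets of a type \<open>'a\<close>. If \<open>'a\<close> is infinite, every finite set is in
  bijection with one of them.
\<close>

definition partition_category ::
    "complex \<Rightarrow> (complex, 'a set, 'a diagram \<Rightarrow>\<^sub>0 complex) lincat" where
  "partition_category \<delta> =
     \<lparr>Obj = {S. finite S},
      Hom = (\<lambda>S T. {f. Poly_Mapping.keys f \<subseteq> partition_diagrams S T}),
      Scale = (\<lambda>c. Poly_Mapping.map ((*) c)),
      Comp = partition_comp \<delta>,
      Ide = (\<lambda>S. Poly_Mapping.single ((\<lambda>s. {Inl s, Inr s}) ` S) 1)\<rparr>"

definition upwards_diagram :: "'a set \<Rightarrow> 'a set \<Rightarrow> 'a diagram \<Rightarrow> bool" where
  "upwards_diagram S T \<alpha> \<longleftrightarrow>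
     \<alpha> \<in> partition_diagrams S T \<and>
     (\<forall>p \<in> \<alpha>. p \<inter> Inr ` T \<noteq> {} \<and> card (p \<inter> Inl ` S) \<in> {0, 1})"

definition downwards_diagram :: "'a set \<Rightarrow> 'a set \<Rightarrow> 'a diagram \<Rightarrow> bool" where
  "downwards_diagram S T \<alpha> \<longleftrightarrow>
     \<alpha> \<in> partition_diagrams S T \<and>
     (\<forall>p \<in> \<alpha>. p \<inter> Inl ` S \<noteq> {} \<and> card (p \<inter> Inr ` T) \<in> {0, 1})"

definition upwards_Hom :: "complex \<Rightarrow> 'a set \<Rightarrow> 'a set \<Rightarrow> ('a diagram \<Rightarrow>\<^sub>0 complex) set" where
  "upwards_Hom \<delta> S T =
     module.span (Scale (partition_category \<delta>))
       ((\<lambda>\<alpha>. Poly_Mapping.single \<alpha> 1) ` {\<alpha>. upwards_diagram S T \<alpha>})"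

definition downwards_Hom :: "complex \<Rightarrow> 'a set \<Rightarrow> 'a set \<Rightarrow> ('a diagram \<Rightarrow>\<^sub>0 complex) set" where
  "downwards_Hom \<delta> S T =
     module.span (Scale (partition_category \<delta>))
       ((\<lambda>\<alpha>. Poly_Mapping.single \<alpha> 1) ` {\<alpha>. downwards_diagram S T \<alpha>})"

end

theory Submission
  imports Defs
begin

text \<open>
  A diagram from \<open>S\<close> to \<open>T\<close> is determined by its cuts, the pairs \<open>(A, B)\<close> with \<open>A \<subseteq> S\<close>, \<open>B \<subseteq> T\<close> such that
  \<open>A \<uplus> B\<close> is a union of parts. Composition of diagrams becomes composition of these relations, and
  the middle parts of a stack are counted by \<open>2 ^ c\<close>, the number of middle sets through which a
  given composite cut passes. This reduces the category axioms to associativity of relational composition and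
  a double count. Upwards diagrams are those whose relation is total and injective, downwards
  diagrams those whose relation is surjective and single-valued; on finite sets this gives (T1) and (T2),
  semisimplicity being Maschke's theorem.

  For (T3), every diagram factors as an upwards after a downwards diagram through a set with as many points
  as it has propagating parts, and such a factorisation is unique up to a permutation of that set.
  Choosing one factorisation per diagram gives a normal form for tensors, in which a tensor is
  determined by its composite.
\<close>

text \<open>The obstacle is merging: a part of a stack comes from a chain of meetings of any length,
  so iterated composites are awkward to compare part by part. A set respects the merged parts
  exactly when it respects the original ones. Seen through such sets, gluing is a conjunction of two
  local conditions, and forgetting the middle is an existential quantifier over the middle set. The
  exponent of \<delta> then has a meaning too: it measures how many witnesses this quantifier has.
  An injective relation leaves at most one witness, so a composite whose second factor is upwards
  carries no power of \<delta>. All compositions in (T1) and (T3) are of this kind, which turns both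
  conditions into statements about diagrams alone: the upwards endomorphisms of a set form a finite
  group, and a tensor of basis diagrams is controlled by the factorisations of one diagram.\<close>

abbreviation disjoint_sum :: "'a set \<Rightarrow> 'b set \<Rightarrow> ('a + 'b) set" (infixr "\<uplus>" 65) where
  "A \<uplus> B \<equiv> Sum_Type.Plus A B"

text \<open>Formulated for any family, not only for partitions, so that it also applies to the
  overlapping parts of two diagrams before they are merged. Points outside \<open>\<Union>P\<close>
  are invisible to it.\<close>

definition saturated :: "'b set set \<Rightarrow> 'b set set" where
  "saturated P = {Q. \<forall>p\<in>P. p \<subseteq> Q \<or> p \<inter> Q = {}}"

lemma saturatedD: "Q \<in> saturated P \<Longrightarrow> p \<in> P \<Longrightarrow> p \<subseteq> Q \<or> p \<inter> Q = {}"
  by (simp add: saturated_def)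

lemma Plus_Int: "(A \<uplus> B) \<inter> (A' \<uplus> B') = (A \<inter> A') \<uplus> (B \<inter> B')"
  by auto

lemma Union_in_saturated:
  assumes "partition_on X P" "F \<subseteq> P"
  shows "\<Union>F \<in> saturated P"
  unfolding saturated_def
proof (intro CollectI ballI)
  fix p assume p: "p \<in> P"
  show "p \<subseteq> \<Union>F \<or> p \<inter> \<Union>F = {}"
  proof (cases "p \<in> F")
    case False
    have "p \<inter> q = {}" if "q \<in> F" for q
      using assms p that False unfolding partition_on_def disjoint_def by (metis subsetD)
    then show ?thesis by blast
  qed blast
qed

text \<open>Each part is itself saturated and lies inside every saturated set that it meets. So a
  part of one partition contains any part of the other that it meets, and conversely.\<close>

lemma partition_eqI:
  assumes P: "partition_on X P" and Q: "partition_on X Q"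
    and sat: "\<And>Y. Y \<subseteq> X \<Longrightarrow> Y \<in> saturated P \<longleftrightarrow> Y \<in> saturated Q"
  shows "P = Q"
proof -
  have *: "P \<subseteq> Q" if P: "partition_on X P" and Q: "partition_on X Q"
    and sat: "\<And>Y. Y \<subseteq> X \<Longrightarrow> Y \<in> saturated P \<longleftrightarrow> Y \<in> saturated Q" for P Q
  proof
    fix p assume p: "p \<in> P"
    then obtain x where x: "x \<in> p" using P by (metis all_not_in_conv partition_onD3)
    have pX: "p \<subseteq> X" using P p partition_onD1 by blast
    then obtain q where q: "q \<in> Q" "x \<in> q" using Q x partition_onD1 by blast
    have qX: "q \<subseteq> X" using Q q partition_onD1 by blast
    have "p \<in> saturated P" using Union_in_saturated[OF P, of "{p}"] p by simp
    then have "p \<in> saturated Q" using sat pX by simp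
    then have "q \<subseteq> p" using q x by (auto simp: saturated_def)
    have "q \<in> saturated Q" using Union_in_saturated[OF Q, of "{q}"] q by simp
    then have "q \<in> saturated P" using sat qX by simp
    then have "p \<subseteq> q" using p q x by (auto simp: saturated_def)
    with \<open>q \<subseteq> p\<close> q show "p \<in> Q" by auto
  qed
  show ?thesis using *[OF P Q sat] *[OF Q P] sat by blast
qed

subsection \<open>Merging\<close>

lemma merge_meeting_eq:
  "merge_meeting P = (\<lambda>p. \<Union>({(p, q). p \<in> P \<and> q \<in> P \<and> p \<inter> q \<noteq> {}}\<^sup>+ `` {p})) ` P"
  by (auto simp: merge_meeting_def quotient_def)

text \<open>If two members meet, then one lies inside \<open>Q\<close> exactly when the other does,
  provided that \<open>Q\<close> is saturated. This passes along chains, and the transitive closure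
  disappears.\<close>

lemma saturated_merge_meeting:
  assumes "{} \<notin> P"
  shows "saturated (merge_meeting P) = saturated P"
proof -
  let ?r = "{(p, q). p \<in> P \<and> q \<in> P \<and> p \<inter> q \<noteq> {}}"
  have "Q \<in> saturated P" if Q: "Q \<in> saturated (merge_meeting P)" for Q
    unfolding saturated_def
    proof (intro CollectI ballI)
      fix p assume p: "p \<in> P"
      then have "(p, p) \<in> ?r" using assms by auto
      then have "p \<subseteq> \<Union>(?r\<^sup>+ `` {p})" by (meson ImageI Union_upper r_into_trancl singletonI)
      moreover have "\<Union>(?r\<^sup>+ `` {p}) \<in> merge_meeting P" using p unfolding merge_meeting_eq by blast
      ultimately show "p \<subseteq> Q \<or> p \<inter> Q = {}" using Q unfolding saturated_def by blast
    qed
  moreover have "Q \<in> saturated (merge_meeting P)" if Q: "Q \<in> saturated P" for Q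
  proof -
    have step: "(p \<subseteq> Q \<longleftrightarrow> q \<subseteq> Q) \<and> p \<in> P \<and> q \<in> P" if "(p, q) \<in> ?r\<^sup>+" for p q
      using that
    proof (induction rule: trancl_induct)
      case (base y)
      then show ?case using Q unfolding saturated_def by blast
    next
      case (step y z)
      then show ?case using Q unfolding saturated_def by blast
    qed
    show "Q \<in> saturated (merge_meeting P)" unfolding saturated_def merge_meeting_eq
    proof (intro CollectI ballI)
      fix m assume "m \<in> (\<lambda>p. \<Union> (?r\<^sup>+ `` {p})) ` P"
      then obtain p where p: "p \<in> P" "m = \<Union> (?r\<^sup>+ `` {p})" by blast
      show "m \<subseteq> Q \<or> m \<inter> Q = {}"
      proof (rule ccontr)
        assume "\<not> (m \<subseteq> Q \<or> m \<inter> Q = {})"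
        then obtain q q' where "(p, q) \<in> ?r\<^sup>+" "\<not> q \<subseteq> Q" "(p, q') \<in> ?r\<^sup>+" "q' \<inter> Q \<noteq> {}"
          unfolding p(2) by blast
        then show False using step[of p q] step[of p q'] Q unfolding saturated_def by blast
      qed
    qed
  qed
  ultimately show ?thesis by blast
qed

text \<open>Nonempty members meet themselves, so the transitive closure of the meeting relation is
  already reflexive on \<open>P\<close>, hence an equivalence.\<close>

lemma partition_on_merge_meeting:
  assumes ne: "{} \<notin> P"
  shows "partition_on (\<Union>P) (merge_meeting P)"
proof (rule partition_onI)
  let ?r = "{(p, q). p \<in> P \<and> q \<in> P \<and> p \<inter> q \<noteq> {}}"
  have refl: "(p, p) \<in> ?r\<^sup>+" if "p \<in> P" for p using that ne by (intro r_into_trancl) auto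
  have ran: "q \<in> P" if "(p, q) \<in> ?r\<^sup>+" for p q using that by (induction rule: trancl_induct) auto
  have sym: "sym (?r\<^sup>+)" by (rule sym_trancl) (auto simp: sym_def)
  show "\<Union> (merge_meeting P) = \<Union> P"
    unfolding merge_meeting_eq
  proof (intro equalityI subsetI)
    fix x assume "x \<in> \<Union> P"
    then obtain p where "p \<in> P" "x \<in> p" by blast
    then show "x \<in> \<Union> ((\<lambda>p. \<Union> (?r\<^sup>+ `` {p})) ` P)" using refl[of p] by blast
  next
    fix x assume "x \<in> \<Union> ((\<lambda>p. \<Union> (?r\<^sup>+ `` {p})) ` P)"
    then obtain p q where "(p, q) \<in> ?r\<^sup>+" "x \<in> q" by blast
    then show "x \<in> \<Union> P" using ran[of p q] by blast
  qed
  show "{} \<notin> merge_meeting P"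
  proof
    assume "{} \<in> merge_meeting P"
    then obtain p where p: "p \<in> P" "{} = \<Union> (?r\<^sup>+ `` {p})" unfolding merge_meeting_eq by blast
    then have "p = {}" using refl[of p] by blast
    then show False using p(1) ne by simp
  qed
  fix m m' assume "m \<in> merge_meeting P" "m' \<in> merge_meeting P" and neq: "m \<noteq> m'"
  then obtain p p' where p: "m = \<Union> (?r\<^sup>+ `` {p})" "m' = \<Union> (?r\<^sup>+ `` {p'})"
    unfolding merge_meeting_eq by blast
  show "disjnt m m'"
  proof (rule ccontr)
    assume "\<not> disjnt m m'"
    then obtain x q q' where "x \<in> q" "x \<in> q'" "(p, q) \<in> ?r\<^sup>+" "(p', q') \<in> ?r\<^sup>+"
      using p by (auto simp: disjnt_def)
    then have "(q, q') \<in> ?r\<^sup>+" using ran[of p q] ran[of p' q'] by (intro r_into_trancl) blast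
    then have "(p, p') \<in> ?r\<^sup>+" using \<open>(p, q) \<in> ?r\<^sup>+\<close> \<open>(p', q') \<in> ?r\<^sup>+\<close> sym
      by (meson symD trancl_trans)
    then have "?r\<^sup>+ `` {p} = ?r\<^sup>+ `` {p'}" using sym
      by (auto dest: trancl_trans symD)
    then show False using p neq by simp
  qed
qed

text \<open>A part that reaches \<open>N\<close> is taken or left according to the prescribed trace
  on \<open>N\<close>; the parts inside \<open>M\<close> can be chosen freely. Taking
  \<open>M\<close> to be the middle of a stack turns the exponent of \<delta> into a
  cardinality.\<close>

lemma card_saturated_between:
  assumes P: "partition_on (M \<union> N) P" and MN: "M \<inter> N = {}" and fin: "finite M"
    and Q0: "Q\<^sub>0 \<in> saturated P" "Q\<^sub>0 \<subseteq> M \<union> N"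
  shows "card {Q \<in> saturated P. Q \<subseteq> M \<union> N \<and> Q \<inter> N = Q\<^sub>0 \<inter> N} = 2 ^ card {p\<in>P. p \<subseteq> M}"
proof -
  let ?A = "{Q \<in> saturated P. Q \<subseteq> M \<union> N \<and> Q \<inter> N = Q\<^sub>0 \<inter> N}"
  let ?B = "{p\<in>P. p \<subseteq> M}"
  have U: "\<Union>P = M \<union> N" using P by (simp add: partition_on_def)
  have ne: "p \<noteq> {}" if "p \<in> P" for p using that P by (metis partition_onD3)
  have dj: "p \<inter> q = {}" if "p \<in> P" "q \<in> P" "p \<noteq> q" for p q
    using that P unfolding partition_on_def disjoint_def by blast
  have sat: "p \<subseteq> Q \<or> p \<inter> Q = {}" if "p \<in> P" "Q \<in> saturated P" for p Q
    using that by (auto simp: saturated_def)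
  \<comment> \<open>The second union collects the forced parts: a part not inside \<open>M\<close>
    contains a point of \<open>N\<close>, where the trace of \<open>Q\<^sub>0\<close> decides about
    it.\<close>
  let ?f = "\<lambda>F. \<Union>F \<union> \<Union>{p\<in>P. p \<subseteq> Q\<^sub>0 \<and> \<not> p \<subseteq> M}"
  have bij: "bij_betw ?f (Pow ?B) ?A"
  proof (rule bij_betw_imageI)
    show "inj_on ?f (Pow ?B)"
    proof (rule inj_onI)
      have *: "F \<subseteq> F'" if F: "F \<in> Pow ?B" "F' \<in> Pow ?B" and eq: "?f F = ?f F'" for F F'
      proof
        fix p assume p: "p \<in> F"
        then obtain x where x: "x \<in> p" using F ne[of p] by blast
        then have "x \<in> ?f F" using p by blast
        then have "x \<in> ?f F'" unfolding eq .
        then obtain q where "q \<in> F' \<or> q \<in> P \<and> \<not> q \<subseteq> M" "x \<in> q" by blast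
        then have "q = p" using dj[of p q] x p F by blast
        then show "p \<in> F'" using \<open>q \<in> F' \<or> _\<close> p F by blast
      qed
      fix F F' assume "F \<in> Pow ?B" "F' \<in> Pow ?B" "?f F = ?f F'"
      then show "F = F'" using *[of F F'] *[of F' F] by auto
    qed
    show "?f ` Pow ?B = ?A"
    proof (intro equalityI subsetI)
      fix Q assume "Q \<in> ?f ` Pow ?B"
      then obtain F where F: "F \<subseteq> ?B" "Q = ?f F" by blast
      have "Q = \<Union>(F \<union> {p\<in>P. p \<subseteq> Q\<^sub>0 \<and> \<not> p \<subseteq> M})" using F by auto
      then have "Q \<in> saturated P" using Union_in_saturated[OF P, of "F \<union> {p\<in>P. p \<subseteq> Q\<^sub>0 \<and> \<not> p \<subseteq> M}"] F
        by auto
      moreover have "Q \<subseteq> M \<union> N" using F U by blast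
      moreover have "Q \<inter> N = Q\<^sub>0 \<inter> N"
      proof (intro equalityI subsetI)
        fix x assume "x \<in> Q \<inter> N"
        then show "x \<in> Q\<^sub>0 \<inter> N" using F MN by blast
      next
        fix x assume x: "x \<in> Q\<^sub>0 \<inter> N"
        then obtain p where "p \<in> P" "x \<in> p" using U by blast
        then show "x \<in> Q \<inter> N" using F MN x sat[OF _ Q0(1)] by blast
      qed
      ultimately show "Q \<in> ?A" by blast
    next
      fix Q assume Q: "Q \<in> ?A"
      have "Q = ?f {p\<in>P. p \<subseteq> Q \<and> p \<subseteq> M}"
      proof (intro equalityI subsetI)
        fix x assume x: "x \<in> Q"
        then obtain p where p: "p \<in> P" "x \<in> p" using U Q by blast
        then have "p \<subseteq> Q" using x sat Q by blast
        show "x \<in> ?f {p\<in>P. p \<subseteq> Q \<and> p \<subseteq> M}"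
        proof (cases "p \<subseteq> M")
          case True then show ?thesis using p \<open>p \<subseteq> Q\<close> by blast
        next
          case False
          then obtain y where "y \<in> p" "y \<in> N" using p U by blast
          then have "y \<in> Q\<^sub>0" using Q \<open>p \<subseteq> Q\<close> by blast
          then have "p \<subseteq> Q\<^sub>0" using \<open>y \<in> p\<close> p sat[OF _ Q0(1)] by blast
          then show ?thesis using False p by blast
        qed
      next
        fix x assume "x \<in> ?f {p\<in>P. p \<subseteq> Q \<and> p \<subseteq> M}"
        then consider "x \<in> Q" | p where "p \<in> P" "x \<in> p" "p \<subseteq> Q\<^sub>0" "\<not> p \<subseteq> M" by blast
        then show "x \<in> Q"
        proof cases
          case 2
          then obtain y where "y \<in> p" "y \<in> N" using U by blast
          then have "y \<in> Q" using Q 2 by blast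
          then show ?thesis using 2(1,2) \<open>y \<in> p\<close> sat[of p Q] Q by blast
        qed
      qed
      then show "Q \<in> ?f ` Pow ?B" by blast
    qed
  qed
  have "finite ?B" by (rule finite_subset[of _ "Pow M"]) (use fin in auto)
  then show ?thesis using bij_betw_same_card[OF bij] card_Pow[of ?B] by simp
qed

subsection \<open>The relation of a diagram\<close>

text \<open>The bounds on \<open>A\<close> and \<open>B\<close> remove the points outside \<alpha>,
  about which saturation says nothing; only then does the relation have its domain in
  \<open>Pow S\<close> and its range in \<open>Pow T\<close>.\<close>

definition cut_rel :: "'a set \<Rightarrow> 'a set \<Rightarrow> 'a diagram \<Rightarrow> ('a set \<times> 'a set) set" where
  "cut_rel S T \<alpha> = {(A, B). A \<subseteq> S \<and> B \<subseteq> T \<and> A \<uplus> B \<in> saturated \<alpha>}"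

lemma Plus_subset_Plus: "A \<uplus> B \<subseteq> A' \<uplus> B' \<longleftrightarrow> A \<subseteq> A' \<and> B \<subseteq> B'"
  by auto

lemma Plus_vimage: "(Q :: ('a + 'b) set) = (Inl -` Q) \<uplus> (Inr -` Q)"
  by (auto elim: sumE) (metis obj_sumE InlI InrI vimageI)

text \<open>The bridge back from relations: equalities between composite diagrams are proved by
  comparing their relations.\<close>

lemma diagram_eqI:
  assumes "\<alpha> \<in> partition_diagrams S T" "\<beta> \<in> partition_diagrams S T" "cut_rel S T \<alpha> = cut_rel S T \<beta>"
  shows "\<alpha> = \<beta>"
proof (rule partition_eqI[of "S \<uplus> T"])
  fix Y :: "('a + 'a) set" assume Y: "Y \<subseteq> S \<uplus> T"
  obtain A B where AB: "Y = A \<uplus> B" using Plus_vimage by blast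
  have "(A, B) \<in> cut_rel S T \<alpha> \<longleftrightarrow> (A, B) \<in> cut_rel S T \<beta>" using assms by simp
  then show "Y \<in> saturated \<alpha> \<longleftrightarrow> Y \<in> saturated \<beta>"
    using Y unfolding AB cut_rel_def Plus_subset_Plus by simp
qed (use assms in \<open>auto simp: partition_diagrams_def\<close>)

lemma finite_partition_diagrams: "finite S \<Longrightarrow> finite T \<Longrightarrow> finite (partition_diagrams S T)"
  unfolding partition_diagrams_def using finitely_many_partition_on[of "S \<uplus> T"] by simp

locale composable =
  fixes S T U :: "'a set" and \<alpha> \<beta> :: "'a diagram"
  assumes \<alpha>: "\<alpha> \<in> partition_diagrams S T" and \<beta>: "\<beta> \<in> partition_diagrams T U"
begin

lemma partition_on_stack: "partition_on (S \<uplus> T \<uplus> U) (stack \<beta> \<alpha>)"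
proof -
  let ?P = "(`) (map_sum id Inl) ` \<alpha> \<union> (`) Inr ` \<beta>"
  have "{} \<notin> ?P" using \<alpha> \<beta> by (auto simp: partition_diagrams_def partition_on_def)
  moreover have "\<Union>?P = S \<uplus> T \<uplus> U"
  proof -
    have "\<Union>?P = map_sum id Inl ` (\<Union>\<alpha>) \<union> Inr ` (\<Union>\<beta>)" by blast
    also have "\<Union>\<alpha> = S \<uplus> T" using \<alpha> by (simp add: partition_diagrams_def partition_on_def)
    also have "\<Union>\<beta> = T \<uplus> U" using \<beta> by (simp add: partition_diagrams_def partition_on_def)
    finally show ?thesis by (simp add: Plus_def image_Un image_image Un_assoc id_def)
  qed
  ultimately show ?thesis unfolding stack_def using partition_on_merge_meeting by metis
qed

text \<open>Merging does not change the saturated sets, so the condition can be tested on the parts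
  of \<alpha> and of \<beta> separately, and each of them sees only two of the three layers.\<close>

lemma saturated_stack_iff:
  "A \<uplus> B \<uplus> C \<in> saturated (stack \<beta> \<alpha>) \<longleftrightarrow> A \<uplus> B \<in> saturated \<alpha> \<and> B \<uplus> C \<in> saturated \<beta>"
proof -
  let ?P = "(`) (map_sum id Inl) ` \<alpha> \<union> (`) Inr ` \<beta>"
  have "{} \<notin> ?P" using \<alpha> \<beta> by (auto simp: partition_diagrams_def partition_on_def)
  then have "saturated (stack \<beta> \<alpha>) = saturated ?P" by (simp add: stack_def saturated_merge_meeting)
  moreover have "map_sum id Inl ` p \<subseteq> A \<uplus> B \<uplus> C \<longleftrightarrow> p \<subseteq> A \<uplus> B" for p
  proof -
    have "p \<subseteq> map_sum id Inl -` (A \<uplus> B \<uplus> C) \<longleftrightarrow> p \<subseteq> A \<uplus> B"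
      by (rule arg_cong[where f = "\<lambda>q. p \<subseteq> q"]) (auto simp: map_sum_def Plus_def split: sum.splits)
    then show ?thesis by (simp add: image_subset_iff_subset_vimage)
  qed
  moreover have "map_sum id Inl ` p \<inter> (A \<uplus> B \<uplus> C) = {} \<longleftrightarrow> p \<inter> (A \<uplus> B) = {}" for p
  proof -
    have "p \<inter> map_sum id Inl -` (A \<uplus> B \<uplus> C) = p \<inter> (A \<uplus> B)"
      by (auto simp: map_sum_def Plus_def split: sum.splits)
    then show ?thesis by blast
  qed
  moreover have "Inr ` p \<subseteq> A \<uplus> B \<uplus> C \<longleftrightarrow> p \<subseteq> B \<uplus> C" for p :: "('a+'a) set"
    by (auto simp: Plus_def)
  moreover have "Inr ` p \<inter> (A \<uplus> B \<uplus> C) = {} \<longleftrightarrow> p \<inter> (B \<uplus> C) = {}" for p :: "('a+'a) set"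
    by (auto simp: Plus_def)
  ultimately show ?thesis unfolding saturated_def by (simp add: ball_Un)
qed

lemma diagram_comp_closed: "diagram_comp \<beta> \<alpha> \<in> partition_diagrams S U"
proof -
  have "map_sum id Inr -` (S \<uplus> T \<uplus> U) = S \<uplus> U"
    by (auto simp: map_sum_def Plus_def split: sum.splits)
  then show ?thesis unfolding partition_diagrams_def diagram_comp_def
    using partition_on_vimage[OF partition_on_stack, of "map_sum id Inr"] by simp
qed

lemma cut_rel_diagram_comp: "cut_rel S U (diagram_comp \<beta> \<alpha>) = cut_rel S T \<alpha> O cut_rel T U \<beta>"
proof (rule subset_antisym; rule subrelI)
  let ?v = "(-`) (map_sum id Inr)"
  have v: "?v (A \<uplus> B \<uplus> C) = A \<uplus> C" for A B C :: "'a set"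
    by (auto simp: map_sum_def Plus_def split: sum.splits)
  fix A C
  {
    assume "(A, C) \<in> cut_rel S U (diagram_comp \<beta> \<alpha>)"
    then have AC: "A \<subseteq> S" "C \<subseteq> U" "A \<uplus> C \<in> saturated (diagram_comp \<beta> \<alpha>)" by (auto simp: cut_rel_def)
    \<comment> \<open>The stack parts that touch the outer cut. The middle set is read off their
      union; parts lying wholly in the middle could be added at will and are left out.\<close>
    define F where "F = {p \<in> stack \<beta> \<alpha>. ?v p \<inter> (A \<uplus> C) \<noteq> {}}"
    obtain A' B C' where ABC: "\<Union>F = A' \<uplus> B \<uplus> C'" using Plus_vimage by metis
    have F: "F \<subseteq> stack \<beta> \<alpha>" by (auto simp: F_def)
    have sat: "\<Union>F \<in> saturated (stack \<beta> \<alpha>)" by (rule Union_in_saturated[OF partition_on_stack F])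
    have "\<Union>F \<subseteq> S \<uplus> T \<uplus> U" using F partition_on_stack by (auto simp: partition_on_def)
    then have B: "B \<subseteq> T" unfolding ABC Plus_subset_Plus by simp
    have "?v (\<Union>F) = A \<uplus> C"
    proof (intro equalityI subsetI)
      fix x assume "x \<in> ?v (\<Union>F)"
      then obtain p where p: "p \<in> F" "x \<in> ?v p" by auto
      then have "?v p \<in> diagram_comp \<beta> \<alpha>" by (auto simp: diagram_comp_def F_def)
      moreover have "?v p \<inter> (A \<uplus> C) \<noteq> {}" using p(1) by (simp add: F_def)
      ultimately show "x \<in> A \<uplus> C" using saturatedD[OF AC(3), of "?v p"] p(2) by (meson subsetD)
    next
      fix x assume x: "x \<in> A \<uplus> C"
      then have "x \<in> ?v (S \<uplus> T \<uplus> U)" using AC v by blast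
      then have "x \<in> ?v (\<Union>(stack \<beta> \<alpha>))" using partition_on_stack by (simp add: partition_on_def)
      then show "x \<in> ?v (\<Union>F)" using x by (auto simp: F_def)
    qed
    then have "A' \<uplus> C' = A \<uplus> C" unfolding ABC v .
    then have "A' = A" "C' = C" using Plus_subset_Plus by (metis order_antisym order_refl)+
    then have "A \<uplus> B \<in> saturated \<alpha>" "B \<uplus> C \<in> saturated \<beta>"
      using sat unfolding ABC saturated_stack_iff by auto
    then show "(A, C) \<in> cut_rel S T \<alpha> O cut_rel T U \<beta>" using AC B by (auto simp: cut_rel_def)
  next
    assume "(A, C) \<in> cut_rel S T \<alpha> O cut_rel T U \<beta>"
    then obtain B where "(A, B) \<in> cut_rel S T \<alpha>" "(B, C) \<in> cut_rel T U \<beta>" by blast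
    then have *: "A \<uplus> B \<uplus> C \<in> saturated (stack \<beta> \<alpha>)" "A \<subseteq> S" "C \<subseteq> U"
      unfolding saturated_stack_iff by (auto simp: cut_rel_def)
    have "A \<uplus> C \<in> saturated (diagram_comp \<beta> \<alpha>)" unfolding saturated_def diagram_comp_def
    proof (intro CollectI ballI)
      fix q assume "q \<in> ?v ` stack \<beta> \<alpha> - {{}}"
      then obtain p where p: "p \<in> stack \<beta> \<alpha>" "q = ?v p" by blast
      have "p \<subseteq> A \<uplus> B \<uplus> C \<or> p \<inter> (A \<uplus> B \<uplus> C) = {}" using * p by (auto simp: saturated_def)
      then show "q \<subseteq> A \<uplus> C \<or> q \<inter> (A \<uplus> C) = {}" unfolding p(2)
        by (metis v vimage_Int vimage_empty vimage_mono)
    qed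
    then show "(A, C) \<in> cut_rel S U (diagram_comp \<beta> \<alpha>)" using * by (simp add: cut_rel_def)
  }
qed

text \<open>The middle sets that join \<open>A\<close> to \<open>C\<close> are the middle layers of
  the saturated sets of the stack whose outer layers are \<open>A\<close> and \<open>C\<close>. The
  number does not depend on the cut, which is what makes double counting possible.\<close>

lemma card_middle:
  assumes T: "finite T" and AC: "(A, C) \<in> cut_rel S U (diagram_comp \<beta> \<alpha>)"
  shows "card {B. (A, B) \<in> cut_rel S T \<alpha> \<and> (B, C) \<in> cut_rel T U \<beta>} = 2 ^ middle_count T \<beta> \<alpha>"
proof -
  obtain B\<^sub>0 where B0: "(A, B\<^sub>0) \<in> cut_rel S T \<alpha>" "(B\<^sub>0, C) \<in> cut_rel T U \<beta>"
    using AC unfolding cut_rel_diagram_comp by blast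
  let ?Q0 = "A \<uplus> B\<^sub>0 \<uplus> C" and ?M = "({} :: 'a set) \<uplus> T \<uplus> ({} :: 'a set)" and ?N = "S \<uplus> ({} :: 'a set) \<uplus> U"
  have MN: "?M \<union> ?N = S \<uplus> T \<uplus> U" by auto
  have M: "?M = Inr ` Inl ` T" by auto
  have sub: "A \<subseteq> S" "C \<subseteq> U" using B0 by (auto simp: cut_rel_def)
  have "card {Q \<in> saturated (stack \<beta> \<alpha>). Q \<subseteq> ?M \<union> ?N \<and> Q \<inter> ?N = ?Q0 \<inter> ?N} = 2 ^ card {p\<in>stack \<beta> \<alpha>. p \<subseteq> ?M}"
  proof (rule card_saturated_between)
    show "partition_on (?M \<union> ?N) (stack \<beta> \<alpha>)" unfolding MN by (rule partition_on_stack)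
    show "?M \<inter> ?N = {}" by auto
    show "finite ?M" using T by simp
    show "?Q0 \<in> saturated (stack \<beta> \<alpha>)" using B0 unfolding saturated_stack_iff by (simp add: cut_rel_def)
    show "?Q0 \<subseteq> ?M \<union> ?N" using B0 unfolding MN Plus_subset_Plus by (simp add: cut_rel_def)
  qed
  also have "{Q \<in> saturated (stack \<beta> \<alpha>). Q \<subseteq> ?M \<union> ?N \<and> Q \<inter> ?N = ?Q0 \<inter> ?N}
      = (\<lambda>B. A \<uplus> B \<uplus> C) ` {B. (A, B) \<in> cut_rel S T \<alpha> \<and> (B, C) \<in> cut_rel T U \<beta>}" (is "?L = ?R")
  proof (intro equalityI subsetI)
    fix Q assume Q: "Q \<in> ?L"
    obtain A' B C' where ABC: "Q = A' \<uplus> B \<uplus> C'" using Plus_vimage by metis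
    have Q1: "Q \<in> saturated (stack \<beta> \<alpha>)" and Q2: "Q \<subseteq> S \<uplus> T \<uplus> U" and Q3: "Q \<inter> ?N = ?Q0 \<inter> ?N"
      using Q unfolding MN by auto
    have "A' \<subseteq> S" "B \<subseteq> T" "C' \<subseteq> U" using Q2 unfolding ABC Plus_subset_Plus by auto
    moreover have "A' \<uplus> ({} :: 'a set) \<uplus> C' = A \<uplus> ({} :: 'a set) \<uplus> C"
      using Q3 sub \<open>A' \<subseteq> S\<close> \<open>C' \<subseteq> U\<close> unfolding ABC Plus_Int by (simp only: Int_absorb2 Int_empty_right)
    then have "A' = A" "C' = C" using Plus_subset_Plus by (metis order_antisym order_refl)+
    ultimately show "Q \<in> ?R" using Q1 unfolding ABC saturated_stack_iff by (auto simp: cut_rel_def)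
  next
    fix Q assume "Q \<in> ?R"
    then obtain B where B: "Q = A \<uplus> B \<uplus> C" "(A, B) \<in> cut_rel S T \<alpha>" "(B, C) \<in> cut_rel T U \<beta>" by blast
    then have "Q \<in> saturated (stack \<beta> \<alpha>)" unfolding B(1) saturated_stack_iff by (simp add: cut_rel_def)
    moreover have "Q \<subseteq> S \<uplus> T \<uplus> U" using B(2,3) unfolding B(1) Plus_subset_Plus by (simp add: cut_rel_def)
    moreover have "Q \<inter> ?N = ?Q0 \<inter> ?N" unfolding B(1) Plus_Int by simp
    ultimately show "Q \<in> ?L" unfolding MN by simp
  qed
  also have "card \<dots> = card {B. (A, B) \<in> cut_rel S T \<alpha> \<and> (B, C) \<in> cut_rel T U \<beta>}"
    by (rule card_image, rule inj_onI) (metis Plus_subset_Plus order_antisym order_refl)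
  finally show ?thesis by (simp only: middle_count_def M)
qed

text \<open>The empty cut always passes. If it has a single middle set, then 2 to the power of the
  count is 1.\<close>

lemma middle_count_eq_0:
  assumes T: "finite T"
    and uniq: "\<And>A B B' C. \<lbrakk>(A, B) \<in> cut_rel S T \<alpha>; (B, C) \<in> cut_rel T U \<beta>; (A, B') \<in> cut_rel S T \<alpha>;
        (B', C) \<in> cut_rel T U \<beta>\<rbrakk> \<Longrightarrow> B = B'"
  shows "middle_count T \<beta> \<alpha> = 0"
proof -
  have e: "({}, {}) \<in> cut_rel S T \<alpha>" "({}, {}) \<in> cut_rel T U \<beta>" by (auto simp: cut_rel_def saturated_def)
  then have "({}, {}) \<in> cut_rel S U (diagram_comp \<beta> \<alpha>)" unfolding cut_rel_diagram_comp by blast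
  from card_middle[OF T this]
  have "card {B. ({}, B) \<in> cut_rel S T \<alpha> \<and> (B, {}) \<in> cut_rel T U \<beta>} = 2 ^ middle_count T \<beta> \<alpha>" .
  moreover have "{B. ({}, B) \<in> cut_rel S T \<alpha> \<and> (B, {}) \<in> cut_rel T U \<beta>} = {{}}"
    using e uniq by blast
  ultimately show ?thesis by (simp, metis One_nat_def Suc_1 n_not_Suc_n nat_power_eq_Suc_0_iff)
qed

end

subsection \<open>Associativity and identities\<close>

lemma cut_rel_subset: "cut_rel S T \<alpha> \<subseteq> Pow S \<times> Pow T"
  by (auto simp: cut_rel_def)

lemma empty_in_cut_rel: "({}, {}) \<in> cut_rel S T \<alpha>"
  by (auto simp: cut_rel_def saturated_def)

lemma diagram_comp_assoc:
  assumes \<alpha>: "\<alpha> \<in> partition_diagrams S T" and \<beta>: "\<beta> \<in> partition_diagrams T U"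
    and \<gamma>: "\<gamma> \<in> partition_diagrams U V"
  shows "diagram_comp \<gamma> (diagram_comp \<beta> \<alpha>) = diagram_comp (diagram_comp \<gamma> \<beta>) \<alpha>"
proof -
  interpret ba: composable S T U \<alpha> \<beta> by standard fact+
  interpret gb: composable T U V \<beta> \<gamma> by standard fact+
  interpret gba: composable S U V "diagram_comp \<beta> \<alpha>" \<gamma> by standard (rule ba.diagram_comp_closed, fact)
  interpret gba': composable S T V \<alpha> "diagram_comp \<gamma> \<beta>" by standard (fact, rule gb.diagram_comp_closed)
  show ?thesis
    by (rule diagram_eqI[OF gba.diagram_comp_closed gba'.diagram_comp_closed])
      (simp add: ba.cut_rel_diagram_comp gb.cut_rel_diagram_comp gba.cut_rel_diagram_comp
        gba'.cut_rel_diagram_comp O_assoc)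
qed

text \<open>Both sides count, in powers of 2, the cuts of the fourfold union that are empty on its ends.\<close>

lemma middle_count_assoc:
  assumes \<alpha>: "\<alpha> \<in> partition_diagrams S T" and \<beta>: "\<beta> \<in> partition_diagrams T U"
    and \<gamma>: "\<gamma> \<in> partition_diagrams U V" and fin: "finite T" "finite U"
  shows "middle_count T \<beta> \<alpha> + middle_count U \<gamma> (diagram_comp \<beta> \<alpha>)
       = middle_count U \<gamma> \<beta> + middle_count T (diagram_comp \<gamma> \<beta>) \<alpha>"
proof -
  interpret ba: composable S T U \<alpha> \<beta> by standard fact+
  interpret gb: composable T U V \<beta> \<gamma> by standard fact+
  interpret gba: composable S U V "diagram_comp \<beta> \<alpha>" \<gamma> by standard (rule ba.diagram_comp_closed, fact)
  interpret gba': composable S T V \<alpha> "diagram_comp \<gamma> \<beta>" by standard (fact, rule gb.diagram_comp_closed)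
  let ?P = "\<lambda>B C. ({}, B) \<in> cut_rel S T \<alpha> \<and> (B, C) \<in> cut_rel T U \<beta> \<and> (C, {}) \<in> cut_rel U V \<gamma>"
  let ?X = "{C. ({}, C) \<in> cut_rel S U (diagram_comp \<beta> \<alpha>) \<and> (C, {}) \<in> cut_rel U V \<gamma>}"
  let ?Y = "{B. ({}, B) \<in> cut_rel S T \<alpha> \<and> (B, {}) \<in> cut_rel T V (diagram_comp \<gamma> \<beta>)}"
  have finX: "finite ?X" by (rule finite_subset[of _ "Pow U"]) (use fin cut_rel_subset in \<open>blast+\<close>)
  have finY: "finite ?Y" by (rule finite_subset[of _ "Pow T"]) (use fin cut_rel_subset in \<open>blast+\<close>)
  have finB: "finite {B. ?P B C}" for C
    by (rule finite_subset[of _ "Pow T"]) (use fin cut_rel_subset in \<open>blast+\<close>)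
  have finC: "finite {C. ?P B C}" for B
    by (rule finite_subset[of _ "Pow U"]) (use fin cut_rel_subset in \<open>blast+\<close>)
  \<comment> \<open>Fibre over \<open>C\<close> first: by \<open>card_middle\<close> for the inner
    composite all fibres have the same size, and by \<open>card_middle\<close> for the outer
    composite at the empty cut the number of fibres is a power of 2 as well. The exponents add up.
    The second count fibres over \<open>B\<close>.\<close>
  have 1: "card {(C, B). ?P B C} = 2 ^ (middle_count T \<beta> \<alpha> + middle_count U \<gamma> (diagram_comp \<beta> \<alpha>))"
  proof -
    have eq: "{(C, B). ?P B C} = (SIGMA C:?X. {B. ?P B C})"
      by (auto simp: ba.cut_rel_diagram_comp)
    have "card {(C, B). ?P B C} = (\<Sum>C\<in>?X. card {B. ?P B C})"
      unfolding eq by (rule card_SigmaI[OF finX]) (rule ballI, rule finB)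
    also have "\<dots> = (\<Sum>C\<in>?X. 2 ^ middle_count T \<beta> \<alpha>)"
    proof (rule sum.cong[OF refl])
      fix C assume C: "C \<in> ?X"
      then have "{B. ?P B C} = {B. ({}, B) \<in> cut_rel S T \<alpha> \<and> (B, C) \<in> cut_rel T U \<beta>}" by blast
      then show "card {B. ?P B C} = 2 ^ middle_count T \<beta> \<alpha>" using ba.card_middle[OF fin(1)] C by simp
    qed
    also have "\<dots> = 2 ^ (middle_count T \<beta> \<alpha> + middle_count U \<gamma> (diagram_comp \<beta> \<alpha>))"
      using gba.card_middle[OF fin(2) empty_in_cut_rel] by (simp add: power_add)
    finally show ?thesis .
  qed
  have 2: "card {(B, C). ?P B C} = 2 ^ (middle_count U \<gamma> \<beta> + middle_count T (diagram_comp \<gamma> \<beta>) \<alpha>)"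
  proof -
    have eq: "{(B, C). ?P B C} = (SIGMA B:?Y. {C. ?P B C})"
      by (auto simp: gb.cut_rel_diagram_comp)
    have "card {(B, C). ?P B C} = (\<Sum>B\<in>?Y. card {C. ?P B C})"
      unfolding eq by (rule card_SigmaI[OF finY]) (rule ballI, rule finC)
    also have "\<dots> = (\<Sum>B\<in>?Y. 2 ^ middle_count U \<gamma> \<beta>)"
    proof (rule sum.cong[OF refl])
      fix B assume B: "B \<in> ?Y"
      then have "{C. ?P B C} = {C. (B, C) \<in> cut_rel T U \<beta> \<and> (C, {}) \<in> cut_rel U V \<gamma>}" by blast
      then show "card {C. ?P B C} = 2 ^ middle_count U \<gamma> \<beta>" using gb.card_middle[OF fin(2)] B by simp
    qed
    also have "\<dots> = 2 ^ (middle_count U \<gamma> \<beta> + middle_count T (diagram_comp \<gamma> \<beta>) \<alpha>)"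
      using gba'.card_middle[OF fin(1) empty_in_cut_rel] by (simp add: power_add)
    finally show ?thesis .
  qed
  have "{(B, C). ?P B C} = {(C, B). ?P B C}\<inverse>" by auto
  then have "card {(B, C). ?P B C} = card {(C, B). ?P B C}" by (simp only: card_inverse)
  with 1 2 show ?thesis by simp
qed

definition graph_diagram :: "('a \<Rightarrow> 'a) \<Rightarrow> 'a set \<Rightarrow> 'a diagram" where
  "graph_diagram \<sigma> S = (\<lambda>s. {Inl s, Inr (\<sigma> s)}) ` S"

lemma graph_diagram_closed:
  assumes "bij_betw \<sigma> S T"
  shows "graph_diagram \<sigma> S \<in> partition_diagrams S T"
proof -
  have "partition_on (S \<uplus> T) (graph_diagram \<sigma> S)"
  proof (rule partition_onI)
    show "\<Union> (graph_diagram \<sigma> S) = S \<uplus> T"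
      using assms by (auto simp: graph_diagram_def bij_betw_def)
    show "disjnt p q" if "p \<in> graph_diagram \<sigma> S" "q \<in> graph_diagram \<sigma> S" "p \<noteq> q" for p q
      using assms that by (auto simp: graph_diagram_def bij_betw_def inj_on_def disjnt_def)
  qed (auto simp: graph_diagram_def)
  then show ?thesis by (simp add: partition_diagrams_def)
qed

lemma cut_rel_graph_diagram:
  assumes "bij_betw \<sigma> S T"
  shows "cut_rel S T (graph_diagram \<sigma> S) = {(A, \<sigma> ` A) | A. A \<subseteq> S}"
proof -
  have "(A, B) \<in> cut_rel S T (graph_diagram \<sigma> S) \<longleftrightarrow> B = \<sigma> ` A" if "A \<subseteq> S" for A B
  proof -
    have "(A, B) \<in> cut_rel S T (graph_diagram \<sigma> S) \<longleftrightarrow> B \<subseteq> T \<and> (\<forall>s\<in>S. s \<in> A \<longleftrightarrow> \<sigma> s \<in> B)"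
      using that by (auto simp: cut_rel_def saturated_def graph_diagram_def)
    also have "\<dots> \<longleftrightarrow> B = \<sigma> ` A"
      using assms that unfolding bij_betw_def inj_on_def by blast
    finally show ?thesis .
  qed
  note * = this
  show ?thesis
  proof (rule subset_antisym; rule subrelI)
    fix A B assume AB: "(A, B) \<in> cut_rel S T (graph_diagram \<sigma> S)"
    then have "A \<subseteq> S" by (simp add: cut_rel_def)
    with AB show "(A, B) \<in> {(A, \<sigma> ` A) | A. A \<subseteq> S}" using *[of A B] by blast
  next
    fix A B assume "(A, B) \<in> {(A, \<sigma> ` A) | A. A \<subseteq> S}"
    then show "(A, B) \<in> cut_rel S T (graph_diagram \<sigma> S)" using *[of A B] by blast
  qed
qed

abbreviation id_diagram :: "'a set \<Rightarrow> 'a diagram" where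
  "id_diagram S \<equiv> (\<lambda>s. {Inl s, Inr s}) ` S"

lemma id_diagram_closed: "id_diagram S \<in> partition_diagrams S S"
  using graph_diagram_closed[OF bij_betw_id[of S]] by (simp add: graph_diagram_def)

lemma cut_rel_id_diagram: "cut_rel S S (id_diagram S) = Id_on (Pow S)"
  using cut_rel_graph_diagram[OF bij_betw_id[of S]] by (auto simp: graph_diagram_def)

lemma Id_on_O: "R \<subseteq> X \<times> Y \<Longrightarrow> Id_on X O R = R" and O_Id_on: "R \<subseteq> X \<times> Y \<Longrightarrow> R O Id_on Y = R"
  by auto

lemma
  assumes \<alpha>: "\<alpha> \<in> partition_diagrams S T" and fin: "finite S" "finite T"
  shows diagram_comp_id_left: "diagram_comp (id_diagram T) \<alpha> = \<alpha>"
    and diagram_comp_id_right: "diagram_comp \<alpha> (id_diagram S) = \<alpha>"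
    and middle_count_id_left: "middle_count T (id_diagram T) \<alpha> = 0"
    and middle_count_id_right: "middle_count S \<alpha> (id_diagram S) = 0"
proof -
  interpret l: composable S T T \<alpha> "id_diagram T" by standard (fact, rule id_diagram_closed)
  interpret r: composable S S T "id_diagram S" \<alpha> by standard (rule id_diagram_closed, fact)
  show "diagram_comp (id_diagram T) \<alpha> = \<alpha>"
    by (rule diagram_eqI[OF l.diagram_comp_closed \<alpha>])
      (simp add: l.cut_rel_diagram_comp cut_rel_id_diagram O_Id_on[OF cut_rel_subset])
  show "diagram_comp \<alpha> (id_diagram S) = \<alpha>"
    by (rule diagram_eqI[OF r.diagram_comp_closed \<alpha>])
      (simp add: r.cut_rel_diagram_comp cut_rel_id_diagram Id_on_O[OF cut_rel_subset])
  show "middle_count T (id_diagram T) \<alpha> = 0"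
    by (rule l.middle_count_eq_0[OF fin(2)]) (auto simp: cut_rel_id_diagram)
  show "middle_count S \<alpha> (id_diagram S) = 0"
    by (rule r.middle_count_eq_0[OF fin(1)]) (auto simp: cut_rel_id_diagram)
qed

subsection \<open>Reversing a diagram\<close>

text \<open>The duality that exchanges upwards and downwards diagrams. On the upwards endomorphisms
  of a finite set it is the group inverse.\<close>

definition flip :: "'a diagram \<Rightarrow> 'a diagram" where
  "flip \<alpha> = (`) (case_sum Inr Inl) ` \<alpha>"

lemma inj_swap: "inj (case_sum Inr Inl :: 'a + 'b \<Rightarrow> 'b + 'a)"
  by (auto simp: inj_def split: sum.splits)

lemma swap_Plus: "case_sum Inr Inl ` (A \<uplus> B) = B \<uplus> A"
  by (auto simp: Plus_def image_Un image_image)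

lemma flip_flip [simp]: "flip (flip \<alpha>) = \<alpha>"
proof -
  have "(case_sum Inr Inl \<circ> case_sum Inr Inl) = (id :: 'a + 'a \<Rightarrow> _)"
    by (auto simp: fun_eq_iff split: sum.splits)
  then have "(`) (case_sum Inr Inl) \<circ> (`) (case_sum Inr Inl) = (id :: ('a + 'a) set \<Rightarrow> _)"
    by (simp add: fun_eq_iff image_comp)
  then show ?thesis unfolding flip_def image_comp by simp
qed

lemma flip_closed: "\<alpha> \<in> partition_diagrams S T \<Longrightarrow> flip \<alpha> \<in> partition_diagrams T S"
proof -
  assume "\<alpha> \<in> partition_diagrams S T"
  then have \<alpha>: "partition_on (S \<uplus> T) \<alpha>" by (simp add: partition_diagrams_def)
  then have "{} \<notin> (`) (case_sum Inr Inl) ` \<alpha>" by (auto dest: partition_onD3)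
  then show ?thesis
    using partition_on_inj_image[OF \<alpha> inj_on_subset[OF inj_swap]]
    by (simp add: partition_diagrams_def flip_def swap_Plus)
qed

lemma saturated_flip: "A \<uplus> B \<in> saturated (flip \<alpha>) \<longleftrightarrow> B \<uplus> A \<in> saturated \<alpha>"
proof -
  have "case_sum Inr Inl ` p \<subseteq> A \<uplus> B \<longleftrightarrow> p \<subseteq> B \<uplus> A" for p :: "('a + 'a) set"
    using inj_image_subset_iff[OF inj_swap, of p "B \<uplus> A"] by (simp add: swap_Plus)
  moreover have "case_sum Inr Inl ` p \<inter> (A \<uplus> B) = {} \<longleftrightarrow> p \<inter> (B \<uplus> A) = {}" for p :: "('a + 'a) set"
    using image_Int[OF inj_swap, of p "B \<uplus> A"] by (metis image_is_empty swap_Plus)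
  ultimately show ?thesis by (simp add: saturated_def flip_def)
qed

lemma cut_rel_flip: "cut_rel T S (flip \<alpha>) = (cut_rel S T \<alpha>)\<inverse>"
  by (auto simp: cut_rel_def saturated_flip)

subsection \<open>Upwards and downwards diagrams\<close>

text \<open>Totality forbids two source points in one part, since a cut starting from just one of
  them would split the part. Injectivity forbids a part without target points, since its source side
  and the empty set would both be related to the empty set.\<close>

lemma upwards_iff_cut_rel:
  assumes fin: "finite S"
  shows "upwards_diagram S T \<alpha> \<longleftrightarrow>
     \<alpha> \<in> partition_diagrams S T \<and> Pow S \<subseteq> Domain (cut_rel S T \<alpha>) \<and> single_valued ((cut_rel S T \<alpha>)\<inverse>)"
proof (cases "\<alpha> \<in> partition_diagrams S T")
  case True
  then have un: "\<Union>\<alpha> = S \<uplus> T" and ne: "{} \<notin> \<alpha>" and dj: "disjoint \<alpha>"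
    by (auto simp: partition_diagrams_def partition_on_def)
  have eqI: "p = q" if "p \<in> \<alpha>" "q \<in> \<alpha>" "x \<in> p" "x \<in> q" for p q x
    using dj that by (auto simp: disjoint_def)
  have at_most_one: "x = y" if up: "upwards_diagram S T \<alpha>" and p: "p \<in> \<alpha>"
      and xy: "x \<in> p \<inter> Inl ` S" "y \<in> p \<inter> Inl ` S" for p x y
  proof -
    have "card (p \<inter> Inl ` S) \<le> Suc 0" using up p unfolding upwards_diagram_def by auto
    then show ?thesis using xy fin by (simp add: card_le_Suc0_iff_eq)
  qed
  show ?thesis
  proof
    assume up: "upwards_diagram S T \<alpha>"
    have "A \<in> Domain (cut_rel S T \<alpha>)" if A: "A \<subseteq> S" for A
    proof -
      \<comment> \<open>The target points linked to \<open>A\<close>. A part that touches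
        \<open>A\<close> contains only one source point, so all of it is covered.\<close>
      define B where "B = {t. \<exists>p\<in>\<alpha>. Inr t \<in> p \<and> p \<inter> Inl ` A \<noteq> {}}"
      have "B \<subseteq> T" using un by (auto simp: B_def)
      moreover have "A \<uplus> B \<in> saturated \<alpha>" unfolding saturated_def
      proof (intro CollectI ballI)
        fix p assume p: "p \<in> \<alpha>"
        show "p \<subseteq> A \<uplus> B \<or> p \<inter> (A \<uplus> B) = {}"
        proof (cases "p \<inter> Inl ` A = {}")
          case True
          have "Inr t \<notin> p" if tB: "t \<in> B" for t
          proof
            assume t: "Inr t \<in> p"
            obtain q where "q \<in> \<alpha>" "Inr t \<in> q" "q \<inter> Inl ` A \<noteq> {}" using tB unfolding B_def by blast
            then show False using True eqI[OF p _ t] by blast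
          qed
          then show ?thesis using True by blast
        next
          case False
          then obtain a where a: "a \<in> A" "Inl a \<in> p" by blast
          have aS: "Inl a \<in> p \<inter> Inl ` S" using a A by blast
          have "s = a" if "Inl s \<in> p" "s \<in> S" for s
          proof -
            have "Inl s \<in> p \<inter> Inl ` S" using that by blast
            then show ?thesis using at_most_one[OF up p] aS by blast
          qed
          then have "Inl s \<in> p \<Longrightarrow> s \<in> A" for s using a p un by blast
          moreover have "Inr t \<in> p \<Longrightarrow> t \<in> B" for t using False p unfolding B_def by blast
          ultimately have "x \<in> A \<uplus> B" if "x \<in> p" for x using that by (cases x) auto
          then show ?thesis by blast
        qed
      qed
      ultimately show ?thesis using A by (auto simp: cut_rel_def)
    qed
    \<comment> \<open>A point of \<open>A\<close> shares its part with some target point, which lies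
      in \<open>B\<close>; the same part then has to lie in the cut over \<open>A'\<close>. By
      symmetry this gives injectivity.\<close>
    moreover have "A \<subseteq> A'" if "(A, B) \<in> cut_rel S T \<alpha>" "(A', B) \<in> cut_rel S T \<alpha>" for A A' B
    proof
      fix s assume s: "s \<in> A"
      then have "Inl s \<in> S \<uplus> T" using that by (auto simp: cut_rel_def)
      then obtain p where p: "p \<in> \<alpha>" "Inl s \<in> p" using un by blast
      then obtain t where t: "Inr t \<in> p" using up unfolding upwards_diagram_def by blast
      have "p \<subseteq> A \<uplus> B" using saturatedD[of "A \<uplus> B" \<alpha> p] that p s unfolding cut_rel_def by blast
      then have "t \<in> B" using t by blast
      then have "p \<subseteq> A' \<uplus> B" using saturatedD[of "A' \<uplus> B" \<alpha> p] that p t unfolding cut_rel_def by blast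
      then show "s \<in> A'" using p by blast
    qed
    ultimately show "\<alpha> \<in> partition_diagrams S T \<and> Pow S \<subseteq> Domain (cut_rel S T \<alpha>) \<and>
        single_valued ((cut_rel S T \<alpha>)\<inverse>)" using True unfolding single_valued_def by blast
  next
    assume R: "\<alpha> \<in> partition_diagrams S T \<and> Pow S \<subseteq> Domain (cut_rel S T \<alpha>) \<and>
        single_valued ((cut_rel S T \<alpha>)\<inverse>)"
    show "upwards_diagram S T \<alpha>" unfolding upwards_diagram_def
    proof (intro conjI ballI True)
      fix p assume p: "p \<in> \<alpha>"
      have pST: "p \<subseteq> S \<uplus> T" using p un by blast
      show "p \<inter> Inr ` T \<noteq> {}"
      proof
        assume "p \<inter> Inr ` T = {}"
        have pA: "p = (Inl -` p) \<uplus> {}"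
        proof (rule Set.set_eqI)
          fix x show "x \<in> p \<longleftrightarrow> x \<in> (Inl -` p) \<uplus> {}"
            using \<open>p \<inter> Inr ` T = {}\<close> pST by (cases x) auto
        qed
        have "p \<in> saturated \<alpha>"
          using Union_in_saturated[of "S \<uplus> T" \<alpha> "{p}"] True p by (simp add: partition_diagrams_def)
        \<comment> \<open>A part inside the source would be a cut ending in the empty set, as the
          empty cut does.\<close>
        then have "(Inl -` p, {}) \<in> cut_rel S T \<alpha>" using pA pST by (auto simp: cut_rel_def)
        then have "Inl -` p = {}" using R empty_in_cut_rel[of S T \<alpha>] unfolding single_valued_def by blast
        then have "p = {}" using pA by (metis Plus_eq_empty_conv)
        then show False using p ne by simp
      qed
      have "s = s'" if s: "Inl s \<in> p" "Inl s' \<in> p" for s s'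
      proof -
        have "{s} \<in> Domain (cut_rel S T \<alpha>)" using R s pST by blast
        then obtain B where "{s} \<uplus> B \<in> saturated \<alpha>" by (auto simp: cut_rel_def)
        then have "p \<subseteq> {s} \<uplus> B" using saturatedD p s by blast
        then show ?thesis using s by blast
      qed
      then have "\<exists>s. p \<inter> Inl ` S \<subseteq> {Inl s}" by blast
      then show "card (p \<inter> Inl ` S) \<in> {0, 1}" by (metis card.empty card_1_singleton_iff insertCI One_nat_def subset_singletonD)
    qed
  qed
qed (simp add: upwards_diagram_def)

lemma flip_mem_iff: "flip \<alpha> \<in> partition_diagrams T S \<longleftrightarrow> \<alpha> \<in> partition_diagrams S T"
  using flip_closed[of \<alpha> S T] flip_closed[of "flip \<alpha>" T S] by auto

lemma downwards_iff_upwards_flip: "downwards_diagram S T \<alpha> \<longleftrightarrow> upwards_diagram T S (flip \<alpha>)"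
proof -
  have "case_sum Inr Inl ` p \<inter> Inr ` S = case_sum Inr Inl ` (p \<inter> Inl ` S)" for p :: "('a + 'a) set"
    by (force split: sum.splits)
  moreover have "case_sum Inr Inl ` p \<inter> Inl ` T = case_sum Inr Inl ` (p \<inter> Inr ` T)" for p :: "('a + 'a) set"
    by (force split: sum.splits)
  moreover have "card (case_sum Inr Inl ` p) = card p" for p :: "('a + 'a) set"
    by (rule card_image) (rule inj_on_subset[OF inj_swap], simp)
  ultimately show ?thesis unfolding downwards_diagram_def upwards_diagram_def flip_mem_iff
    by (simp add: flip_def)
qed

lemma downwards_iff_cut_rel:
  assumes "finite T"
  shows "downwards_diagram S T \<alpha> \<longleftrightarrow>
     \<alpha> \<in> partition_diagrams S T \<and> Pow T \<subseteq> Range (cut_rel S T \<alpha>) \<and> single_valued (cut_rel S T \<alpha>)"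
  by (simp add: downwards_iff_upwards_flip upwards_iff_cut_rel[OF assms] flip_mem_iff cut_rel_flip)

lemma upwards_total:
  assumes "upwards_diagram S T \<alpha>" "finite S" "A \<subseteq> S"
  obtains B where "(A, B) \<in> cut_rel S T \<alpha>" "B \<subseteq> T"
proof -
  have "A \<in> Domain (cut_rel S T \<alpha>)" using assms upwards_iff_cut_rel by (metis PowI subsetD)
  then show thesis using that by (auto simp: cut_rel_def)
qed

lemma downwards_surj:
  assumes "downwards_diagram S T \<alpha>" "finite T" "B \<subseteq> T"
  obtains A where "(A, B) \<in> cut_rel S T \<alpha>" "A \<subseteq> S"
proof -
  have "B \<in> Range (cut_rel S T \<alpha>)" using assms downwards_iff_cut_rel by (metis PowI subsetD)
  then show thesis using that by (auto simp: cut_rel_def)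
qed

lemma upwards_injective:
  assumes "upwards_diagram S T \<alpha>" "finite S" "(A, B) \<in> cut_rel S T \<alpha>" "(A', B) \<in> cut_rel S T \<alpha>"
  shows "A = A'"
  using assms upwards_iff_cut_rel unfolding single_valued_def by (metis converseI)

lemma downwards_single_valued:
  assumes "downwards_diagram S T \<alpha>" "finite T" "(A, B) \<in> cut_rel S T \<alpha>" "(A, B') \<in> cut_rel S T \<alpha>"
  shows "B = B'"
  using assms downwards_iff_cut_rel unfolding single_valued_def by metis

lemma upwards_diagram_comp:
  assumes u\<alpha>: "upwards_diagram S T \<alpha>" and u\<beta>: "upwards_diagram T U \<beta>" and fin: "finite S" "finite T"
  shows "upwards_diagram S U (diagram_comp \<beta> \<alpha>)"
proof -
  interpret composable S T U \<alpha> \<beta> by standard (use u\<alpha> u\<beta> in \<open>auto simp: upwards_diagram_def\<close>)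
  have "A \<in> Domain (cut_rel S T \<alpha> O cut_rel T U \<beta>)" if A: "A \<subseteq> S" for A
  proof -
    obtain B where "(A, B) \<in> cut_rel S T \<alpha>" "B \<subseteq> T" using upwards_total[OF u\<alpha> fin(1) A] .
    moreover from this obtain C where "(B, C) \<in> cut_rel T U \<beta>" using upwards_total[OF u\<beta> fin(2)] by metis
    ultimately show ?thesis by blast
  qed
  then show ?thesis using u\<alpha> u\<beta> diagram_comp_closed
    unfolding upwards_iff_cut_rel[OF fin(1)] upwards_iff_cut_rel[OF fin(2)] cut_rel_diagram_comp
      converse_relcomp
    by (auto intro: single_valued_relcomp)
qed

lemma downwards_diagram_comp:
  assumes u\<alpha>: "downwards_diagram S T \<alpha>" and u\<beta>: "downwards_diagram T U \<beta>" and fin: "finite T" "finite U"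
  shows "downwards_diagram S U (diagram_comp \<beta> \<alpha>)"
proof -
  interpret composable S T U \<alpha> \<beta> by standard (use u\<alpha> u\<beta> in \<open>auto simp: downwards_diagram_def\<close>)
  have "C \<in> Range (cut_rel S T \<alpha> O cut_rel T U \<beta>)" if C: "C \<subseteq> U" for C
  proof -
    obtain B where "(B, C) \<in> cut_rel T U \<beta>" "B \<subseteq> T" using downwards_surj[OF u\<beta> fin(2) C] .
    moreover from this obtain A where "(A, B) \<in> cut_rel S T \<alpha>" using downwards_surj[OF u\<alpha> fin(1)] by metis
    ultimately show ?thesis by blast
  qed
  then show ?thesis using u\<alpha> u\<beta> diagram_comp_closed
    unfolding downwards_iff_cut_rel[OF fin(1)] downwards_iff_cut_rel[OF fin(2)] cut_rel_diagram_comp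
    by (auto intro: single_valued_relcomp)
qed

lemma id_diagram_upwards: "finite S \<Longrightarrow> upwards_diagram S S (id_diagram S)"
  by (auto simp: upwards_iff_cut_rel id_diagram_closed cut_rel_id_diagram single_valued_def)

lemma id_diagram_downwards: "finite S \<Longrightarrow> downwards_diagram S S (id_diagram S)"
  by (auto simp: downwards_iff_cut_rel id_diagram_closed cut_rel_id_diagram single_valued_def)

text \<open>Injectivity of the second relation lets the end of a cut determine the middle set,
  whatever the first diagram is. Hence such composites are plain diagrams, without a power of
  \<delta>.\<close>

lemma middle_count_upwards:
  assumes "finite T" "\<alpha> \<in> partition_diagrams S T" "upwards_diagram T U \<beta>"
  shows "middle_count T \<beta> \<alpha> = 0"
proof -
  interpret composable S T U \<alpha> \<beta> by standard (use assms in \<open>auto simp: upwards_diagram_def\<close>)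
  show ?thesis using upwards_injective[OF assms(3,1)] by (intro middle_count_eq_0[OF assms(1)])
qed

section \<open>Cardinalities and endomorphisms\<close>

lemma card_le_if_separating:
  assumes "finite Y" "\<And>a. a \<in> X \<Longrightarrow> \<exists>b\<in>Y. P a b" "\<And>a a' b. a \<in> X \<Longrightarrow> a' \<in> X \<Longrightarrow> P a b \<Longrightarrow> P a' b \<Longrightarrow> a = a'"
  shows "card X \<le> card Y"
proof -
  obtain f where f: "\<And>a. a \<in> X \<Longrightarrow> f a \<in> Y \<and> P a (f a)" using assms(2) by metis
  then have "inj_on f X" by (intro inj_onI) (metis assms(3))
  then show ?thesis using f by (intro card_inj_on_le[OF _ _ assms(1)]) auto
qed

text \<open>The relation lives on subsets, so the power sets are compared; the inequality between
  the sizes follows by monotonicity of powers of 2.\<close>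

lemma upwards_card_le:
  assumes "upwards_diagram S T \<alpha>" "finite S" "finite T"
  shows "card S \<le> card T"
proof -
  have "card (Pow S) \<le> card (Pow T)"
  proof (rule card_le_if_separating[where P = "\<lambda>A B. (A, B) \<in> cut_rel S T \<alpha>"])
    show "\<exists>B\<in>Pow T. (A, B) \<in> cut_rel S T \<alpha>" if "A \<in> Pow S" for A
      using upwards_total[OF assms(1,2)] that by (metis PowD PowI)
  qed (use assms upwards_injective[OF assms(1,2)] in auto)
  then show ?thesis using assms by (simp add: card_Pow)
qed

lemma downwards_card_le:
  assumes "downwards_diagram S T \<alpha>" "finite S" "finite T"
  shows "card T \<le> card S"
  using assms upwards_card_le by (auto simp: downwards_iff_upwards_flip)

text \<open>A function chosen inside the relation is injective, hence bijective on the finite set,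
  and injectivity of the relation leaves no room for pairs outside its graph.\<close>

lemma finite_total_injective_rel:
  assumes fin: "finite X" and R: "R \<subseteq> X \<times> X" "X \<subseteq> Domain R" "single_valued (R\<inverse>)"
  shows "X \<subseteq> Range R \<and> single_valued R"
proof -
  have "\<forall>a\<in>X. \<exists>b. (a, b) \<in> R" using R(2) by blast
  then obtain f where f: "\<And>a. a \<in> X \<Longrightarrow> (a, f a) \<in> R" by metis
  have "inj_on f X" using f R(3) unfolding single_valued_def by (intro inj_onI) (metis converseI)
  moreover have "f ` X \<subseteq> X" using f R(1) by blast
  ultimately have surj: "f ` X = X" using fin endo_inj_surj by blast
  have "b = f a" if "(a, b) \<in> R" for a b
  proof -
    have "b \<in> f ` X" using that R(1) surj by blast
    then obtain a' where "a' \<in> X" "b = f a'" by blast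
    then have "a' = a" using that f[of a'] R(3) unfolding single_valued_def by (metis converseI)
    then show ?thesis using \<open>b = f a'\<close> by simp
  qed
  then have "single_valued R" by (metis single_valuedI)
  moreover have "b \<in> Range R" if "b \<in> X" for b
  proof -
    have "b \<in> f ` X" using that surj by simp
    then show ?thesis using f by blast
  qed
  ultimately show ?thesis by blast
qed

lemma upwards_iff_downwards:
  assumes "finite S"
  shows "upwards_diagram S S \<alpha> \<longleftrightarrow> downwards_diagram S S \<alpha>"
proof -
  have "(cut_rel S S \<alpha>)\<inverse> \<subseteq> Pow S \<times> Pow S" using cut_rel_subset[of S S \<alpha>] by blast
  then show ?thesis
    using finite_total_injective_rel[of "Pow S" "cut_rel S S \<alpha>"] cut_rel_subset[of S S \<alpha>] assms
      finite_total_injective_rel[of "Pow S" "(cut_rel S S \<alpha>)\<inverse>"]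
    unfolding upwards_iff_cut_rel[OF assms] downwards_iff_cut_rel[OF assms] by simp blast
qed

text \<open>A total injective relation followed by its converse is the identity. Applied to a
  diagram and to its reversal, this gives isomorphisms between objects and inverses among
  endomorphisms.\<close>

lemma flip_comp_id:
  assumes u\<alpha>: "upwards_diagram S T \<alpha>" and fin: "finite S"
  shows "diagram_comp (flip \<alpha>) \<alpha> = id_diagram S"
proof -
  interpret composable S T S \<alpha> "flip \<alpha>"
    by standard (use u\<alpha> in \<open>auto simp: upwards_diagram_def flip_mem_iff\<close>)
  show ?thesis
  proof (rule diagram_eqI[OF diagram_comp_closed id_diagram_closed])
    have "(A, A') \<in> cut_rel S T \<alpha> O (cut_rel S T \<alpha>)\<inverse> \<longleftrightarrow> (A, A') \<in> Id_on (Pow S)" for A A'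
    proof
      assume "(A, A') \<in> cut_rel S T \<alpha> O (cut_rel S T \<alpha>)\<inverse>"
      then obtain B where "(A, B) \<in> cut_rel S T \<alpha>" "(A', B) \<in> cut_rel S T \<alpha>" by blast
      then show "(A, A') \<in> Id_on (Pow S)"
        using upwards_injective[OF u\<alpha> fin] by (auto simp: cut_rel_def)
    next
      assume "(A, A') \<in> Id_on (Pow S)"
      then show "(A, A') \<in> cut_rel S T \<alpha> O (cut_rel S T \<alpha>)\<inverse>"
        using upwards_total[OF u\<alpha> fin, of A] by (metis Id_onE PowD converseI prod.inject relcomp.intros)
    qed
    then show "cut_rel S S (diagram_comp (flip \<alpha>) \<alpha>) = cut_rel S S (id_diagram S)"
      unfolding cut_rel_diagram_comp cut_rel_flip cut_rel_id_diagram by auto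
  qed
qed

lemma flip_upwards_endo:
  assumes "finite S" "upwards_diagram S S \<alpha>"
  shows "upwards_diagram S S (flip \<alpha>)"
  using assms by (metis downwards_iff_upwards_flip upwards_iff_downwards)

subsection \<open>Finitely supported functions as a vector space\<close>

lemma lookup_map_mult [simp]:
  "Poly_Mapping.lookup (Poly_Mapping.map ((*) (c :: 'k::field)) f) k = c * Poly_Mapping.lookup f k"
  by (simp add: Poly_Mapping.map.rep_eq when_def)

interpretation pm: vector_space "\<lambda>c :: 'k::field. Poly_Mapping.map ((*) c) :: ('b \<Rightarrow>\<^sub>0 'k) \<Rightarrow> _"
  by standard (auto intro!: poly_mapping_eqI simp: lookup_add algebra_simps)

interpretation pm_pair: vector_space_pair "\<lambda>c :: 'k::field. Poly_Mapping.map ((*) c) :: ('b \<Rightarrow>\<^sub>0 'k) \<Rightarrow> _"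
  "\<lambda>c :: 'k::field. Poly_Mapping.map ((*) c) :: ('b \<Rightarrow>\<^sub>0 'k) \<Rightarrow> _"
  by standard

lemma map_mult_single [simp]:
  "Poly_Mapping.map ((*) (c :: 'k::field)) (Poly_Mapping.single k d) = Poly_Mapping.single k (c * d)"
  by (rule poly_mapping_eqI) (simp add: lookup_single when_def)

lemma poly_mapping_sum_single:
  "(f :: 'b \<Rightarrow>\<^sub>0 'k::comm_monoid_add)
    = (\<Sum>k\<in>Poly_Mapping.keys f. Poly_Mapping.single k (Poly_Mapping.lookup f k))"
  by (rule poly_mapping_eqI)
    (auto simp: lookup_sum lookup_single when_def sum.delta in_keys_iff)

lemma subspace_keys_subset: "pm.subspace {f :: 'b \<Rightarrow>\<^sub>0 'k::field. Poly_Mapping.keys f \<subseteq> K}"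
  unfolding pm.subspace_def
  by (auto simp: in_keys_iff lookup_add) (metis add_0 in_keys_iff subsetD)+

lemma span_singles:
  "pm.span ((\<lambda>k. Poly_Mapping.single k 1) ` K) = {f :: 'b \<Rightarrow>\<^sub>0 'k::field. Poly_Mapping.keys f \<subseteq> K}"
proof (rule pm.span_unique)
  show "(\<lambda>k. Poly_Mapping.single k (1 :: 'k)) ` K \<subseteq> {f. Poly_Mapping.keys f \<subseteq> K}" by auto
  fix V :: "('b \<Rightarrow>\<^sub>0 'k) set"
  assume V: "(\<lambda>k. Poly_Mapping.single k 1) ` K \<subseteq> V" "pm.subspace V"
  show "{f. Poly_Mapping.keys f \<subseteq> K} \<subseteq> V"
  proof clarify
    fix f :: "'b \<Rightarrow>\<^sub>0 'k" assume f: "Poly_Mapping.keys f \<subseteq> K"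
    have "Poly_Mapping.single k (Poly_Mapping.lookup f k) \<in> V" if "k \<in> Poly_Mapping.keys f" for k
    proof -
      have "Poly_Mapping.single k 1 \<in> V" using that f V by blast
      from pm.subspace_scale[OF V(2) this, of "Poly_Mapping.lookup f k"] show ?thesis by simp
    qed
    then have "(\<Sum>k\<in>Poly_Mapping.keys f. Poly_Mapping.single k (Poly_Mapping.lookup f k)) \<in> V"
      by (intro pm.subspace_sum V)
    then show "f \<in> V" using poly_mapping_sum_single[of f] by simp
  qed
qed (rule subspace_keys_subset)

text \<open>The coefficient stays in the basis case, so an additive statement can be proved without
  a separate case for scaling.\<close>

lemma keys_subset_induct [consumes 1, case_names zero add single]:
  assumes "Poly_Mapping.keys f \<subseteq> K" and "P 0"
    and add: "\<And>f g. \<lbrakk>Poly_Mapping.keys f \<subseteq> K; Poly_Mapping.keys g \<subseteq> K; P f; P g\<rbrakk> \<Longrightarrow> P (f + g)"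
    and single: "\<And>k c. k \<in> K \<Longrightarrow> P (Poly_Mapping.single k c)"
  shows "P (f :: 'b \<Rightarrow>\<^sub>0 'k::comm_monoid_add)"
proof -
  have "Poly_Mapping.keys (\<Sum>k\<in>A. Poly_Mapping.single k (Poly_Mapping.lookup f k)) \<subseteq> K
      \<and> P (\<Sum>k\<in>A. Poly_Mapping.single k (Poly_Mapping.lookup f k))"
    if "finite A" "A \<subseteq> K" for A
    using that
  proof (induction A rule: finite_induct)
    case empty
    then show ?case using assms(2) by simp
  next
    case (insert k A)
    let ?g = "\<Sum>k\<in>A. Poly_Mapping.single k (Poly_Mapping.lookup f k)"
    have "Poly_Mapping.keys (Poly_Mapping.single k (Poly_Mapping.lookup f k)) \<subseteq> K" using insert by simp
    moreover have "Poly_Mapping.keys ?g \<subseteq> K" "P ?g" using insert by auto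
    ultimately show ?case
      using insert add single[of k] keys_add[of "Poly_Mapping.single k (Poly_Mapping.lookup f k)" ?g]
      by (simp del: keys_single) blast
  qed
  from this[of "Poly_Mapping.keys f"] assms(1) show ?thesis
    using poly_mapping_sum_single[of f] by simp
qed

subsection \<open>The partition category\<close>

context
  fixes \<delta> :: complex
begin

lemma partition_category_simps [simp]:
  "Obj (partition_category \<delta>) = {S. finite S}"
  "Hom (partition_category \<delta>) S T = {f. Poly_Mapping.keys f \<subseteq> partition_diagrams S T}"
  "Scale (partition_category \<delta>) c = Poly_Mapping.map ((*) c)"
  "Comp (partition_category \<delta>) = partition_comp \<delta>"
  "Ide (partition_category \<delta>) S = Poly_Mapping.single (id_diagram S) 1"
  by (simp_all add: partition_category_def)

lemma Scale_partition_category: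
  "Scale (partition_category \<delta>) = (\<lambda>c. Poly_Mapping.map ((*) c))"
  by (rule ext) simp

lemma upwards_Hom_eq: "upwards_Hom \<delta> S T = {f. Poly_Mapping.keys f \<subseteq> {\<alpha>. upwards_diagram S T \<alpha>}}"
  unfolding upwards_Hom_def Scale_partition_category by (rule span_singles)

lemma downwards_Hom_eq: "downwards_Hom \<delta> S T = {f. Poly_Mapping.keys f \<subseteq> {\<alpha>. downwards_diagram S T \<alpha>}}"
  unfolding downwards_Hom_def Scale_partition_category by (rule span_singles)

text \<open>Composition sums over supports, and supports change under addition and scaling. Over
  fixed larger index sets, bilinearity can be checked term by term.\<close>

lemma partition_comp_eq_sum:
  assumes "finite K" "Poly_Mapping.keys g \<subseteq> K" "finite L" "Poly_Mapping.keys f \<subseteq> L"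
  shows "partition_comp \<delta> S T U g f = (\<Sum>\<beta>\<in>K. \<Sum>\<alpha>\<in>L. Poly_Mapping.single (diagram_comp \<beta> \<alpha>)
      (Poly_Mapping.lookup g \<beta> * Poly_Mapping.lookup f \<alpha> * \<delta> ^ middle_count T \<beta> \<alpha>))"
proof -
  have "(\<Sum>\<alpha>\<in>Poly_Mapping.keys f. Poly_Mapping.single (diagram_comp \<beta> \<alpha>)
      (Poly_Mapping.lookup g \<beta> * Poly_Mapping.lookup f \<alpha> * \<delta> ^ middle_count T \<beta> \<alpha>))
    = (\<Sum>\<alpha>\<in>L. Poly_Mapping.single (diagram_comp \<beta> \<alpha>)
      (Poly_Mapping.lookup g \<beta> * Poly_Mapping.lookup f \<alpha> * \<delta> ^ middle_count T \<beta> \<alpha>))" for \<beta>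
    by (rule sum.mono_neutral_left) (use assms in \<open>auto simp: in_keys_iff\<close>)
  then show ?thesis unfolding partition_comp_def
    by (simp, intro sum.mono_neutral_left) (use assms in \<open>auto simp: in_keys_iff\<close>)
qed

lemma partition_comp_add_left:
  "partition_comp \<delta> S T U (g + g') f = partition_comp \<delta> S T U g f + partition_comp \<delta> S T U g' f"
proof -
  let ?K = "Poly_Mapping.keys g \<union> Poly_Mapping.keys g'"
  have "Poly_Mapping.keys (g + g') \<subseteq> ?K" by (rule keys_add)
  then show ?thesis
    using partition_comp_eq_sum[of ?K _ "Poly_Mapping.keys f" f S T U]
    by (simp add: sum.distrib lookup_add algebra_simps single_add flip: sum.distrib)
qed

lemma partition_comp_add_right:
  "partition_comp \<delta> S T U g (f + f') = partition_comp \<delta> S T U g f + partition_comp \<delta> S T U g f'"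
proof -
  let ?L = "Poly_Mapping.keys f \<union> Poly_Mapping.keys f'"
  have "Poly_Mapping.keys (f + f') \<subseteq> ?L" by (rule keys_add)
  then show ?thesis
    using partition_comp_eq_sum[of "Poly_Mapping.keys g" g ?L _ S T U]
    by (simp add: sum.distrib lookup_add algebra_simps single_add flip: sum.distrib)
qed

lemma partition_comp_zero [simp]:
  "partition_comp \<delta> S T U 0 f = 0" "partition_comp \<delta> S T U g 0 = 0"
  by (simp_all add: partition_comp_def)

lemma partition_comp_single [simp]:
  "partition_comp \<delta> S T U (Poly_Mapping.single \<beta> b) (Poly_Mapping.single \<alpha> a)
    = Poly_Mapping.single (diagram_comp \<beta> \<alpha>) (b * a * \<delta> ^ middle_count T \<beta> \<alpha>)"
  by (simp add: partition_comp_def)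

lemma partition_comp_scale_left:
  "partition_comp \<delta> S T U (Poly_Mapping.map ((*) c) g) f
    = Poly_Mapping.map ((*) c) (partition_comp \<delta> S T U g f)"
proof -
  have "Poly_Mapping.keys (Poly_Mapping.map ((*) c) g) \<subseteq> Poly_Mapping.keys g"
    by (auto simp: in_keys_iff)
  then show ?thesis
    using partition_comp_eq_sum[of "Poly_Mapping.keys g" _ "Poly_Mapping.keys f" f S T U]
    by (simp add: pm.scale_sum_right mult.assoc)
qed

lemma partition_comp_scale_right:
  "partition_comp \<delta> S T U g (Poly_Mapping.map ((*) c) f)
    = Poly_Mapping.map ((*) c) (partition_comp \<delta> S T U g f)"
proof -
  have "Poly_Mapping.keys (Poly_Mapping.map ((*) c) f) \<subseteq> Poly_Mapping.keys f"
    by (auto simp: in_keys_iff)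
  then show ?thesis
    using partition_comp_eq_sum[of "Poly_Mapping.keys g" g "Poly_Mapping.keys f" _ S T U]
    by (simp add: pm.scale_sum_right mult_ac)
qed

lemma partition_comp_sum_right:
  "partition_comp \<delta> S T U g (\<Sum>i\<in>A. f i) = (\<Sum>i\<in>A. partition_comp \<delta> S T U g (f i))"
  by (induction A rule: infinite_finite_induct) (simp_all add: partition_comp_add_right)

lemma keys_partition_comp:
  "Poly_Mapping.keys (partition_comp \<delta> S T U g f)
    \<subseteq> {diagram_comp \<beta> \<alpha> | \<beta> \<alpha>. \<beta> \<in> Poly_Mapping.keys g \<and> \<alpha> \<in> Poly_Mapping.keys f}"
proof
  fix \<gamma> assume "\<gamma> \<in> Poly_Mapping.keys (partition_comp \<delta> S T U g f)"
  then have "Poly_Mapping.lookup (partition_comp \<delta> S T U g f) \<gamma> \<noteq> 0" by (simp add: in_keys_iff)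
  then obtain \<beta> \<alpha> where "\<beta> \<in> Poly_Mapping.keys g" "\<alpha> \<in> Poly_Mapping.keys f"
    "Poly_Mapping.lookup (Poly_Mapping.single (diagram_comp \<beta> \<alpha>)
      (Poly_Mapping.lookup g \<beta> * Poly_Mapping.lookup f \<alpha> * \<delta> ^ middle_count T \<beta> \<alpha>)) \<gamma> \<noteq> 0"
    unfolding partition_comp_def lookup_sum by (metis (no_types, lifting) sum.neutral)
  then show "\<gamma> \<in> {diagram_comp \<beta> \<alpha> | \<beta> \<alpha>. \<beta> \<in> Poly_Mapping.keys g \<and> \<alpha> \<in> Poly_Mapping.keys f}"
    by (auto simp: lookup_single when_def split: if_splits)
qed

lemma partition_comp_closed:
  assumes "Poly_Mapping.keys g \<subseteq> K" "Poly_Mapping.keys f \<subseteq> L"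
    "\<And>\<beta> \<alpha>. \<beta> \<in> K \<Longrightarrow> \<alpha> \<in> L \<Longrightarrow> diagram_comp \<beta> \<alpha> \<in> M"
  shows "Poly_Mapping.keys (partition_comp \<delta> S T U g f) \<subseteq> M"
  using keys_partition_comp[of S T U g f] assms by blast

text \<open>By additivity in each argument only basis diagrams remain, where associativity is an
  identity of diagrams together with an equality of exponents of \<delta>.\<close>

lemma partition_comp_assoc:
  assumes f: "Poly_Mapping.keys f \<subseteq> partition_diagrams W X" and g: "Poly_Mapping.keys g \<subseteq> partition_diagrams X Y"
    and h: "Poly_Mapping.keys h \<subseteq> partition_diagrams Y Z" and fin: "finite X" "finite Y"
  shows "partition_comp \<delta> W Y Z h (partition_comp \<delta> W X Y g f)
    = partition_comp \<delta> W X Z (partition_comp \<delta> X Y Z h g) f"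
  using h
proof (induction rule: keys_subset_induct)
  case (single \<gamma> c)
  note \<gamma> = single
  show ?case using g
  proof (induction rule: keys_subset_induct)
    case (single \<beta> b)
    note \<beta> = single
    show ?case using f
    proof (induction rule: keys_subset_induct)
      case (single \<alpha> a)
      have "\<delta> ^ middle_count X \<beta> \<alpha> * \<delta> ^ middle_count Y \<gamma> (diagram_comp \<beta> \<alpha>)
          = \<delta> ^ middle_count Y \<gamma> \<beta> * \<delta> ^ middle_count X (diagram_comp \<gamma> \<beta>) \<alpha>"
        using middle_count_assoc[OF single \<beta> \<gamma> fin] by (simp flip: power_add)
      then show ?case using diagram_comp_assoc[OF single \<beta> \<gamma>] by (simp add: mult_ac)
    qed (simp_all add: partition_comp_add_right)
  qed (simp_all add: partition_comp_add_left partition_comp_add_right)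
qed (simp_all add: partition_comp_add_left)

lemma
  assumes f: "Poly_Mapping.keys f \<subseteq> partition_diagrams S T" and fin: "finite S" "finite T"
  shows partition_comp_id_left:
      "partition_comp \<delta> S T T (Poly_Mapping.single (id_diagram T) 1) f = f"
    and partition_comp_id_right:
      "partition_comp \<delta> S S T f (Poly_Mapping.single (id_diagram S) 1) = f"
  using f
  by (induction rule: keys_subset_induct)
    (simp_all add: partition_comp_add_left partition_comp_add_right diagram_comp_id_left[OF _ fin]
      diagram_comp_id_right[OF _ fin] middle_count_id_left[OF _ fin] middle_count_id_right[OF _ fin])

lemma diagram_comp_in_partition_diagrams:
  assumes "\<alpha> \<in> partition_diagrams S T" "\<beta> \<in> partition_diagrams T U"
  shows "diagram_comp \<beta> \<alpha> \<in> partition_diagrams S U"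
  using composable.diagram_comp_closed composable.intro assms by metis

section \<open>The category and its two wide subcategories\<close>

lemma linear_category_partition_category: "linear_category (partition_category \<delta> :: (_, 'a set, _) lincat)"
proof (unfold_locales)
  fix S T U :: "'a set" and f g :: "'a diagram \<Rightarrow>\<^sub>0 complex"
  assume "f \<in> Hom (partition_category \<delta>) S T" "g \<in> Hom (partition_category \<delta>) T U"
  then show "Comp (partition_category \<delta>) S T U g f \<in> Hom (partition_category \<delta>) S U"
    unfolding partition_category_simps mem_Collect_eq
    by - (rule partition_comp_closed, auto intro: diagram_comp_in_partition_diagrams)
qed (auto simp: Scale_partition_category subspace_keys_subset partition_comp_add_left partition_comp_add_right
    partition_comp_scale_left partition_comp_scale_right partition_comp_id_left partition_comp_id_right
    id_diagram_closed pm.scale_right_distrib pm.scale_left_distrib intro!: partition_comp_assoc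
    simp del: partition_category_simps(3))

lemma wide_subcategory_upwards:
  "wide_subcategory (partition_category \<delta> :: (_, 'a set, _) lincat) (upwards_Hom \<delta>)"
proof -
  interpret linear_category "partition_category \<delta> :: (_, 'a set, _) lincat"
    by (rule linear_category_partition_category)
  show ?thesis
  proof
    fix S T U :: "'a set" and f g :: "'a diagram \<Rightarrow>\<^sub>0 complex"
    assume "S \<in> Obj (partition_category \<delta>)" "T \<in> Obj (partition_category \<delta>)"
      "f \<in> upwards_Hom \<delta> S T" "g \<in> upwards_Hom \<delta> T U"
    then show "Comp (partition_category \<delta>) S T U g f \<in> upwards_Hom \<delta> S U"
      unfolding partition_category_simps mem_Collect_eq upwards_Hom_eq
      by (intro partition_comp_closed[where M = "{\<alpha>. upwards_diagram S U \<alpha>}"])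
        (auto intro: upwards_diagram_comp)
  qed (use id_diagram_upwards in \<open>auto simp: upwards_Hom_eq Scale_partition_category subspace_keys_subset
      upwards_diagram_def simp del: partition_category_simps(3)\<close>)
qed

lemma wide_subcategory_downwards:
  "wide_subcategory (partition_category \<delta> :: (_, 'a set, _) lincat) (downwards_Hom \<delta>)"
proof -
  interpret linear_category "partition_category \<delta> :: (_, 'a set, _) lincat"
    by (rule linear_category_partition_category)
  show ?thesis
  proof
    fix S T U :: "'a set" and f g :: "'a diagram \<Rightarrow>\<^sub>0 complex"
    assume "T \<in> Obj (partition_category \<delta>)" "U \<in> Obj (partition_category \<delta>)"
      "f \<in> downwards_Hom \<delta> S T" "g \<in> downwards_Hom \<delta> T U"
    then show "Comp (partition_category \<delta>) S T U g f \<in> downwards_Hom \<delta> S U"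
      unfolding partition_category_simps mem_Collect_eq downwards_Hom_eq
      by (intro partition_comp_closed[where M = "{\<alpha>. downwards_diagram S U \<alpha>}"])
        (auto intro: downwards_diagram_comp)
  qed (use id_diagram_downwards in \<open>auto simp: downwards_Hom_eq Scale_partition_category subspace_keys_subset
      downwards_diagram_def simp del: partition_category_simps(3)\<close>)
qed

subsection \<open>Isomorphism classes\<close>

text \<open>No trace or dimension argument is involved: some pair of basis diagrams must compose to
  the identity diagram, and then subsets of \<open>S\<close> can be told apart by subsets of
  \<open>T\<close>. This works for every \<delta>, including 0.\<close>

lemma isomorphic_imp_card_le:
  assumes "isomorphic_in (partition_category \<delta>) S T" and fin: "finite S" "finite T"
  shows "card S \<le> card T"
proof -
  obtain f g where fg: "Poly_Mapping.keys f \<subseteq> partition_diagrams S T"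
    "Poly_Mapping.keys g \<subseteq> partition_diagrams T S"
    "partition_comp \<delta> S T S g f = Poly_Mapping.single (id_diagram S) 1"
    using assms by (auto simp: isomorphic_in_def)
  then have "id_diagram S \<in> Poly_Mapping.keys (partition_comp \<delta> S T S g f)" by simp
  then obtain \<alpha> \<beta> where "\<alpha> \<in> partition_diagrams S T" "\<beta> \<in> partition_diagrams T S"
    and id: "id_diagram S = diagram_comp \<beta> \<alpha>"
    using subsetD[OF keys_partition_comp] fg(1,2) by (smt (verit, best) mem_Collect_eq subsetD)
  then interpret composable S T S \<alpha> \<beta> by unfold_locales
  \<comment> \<open>\<open>B\<close> is a middle set on the way from \<open>A\<close> back to
    itself. If \<open>A'\<close> uses the same \<open>B\<close>, the composite relates
    \<open>A\<close> to \<open>A'\<close>, and the composite is the identity.\<close>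
  let ?P = "\<lambda>A B. (A, B) \<in> cut_rel S T \<alpha> \<and> (B, A) \<in> cut_rel T S \<beta>"
  have comp: "cut_rel S T \<alpha> O cut_rel T S \<beta> = Id_on (Pow S)"
    using cut_rel_diagram_comp by (simp add: cut_rel_id_diagram flip: id)
  have "card (Pow S) \<le> card (Pow T)"
  proof (rule card_le_if_separating[where P = ?P])
    fix A assume "A \<in> Pow S"
    then have "(A, A) \<in> cut_rel S T \<alpha> O cut_rel T S \<beta>" unfolding comp by blast
    then show "\<exists>B\<in>Pow T. ?P A B" by (auto simp: cut_rel_def)
  next
    fix A A' B assume "?P A B" "?P A' B"
    then have "(A, A') \<in> cut_rel S T \<alpha> O cut_rel T S \<beta>" by blast
    then show "A = A'" unfolding comp by blast
  qed (use fin in simp)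
  then show ?thesis using fin by (simp add: card_Pow)
qed

lemma isomorphic_sym: "isomorphic_in G S T \<Longrightarrow> isomorphic_in G T S"
  by (auto simp: isomorphic_in_def)

text \<open>The graph of a bijection and its reversal are both upwards, so each composite is an
  identity diagram with coefficient 1.\<close>

lemma isomorphic_if_card_eq:
  assumes "card S = card T" and fin: "finite S" "finite T"
  shows "isomorphic_in (partition_category \<delta>) S T"
proof -
  obtain \<sigma> where \<sigma>: "bij_betw \<sigma> S T" using assms finite_same_card_bij by blast
  define \<alpha> where "\<alpha> = graph_diagram \<sigma> S"
  have \<alpha>: "\<alpha> \<in> partition_diagrams S T" unfolding \<alpha>_def by (rule graph_diagram_closed[OF \<sigma>])
  have R: "cut_rel S T \<alpha> = {(A, \<sigma> ` A) | A. A \<subseteq> S}" unfolding \<alpha>_def by (rule cut_rel_graph_diagram[OF \<sigma>])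
  have inj: "\<sigma> ` A = \<sigma> ` A' \<Longrightarrow> A = A'" if "A \<subseteq> S" "A' \<subseteq> S" for A A'
    using \<sigma> that by (metis bij_betw_def inj_on_image_eq_iff)
  have surj: "\<exists>A. A \<subseteq> S \<and> B = \<sigma> ` A" if "B \<subseteq> T" for B
    using \<sigma> that by (metis bij_betw_def subset_imageE)
  have up: "upwards_diagram S T \<alpha>"
  proof -
    have "single_valued ({(A, \<sigma> ` A) | A. A \<subseteq> S}\<inverse>)" using inj by (auto simp: single_valued_def)
    then show ?thesis unfolding upwards_iff_cut_rel[OF fin(1)] R using \<alpha> by auto
  qed
  have up': "upwards_diagram T S (flip \<alpha>)"
  proof -
    have "single_valued {(A, \<sigma> ` A) | A. A \<subseteq> S}" by (auto simp: single_valued_def)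
    moreover have "Pow T \<subseteq> Range {(A, \<sigma> ` A) | A. A \<subseteq> S}"
    proof
      fix B assume "B \<in> Pow T"
      then obtain A where "A \<subseteq> S" "B = \<sigma> ` A" using surj by blast
      then show "B \<in> Range {(A, \<sigma> ` A) | A. A \<subseteq> S}" by blast
    qed
    ultimately show ?thesis
      unfolding upwards_iff_cut_rel[OF fin(2)] cut_rel_flip R flip_mem_iff using \<alpha> by simp
  qed
  have 1: "partition_comp \<delta> S T S (Poly_Mapping.single (flip \<alpha>) 1) (Poly_Mapping.single \<alpha> 1)
      = Poly_Mapping.single (id_diagram S) 1"
    using middle_count_upwards[OF fin(2) \<alpha> up'] flip_comp_id[OF up fin(1)] by simp
  have 2: "partition_comp \<delta> T S T (Poly_Mapping.single \<alpha> 1) (Poly_Mapping.single (flip \<alpha>) 1)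
      = Poly_Mapping.single (id_diagram T) 1"
    using middle_count_upwards[OF fin(1) flip_closed[OF \<alpha>] up] flip_comp_id[OF up' fin(2)] by simp
  show ?thesis unfolding isomorphic_in_def
    by (intro bexI[of _ "Poly_Mapping.single \<alpha> 1"] bexI[of _ "Poly_Mapping.single (flip \<alpha>) 1"] conjI)
      (use 1 2 \<alpha> flip_closed[OF \<alpha>] in auto)
qed

lemma isomorphic_iff_card_eq:
  assumes "finite S" "finite T"
  shows "isomorphic_in (partition_category \<delta>) S T \<longleftrightarrow> card S = card T"
  using isomorphic_imp_card_le[of S T] isomorphic_imp_card_le[of T S] isomorphic_sym[of _ S T]
    isomorphic_if_card_eq[of S T] assms by (meson order_antisym)

lemma iso_class_partition_category:
  "finite S \<Longrightarrow> iso_class (partition_category \<delta>) S = {T. finite T \<and> card T = card S}"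
  by (auto simp: iso_class_def isomorphic_iff_card_eq)

section \<open>Conditions (T0) and (T2)\<close>

lemma essentially_small_partition_category:
  "essentially_small TYPE(nat) (partition_category \<delta> :: (_, 'a::infinite set, _) lincat)"
proof -
  have "\<exists>S :: 'a set. finite S \<and> card S = n" for n
    using infinite_arbitrarily_large[OF infinite_UNIV] by blast
  then obtain F :: "nat \<Rightarrow> 'a set" where "\<And>n. finite (F n) \<and> card (F n) = n" by metis
  then show ?thesis unfolding essentially_small_def
    by (intro exI[of _ F]) (auto simp: isomorphic_iff_card_eq)
qed

lemma finite_dim_partition_category:
  assumes "finite S" "finite T"
  shows "finite_dim_Hom (partition_category \<delta>) S T"
  unfolding finite_dim_Hom_def Scale_partition_category partition_category_simps
  using span_singles[of "partition_diagrams S T"] finite_partition_diagrams[OF assms] by blast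

lemma partition_category_order:
  fixes G :: "(_, 'a set, _) lincat"
  defines "G \<equiv> partition_category \<delta>"
  shows "\<exists>r. partial_order_on (iso_classes G) r \<and>
      (\<forall>X \<in> iso_classes G. finite {Y \<in> iso_classes G. (Y, X) \<in> r}) \<and>
      (\<forall>x \<in> Obj G. \<forall>y \<in> Obj G.
        (\<exists>f \<in> upwards_Hom \<delta> x y. f \<noteq> 0) \<longrightarrow> (iso_class G x, iso_class G y) \<in> r) \<and>
      (\<forall>x \<in> Obj G. \<forall>y \<in> Obj G.
        (\<exists>f \<in> downwards_Hom \<delta> x y. f \<noteq> 0) \<longrightarrow> (iso_class G y, iso_class G x) \<in> r)"
proof (intro exI conjI ballI impI)
  \<comment> \<open>Isomorphism classes correspond to cardinalities, so the required order is the
    usual one on numbers, transported to the classes \<open>C n\<close>.\<close>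
  define C :: "nat \<Rightarrow> 'a set set" where "C n = {T. finite T \<and> card T = n}" for n
  have cls: "iso_class G S = C (card S)" if "finite S" for S
    using that by (simp add: G_def C_def iso_class_partition_category)
  have Obj: "Obj G = {S. finite S}" by (simp add: G_def)
  define r where "r = {(C (card S), C (card T)) | (S :: 'a set) (T :: 'a set). finite S \<and> finite T \<and> card S \<le> card T}"
  have C_eq: "card S = card T" if "C (card S) = C (card T)" "finite S" for S T :: "'a set"
  proof -
    have "S \<in> C (card T)" using that by (simp flip: that(1)) (simp add: C_def)
    then show ?thesis by (simp add: C_def)
  qed
  have r_iff: "(C (card S), C (card T)) \<in> r \<longleftrightarrow> card S \<le> card T" if "finite S" "finite T" for S T :: "'a set"
  proof
    assume "(C (card S), C (card T)) \<in> r"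
    then obtain S' T' :: "'a set" where le: "card S' \<le> card T'" and eq: "C (card S) = C (card S')" "C (card T) = C (card T')"
      unfolding r_def mem_Collect_eq prod.inject by metis
    show "card S \<le> card T" using le unfolding C_eq[OF eq(1) that(1)] C_eq[OF eq(2) that(2)] .
  next
    assume "card S \<le> card T"
    then show "(C (card S), C (card T)) \<in> r" unfolding r_def using that by blast
  qed
  have classes: "iso_classes G = {C (card S) | S :: 'a set. finite S}"
    unfolding iso_classes_def Obj using cls by (auto intro!: image_eqI)
  show "partial_order_on (iso_classes G) r"
    unfolding partial_order_on_def preorder_on_def refl_on_def trans_def antisym_def classes
  proof (intro conjI)
    show "r \<subseteq> {C (card S) | S :: 'a set. finite S} \<times> {C (card S) | S :: 'a set. finite S}" by (auto simp: r_def)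
    show "\<forall>x\<in>{C (card S) | S :: 'a set. finite S}. (x, x) \<in> r" by (auto simp: r_iff)
    show "\<forall>x y z. (x, y) \<in> r \<longrightarrow> (y, z) \<in> r \<longrightarrow> (x, z) \<in> r"
    proof (intro allI impI)
      fix x y z assume "(x, y) \<in> r" "(y, z) \<in> r"
      then obtain S T T' U :: "'a set" where "finite S" "finite T" "finite T'" "finite U" "x = C (card S)"
        "y = C (card T)" "y = C (card T')" "z = C (card U)" "card S \<le> card T" "card T' \<le> card U"
        unfolding r_def by blast
      moreover from this have "card T = card T'" using C_eq by metis
      ultimately show "(x, z) \<in> r" using r_iff by simp
    qed
    show "\<forall>x y. (x, y) \<in> r \<longrightarrow> (y, x) \<in> r \<longrightarrow> x = y"
    proof (intro allI impI)
      fix x y assume xy: "(x, y) \<in> r" "(y, x) \<in> r"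
      then obtain S T :: "'a set" where "finite S" "finite T" "x = C (card S)" "y = C (card T)" "card S \<le> card T"
        unfolding r_def by blast
      then show "x = y" using xy r_iff[of T S] by simp
    qed
  qed
  show "finite {Y \<in> iso_classes G. (Y, X) \<in> r}" if "X \<in> iso_classes G" for X
  proof -
    obtain S :: "'a set" where S: "finite S" "X = C (card S)" using \<open>X \<in> iso_classes G\<close> unfolding classes by blast
    \<comment> \<open>The classes below that of \<open>S\<close> are among those of the finitely
      many sizes up to \<open>card S\<close>.\<close>
    have "{Y \<in> iso_classes G. (Y, X) \<in> r} \<subseteq> C ` {..card S}"
      unfolding classes S(2) using r_iff[OF _ S(1)] by auto
    then show ?thesis by (rule finite_subset) simp
  qed
  show "(iso_class G x, iso_class G y) \<in> r"
    if "x \<in> Obj G" "y \<in> Obj G" "\<exists>f \<in> upwards_Hom \<delta> x y. f \<noteq> 0" for x y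
  proof -
    have "\<exists>\<alpha>. upwards_diagram x y \<alpha>" using that(3) unfolding upwards_Hom_eq
      by (metis (no_types, lifting) Collect_empty_eq keys_eq_empty mem_Collect_eq subset_empty)
    then show ?thesis using upwards_card_le that(1,2) by (auto simp: Obj cls r_iff)
  qed
  show "(iso_class G y, iso_class G x) \<in> r"
    if "x \<in> Obj G" "y \<in> Obj G" "\<exists>f \<in> downwards_Hom \<delta> x y. f \<noteq> 0" for x y
  proof -
    have "\<exists>\<alpha>. downwards_diagram x y \<alpha>" using that(3) unfolding downwards_Hom_eq
      by (metis (no_types, lifting) Collect_empty_eq keys_eq_empty mem_Collect_eq subset_empty)
    then show ?thesis using downwards_card_le that(1,2) by (auto simp: Obj cls r_iff)
  qed
qed

end

subsection \<open>Semisimplicity of the endomorphism rings\<close>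

context wide_subcategory
begin

lemma sub_Hom: "\<lbrakk>x \<in> Obj G; y \<in> Obj G; f \<in> U x y\<rbrakk> \<Longrightarrow> f \<in> Hom G x y"
  using sub_subset by blast

lemma
  assumes "x \<in> Obj G" "y \<in> Obj G"
  shows sub_zero: "0 \<in> U x y"
    and sub_add: "\<lbrakk>f \<in> U x y; g \<in> U x y\<rbrakk> \<Longrightarrow> f + g \<in> U x y"
    and sub_scale: "f \<in> U x y \<Longrightarrow> Scale G c f \<in> U x y"
    and sub_uminus: "f \<in> U x y \<Longrightarrow> - f \<in> U x y"
proof -
  interpret vector_space "Scale G" by (rule vector_space_Scale)
  show "0 \<in> U x y" "\<lbrakk>f \<in> U x y; g \<in> U x y\<rbrakk> \<Longrightarrow> f + g \<in> U x y" "f \<in> U x y \<Longrightarrow> Scale G c f \<in> U x y"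
    "f \<in> U x y \<Longrightarrow> - f \<in> U x y"
    using sub_subspace[OF assms] by (simp_all add: subspace_0 subspace_add subspace_scale subspace_neg)
qed

lemma End_ring_simps [simp]:
  "carrier (End_ring G U x) = U x x" "monoid.mult (End_ring G U x) = Comp G x x x"
  "one (End_ring G U x) = Ide G x" "ring.zero (End_ring G U x) = 0" "ring.add (End_ring G U x) = (+)"
  by (simp_all add: End_ring_def)

lemma ring_End_ring:
  assumes x: "x \<in> Obj G"
  shows "ring (End_ring G U x)"
proof (rule ringI)
  show "abelian_group (End_ring G U x)"
  proof (rule abelian_groupI)
    show "\<exists>g\<in>carrier (End_ring G U x). g \<oplus>\<^bsub>End_ring G U x\<^esub> f = \<zero>\<^bsub>End_ring G U x\<^esub>"
      if "f \<in> carrier (End_ring G U x)" for f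
      using that sub_uminus[OF x x] by (intro bexI[of _ "- f"]) auto
  qed (use x in \<open>auto simp: sub_zero sub_add add_ac\<close>)
  show "monoid (End_ring G U x)"
    by (rule monoidI) (use x in \<open>auto simp: sub_Comp sub_Ide Ide_left Ide_right sub_Hom intro!: Comp_assoc[symmetric]\<close>)
qed (use x in \<open>auto simp: Comp_add_left Comp_add_right sub_Hom\<close>)

text \<open>A scalar acts as left multiplication by that multiple of the identity, so the merely
  additive closure of a left ideal is already linear. This opens left ideals to linear
  projections.\<close>

lemma left_ideal_End_ring_iff:
  assumes x: "x \<in> Obj G"
  shows "left_ideal I (End_ring G U x) \<longleftrightarrow>
    I \<subseteq> U x x \<and> module.subspace (Scale G) I \<and> (\<forall>r \<in> U x x. \<forall>a \<in> I. Comp G x x x r a \<in> I)"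
proof -
  interpret vector_space "Scale G" by (rule vector_space_Scale)
  interpret R: ring "End_ring G U x" by (rule ring_End_ring[OF x])
  have inv: "inv\<^bsub>add_monoid (End_ring G U x)\<^esub> f = - f" if "f \<in> U x x" for f
    unfolding a_inv_def[symmetric] by (rule R.minus_equality) (use that x sub_uminus in auto)
  show ?thesis
  proof
    assume I: "left_ideal I (End_ring G U x)"
    then have sub: "subgroup I (add_monoid (End_ring G U x))"
      and mult: "\<forall>r \<in> U x x. \<forall>a \<in> I. Comp G x x x r a \<in> I"
      by (auto simp: left_ideal_def additive_subgroup_def)
    have IU: "I \<subseteq> U x x" using subgroup.subset[OF sub] by simp
    have "Scale G c a \<in> I" if "a \<in> I" for c a
    proof -
      have "a \<in> U x x" using that IU by blast
      then have "Comp G x x x (Scale G c (Ide G x)) a = Scale G c a"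
        using x by (simp add: Comp_Scale_left sub_Hom Ide_closed Ide_left)
      moreover have "Scale G c (Ide G x) \<in> U x x" using x sub_scale sub_Ide by blast
      ultimately show ?thesis using mult that by metis
    qed
    moreover have "0 \<in> I" using subgroup.one_closed[OF sub] by simp
    moreover have "a + b \<in> I" if "a \<in> I" "b \<in> I" for a b using subgroup.m_closed[OF sub that] by simp
    ultimately show "I \<subseteq> U x x \<and> subspace I \<and> (\<forall>r \<in> U x x. \<forall>a \<in> I. Comp G x x x r a \<in> I)"
      using IU mult by (simp add: subspace_def)
  next
    assume I: "I \<subseteq> U x x \<and> subspace I \<and> (\<forall>r \<in> U x x. \<forall>a \<in> I. Comp G x x x r a \<in> I)"
    have "subgroup I (add_monoid (End_ring G U x))"
    proof
      show "inv\<^bsub>add_monoid (End_ring G U x)\<^esub> f \<in> I" if "f \<in> I" for f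
        using that I inv[of f] subspace_neg by auto
    qed (use I subspace_0 subspace_add in auto)
    then show "left_ideal I (End_ring G U x)" using I by (auto simp: left_ideal_def additive_subgroup_def)
  qed
qed

end

lemma flip_diagram_comp:
  assumes \<alpha>: "\<alpha> \<in> partition_diagrams S T" and \<beta>: "\<beta> \<in> partition_diagrams T U"
  shows "flip (diagram_comp \<beta> \<alpha>) = diagram_comp (flip \<alpha>) (flip \<beta>)"
proof -
  interpret c: composable S T U \<alpha> \<beta> by standard fact+
  interpret f: composable U T S "flip \<beta>" "flip \<alpha>" by standard (rule flip_closed, fact)+
  show ?thesis
    by (rule diagram_eqI[OF flip_closed[OF c.diagram_comp_closed] f.diagram_comp_closed])
      (simp add: cut_rel_flip c.cut_rel_diagram_comp f.cut_rel_diagram_comp converse_relcomp)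
qed

text \<open>Maschke's theorem for the symmetric group: averaging a linear projection onto a left ideal over
  the group makes it commute with left multiplication, so its kernel is a complementary left ideal.\<close>

lemma semisimple_End_upwards:
  assumes fin: "finite S"
  shows "semisimple_ring (End_ring (partition_category \<delta>) (upwards_Hom \<delta>) S)"
proof -
  interpret U: wide_subcategory "partition_category \<delta>" "upwards_Hom \<delta>" by (rule wide_subcategory_upwards)
  let ?R = "End_ring (partition_category \<delta>) (upwards_Hom \<delta>) S"
  \<comment> \<open>The group to be averaged over: the basis of the endomorphism ring, closed under
    composition, with \<open>flip\<close> as inverse and without powers of \<delta>.\<close>
  define P where "P = {\<sigma>. upwards_diagram S S \<sigma>}"
  define V where "V = {f :: 'a diagram \<Rightarrow>\<^sub>0 complex. Poly_Mapping.keys f \<subseteq> P}"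
  define e where "e \<sigma> = Poly_Mapping.single \<sigma> (1 :: complex)" for \<sigma> :: "'a diagram"
  define m where "m = partition_comp \<delta> S S S"
  let ?sc = "\<lambda>c. Poly_Mapping.map ((*) (c :: complex)) :: ('a diagram \<Rightarrow>\<^sub>0 complex) \<Rightarrow> _"
  have S: "S \<in> Obj (partition_category \<delta>)" using fin by simp
  have V: "upwards_Hom \<delta> S S = V" by (simp add: upwards_Hom_eq V_def P_def)
  have Ppd: "P \<subseteq> partition_diagrams S S" by (auto simp: P_def upwards_diagram_def)
  have finP: "finite P" using finite_subset[OF Ppd] finite_partition_diagrams fin by blast
  have idP: "id_diagram S \<in> P" using fin by (simp add: P_def id_diagram_upwards)
  have Pcomp: "diagram_comp \<sigma> \<tau> \<in> P" if "\<sigma> \<in> P" "\<tau> \<in> P" for \<sigma> \<tau>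
    using that fin upwards_diagram_comp by (auto simp: P_def)
  have Pflip: "flip \<sigma> \<in> P" if "\<sigma> \<in> P" for \<sigma> using that fin flip_upwards_endo by (auto simp: P_def)
  have Pinv: "diagram_comp (flip \<sigma>) \<sigma> = id_diagram S" "diagram_comp \<sigma> (flip \<sigma>) = id_diagram S"
    if "\<sigma> \<in> P" for \<sigma>
    using flip_comp_id[of S S \<sigma>] flip_comp_id[of S S "flip \<sigma>"] that Pflip[OF that] fin by (auto simp: P_def)
  have Pmid: "middle_count S \<sigma> \<tau> = 0" if "\<sigma> \<in> P" "\<tau> \<in> P" for \<sigma> \<tau>
    by (rule middle_count_upwards[OF fin, of _ S S]) (use that Ppd in \<open>auto simp: P_def\<close>)
  have eV: "e \<sigma> \<in> V" if "\<sigma> \<in> P" for \<sigma> using that by (simp add: e_def V_def)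
  have ee: "m (e \<sigma>) (e \<tau>) = e (diagram_comp \<sigma> \<tau>)" if "\<sigma> \<in> P" "\<tau> \<in> P" for \<sigma> \<tau>
    using that Pmid by (simp add: m_def e_def)
  have V_pd: "Poly_Mapping.keys f \<subseteq> partition_diagrams S S" if "f \<in> V" for f using that Ppd by (auto simp: V_def)
  have assoc: "m h (m g f) = m (m h g) f" if "f \<in> V" "g \<in> V" "h \<in> V" for f g h
    unfolding m_def by (rule partition_comp_assoc) (use that V_pd fin in auto)
  have one: "m (e (id_diagram S)) f = f" if "f \<in> V" for f
    unfolding m_def e_def by (rule partition_comp_id_left) (use that V_pd fin in auto)
  have mV: "m g f \<in> V" if "f \<in> V" "g \<in> V" for f g
    unfolding m_def V_def mem_Collect_eq
    by (rule partition_comp_closed) (use that Pcomp in \<open>auto simp: V_def\<close>)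
  have Vsub: "pm.subspace V" unfolding V_def by (rule subspace_keys_subset)
  have m_add: "m (g + g') f = m g f + m g' f" "m g (f + f') = m g f + m g f'" for f f' g g'
    by (simp_all add: m_def partition_comp_add_left partition_comp_add_right)
  have m_scale: "m (?sc c g) f = ?sc c (m g f)" "m g (?sc c f) = ?sc c (m g f)" for c f g
    by (simp_all add: m_def partition_comp_scale_left partition_comp_scale_right)
  have m_sum: "m g (\<Sum>i\<in>A. h i) = (\<Sum>i\<in>A. m g (h i))" for g A and h :: "'a diagram \<Rightarrow> _"
    by (simp add: m_def partition_comp_sum_right)
  have compl: "\<exists>J. left_ideal J ?R \<and> I \<inter> J = {\<zero>\<^bsub>?R\<^esub>} \<and> I <+>\<^bsub>?R\<^esub> J = carrier ?R" if "left_ideal I ?R" for I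
  proof -
    have IV: "I \<subseteq> V" and Isub: "pm.subspace I" and Imult: "\<And>r a. r \<in> V \<Longrightarrow> a \<in> I \<Longrightarrow> m r a \<in> I"
      using that unfolding U.left_ideal_End_ring_iff[OF S] V Scale_partition_category
      by (auto simp: m_def)
    \<comment> \<open>A linear projection onto \<open>I\<close> that need not respect
      multiplication, obtained as a left inverse of the inclusion.\<close>
    obtain p where p: "range p \<subseteq> I" "Vector_Spaces.linear ?sc ?sc p" "\<And>v. v \<in> I \<Longrightarrow> p v = v"
    proof -
      have "inj_on (\<lambda>v :: 'a diagram \<Rightarrow>\<^sub>0 complex. v) I" by simp
      from pm_pair.linear_exists_left_inverse_on[OF pm.linear_ident Isub this] that show thesis
        by (elim exE conjE) blast
    qed
    interpret p: Vector_Spaces.linear ?sc ?sc p by fact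
    define \<pi> where "\<pi> a = ?sc (1 / of_nat (card P)) (\<Sum>\<sigma>\<in>P. m (e (flip \<sigma>)) (p (m (e \<sigma>) a)))" for a
    have \<pi>_add: "\<pi> (a + b) = \<pi> a + \<pi> b" for a b
      by (simp add: \<pi>_def m_add p.add sum.distrib pm.scale_right_distrib)
    have \<pi>_scale: "\<pi> (?sc c a) = ?sc c (\<pi> a)" for a c
      by (simp add: \<pi>_def m_scale p.scale pm.scale_sum_right mult.commute)
    have \<pi>_I: "\<pi> a \<in> I" if "a \<in> V" for a
      unfolding \<pi>_def using p(1) Pflip eV
      by (intro pm.subspace_scale[OF Isub] pm.subspace_sum[OF Isub] Imult) auto
    have \<pi>_id: "\<pi> a = a" if a: "a \<in> I" for a
    proof -
      have "m (e (flip \<sigma>)) (p (m (e \<sigma>) a)) = a" if "\<sigma> \<in> P" for \<sigma>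
      proof -
        have "m (e (flip \<sigma>)) (p (m (e \<sigma>) a)) = m (e (flip \<sigma>)) (m (e \<sigma>) a)"
          using p(3) Imult eV that a by simp
        also have "\<dots> = a"
          using assoc[of a "e \<sigma>" "e (flip \<sigma>)"] IV a eV that Pflip ee Pinv one by auto
        finally show ?thesis .
      qed
      then have "(\<Sum>\<sigma>\<in>P. m (e (flip \<sigma>)) (p (m (e \<sigma>) a))) = (\<Sum>\<sigma>\<in>P. a)" by simp
      also have "\<dots> = ?sc (of_nat (card P)) a"
        by (rule poly_mapping_eqI) (simp add: lookup_sum)
      \<comment> \<open>The averaging factor cancels in characteristic 0, \<open>P\<close> being
        finite and containing the identity diagram.\<close>
      finally show ?thesis unfolding \<pi>_def using finP idP by (auto simp: card_gt_0_iff)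
    qed
    have \<pi>_e: "\<pi> (m (e \<tau>) a) = m (e \<tau>) (\<pi> a)" if \<tau>: "\<tau> \<in> P" and a: "a \<in> V" for \<tau> a
    proof -
      \<comment> \<open>Equivariance comes from reindexing the average by right translation with
        \<tau>, whose inverse is translation by \<open>flip \<tau>\<close>.\<close>
      have bij: "bij_betw (\<lambda>\<sigma>. diagram_comp \<sigma> \<tau>) P P"
      proof (rule bij_betw_byWitness[where f' = "\<lambda>\<sigma>. diagram_comp \<sigma> (flip \<tau>)"])
        have *: "diagram_comp (diagram_comp \<sigma> \<mu>) \<nu> = \<sigma>"
          if "\<sigma> \<in> P" "\<mu> \<in> P" "\<nu> \<in> P" "diagram_comp \<mu> \<nu> = id_diagram S" for \<sigma> \<mu> \<nu>
        proof -
          have "diagram_comp (diagram_comp \<sigma> \<mu>) \<nu> = diagram_comp \<sigma> (diagram_comp \<mu> \<nu>)"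
            by (rule diagram_comp_assoc[symmetric]) (use that Ppd in auto)
          then show ?thesis using that Ppd diagram_comp_id_right[of \<sigma> S S] fin by auto
        qed
        show "\<forall>\<sigma>\<in>P. diagram_comp (diagram_comp \<sigma> \<tau>) (flip \<tau>) = \<sigma>"
          "\<forall>\<sigma>\<in>P. diagram_comp (diagram_comp \<sigma> (flip \<tau>)) \<tau> = \<sigma>"
          using * \<tau> Pflip Pinv by auto
      qed (use \<tau> Pflip Pcomp in auto)
      have "m (e \<tau>) (m (e (flip (diagram_comp \<sigma> \<tau>))) (p (m (e (diagram_comp \<sigma> \<tau>)) a)))
          = m (e (flip \<sigma>)) (p (m (e \<sigma>) (m (e \<tau>) a)))" if \<sigma>: "\<sigma> \<in> P" for \<sigma>
      proof -
        have 1: "m (e \<sigma>) (m (e \<tau>) a) = m (e (diagram_comp \<sigma> \<tau>)) a"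
          using assoc[of a "e \<tau>" "e \<sigma>"] a eV \<sigma> \<tau> ee by simp
        have "diagram_comp \<tau> (flip (diagram_comp \<sigma> \<tau>)) = diagram_comp \<tau> (diagram_comp (flip \<tau>) (flip \<sigma>))"
          using flip_diagram_comp[OF subsetD[OF Ppd \<tau>] subsetD[OF Ppd \<sigma>]] by simp
        also have "\<dots> = diagram_comp (diagram_comp \<tau> (flip \<tau>)) (flip \<sigma>)"
          by (rule diagram_comp_assoc) (use \<sigma> \<tau> Ppd Pflip in auto)
        also have "\<dots> = flip \<sigma>"
          using Pinv(2)[OF \<tau>] diagram_comp_id_left[of "flip \<sigma>" S S] Pflip[OF \<sigma>] Ppd fin by auto
        finally have 2: "diagram_comp \<tau> (flip (diagram_comp \<sigma> \<tau>)) = flip \<sigma>" .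
        have "p (m (e (diagram_comp \<sigma> \<tau>)) a) \<in> V" using p(1) IV by blast
        from assoc[OF this eV[OF Pflip[OF Pcomp[OF \<sigma> \<tau>]]] eV[OF \<tau>]]
        show ?thesis unfolding 1 using ee[OF \<tau> Pflip[OF Pcomp[OF \<sigma> \<tau>]]] 2 by simp
      qed
      then have "(\<Sum>\<sigma>\<in>P. m (e (flip \<sigma>)) (p (m (e \<sigma>) (m (e \<tau>) a))))
          = (\<Sum>\<sigma>\<in>P. m (e \<tau>) (m (e (flip (diagram_comp \<sigma> \<tau>))) (p (m (e (diagram_comp \<sigma> \<tau>)) a))))"
        by simp
      also have "\<dots> = (\<Sum>\<sigma>\<in>P. m (e \<tau>) (m (e (flip \<sigma>)) (p (m (e \<sigma>) a))))"
        by (rule sum.reindex_bij_betw[OF bij])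
      finally show ?thesis unfolding \<pi>_def m_scale m_sum by simp
    qed
    have \<pi>_mult: "\<pi> (m r a) = m r (\<pi> a)" if r: "r \<in> V" and a: "a \<in> V" for r a
    proof -
      have "Poly_Mapping.keys r \<subseteq> P" using r by (simp add: V_def)
      then show ?thesis
      proof (induction rule: keys_subset_induct)
        case zero
        show ?case using \<pi>_scale[of 0 0] by (simp add: m_def)
      next
        case (single \<tau> c)
        have "Poly_Mapping.single \<tau> c = ?sc c (e \<tau>)" by (simp add: e_def)
        then show ?case using single a by (simp add: m_scale \<pi>_scale \<pi>_e)
      qed (simp add: m_add \<pi>_add)
    qed
    define J where "J = {a \<in> V. \<pi> a = 0}"
    have \<pi>0: "\<pi> 0 = 0" using \<pi>_id[OF pm.subspace_0[OF Isub]] .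
    have "pm.subspace J" unfolding pm.subspace_def J_def
      using pm.subspace_0[OF Vsub] pm.subspace_add[OF Vsub] pm.subspace_scale[OF Vsub]
      by (auto simp: \<pi>0 \<pi>_add \<pi>_scale)
    moreover have "m r a \<in> J" if "r \<in> V" "a \<in> J" for r a
      using that mV by (auto simp: J_def \<pi>_mult) (simp add: m_def)
    ultimately have "left_ideal J ?R"
      unfolding U.left_ideal_End_ring_iff[OF S] V Scale_partition_category by (auto simp: J_def m_def)
    moreover have "I \<inter> J = {\<zero>\<^bsub>?R\<^esub>}"
      using \<pi>_id pm.subspace_0[OF Isub] pm.subspace_0[OF Vsub] \<pi>0 by (auto simp: J_def)
    moreover have "I <+>\<^bsub>?R\<^esub> J = carrier ?R"
    proof -
      \<comment> \<open>The decomposition belonging to the averaged projection: \<open>a\<close> is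
        the sum of \<open>\<pi> a\<close> and \<open>a - \<pi> a\<close>.\<close>
      have "\<exists>i\<in>I. \<exists>j\<in>J. a = i + j" if a: "a \<in> V" for a
      proof (intro bexI)
        show "\<pi> a \<in> I" by (rule \<pi>_I[OF a])
        have "\<pi> (a - \<pi> a) + \<pi> (\<pi> a) = \<pi> a" by (simp flip: \<pi>_add)
        then have "\<pi> (a - \<pi> a) = 0" using \<pi>_id \<pi>_I a by simp
        then show "a - \<pi> a \<in> J" using a \<pi>_I[OF a] IV pm.subspace_diff[OF Vsub] by (auto simp: J_def)
      qed simp
      moreover have "i + j \<in> V" if "i \<in> I" "j \<in> J" for i j
        using that IV pm.subspace_add[OF Vsub] by (auto simp: J_def)
      ultimately show ?thesis by (auto simp: set_add_def set_mult_def V)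
    qed
    ultimately show ?thesis by blast
  qed
  show ?thesis unfolding semisimple_ring_def using U.ring_End_ring[OF S] compl by blast
qed

subsection \<open>Factorisation into a downwards and an upwards diagram\<close>

text \<open>\<open>half \<alpha> L P e\<close> keeps the side \<open>L\<close> of every part and ends the parts in \<open>P\<close> at the points given by \<open>e\<close>.\<close>

definition half :: "'b set \<Rightarrow> ('b \<Rightarrow> 'a set) \<Rightarrow> 'b set \<Rightarrow> ('b \<Rightarrow> 'a) \<Rightarrow> 'a diagram" where
  "half \<alpha> L P e = (\<lambda>p. L p \<uplus> (if p \<in> P then {e p} else {})) ` {p \<in> \<alpha>. L p \<noteq> {}}"

context
  fixes \<alpha> :: "'b set" and L :: "'b \<Rightarrow> 'a set" and P :: "'b set" and e :: "'b \<Rightarrow> 'a" and S Y :: "'a set"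
  assumes L_Un: "(\<Union>p\<in>\<alpha>. L p) = S"
    and L_disj: "\<And>p q. \<lbrakk>p \<in> \<alpha>; q \<in> \<alpha>; p \<noteq> q\<rbrakk> \<Longrightarrow> L p \<inter> L q = {}"
    and P: "P \<subseteq> {p \<in> \<alpha>. L p \<noteq> {}}"
    and e: "bij_betw e P Y"
begin

lemma half_closed: "half \<alpha> L P e \<in> partition_diagrams S Y"
proof -
  have "partition_on (S \<uplus> Y) (half \<alpha> L P e)"
  proof (rule partition_onI)
    have "\<Union> (half \<alpha> L P e) = (\<Union>p\<in>{p \<in> \<alpha>. L p \<noteq> {}}. L p) \<uplus> (e ` P)"
      unfolding half_def using P by (force split: if_splits)
    also have "(\<Union>p\<in>{p \<in> \<alpha>. L p \<noteq> {}}. L p) = S" using L_Un by blast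
    also have "e ` P = Y" using e by (simp add: bij_betw_def)
    finally show "\<Union> (half \<alpha> L P e) = S \<uplus> Y" .
    show "{} \<notin> half \<alpha> L P e" by (auto simp: half_def)
    fix p q assume "p \<in> half \<alpha> L P e" "q \<in> half \<alpha> L P e" "p \<noteq> q"
    then obtain p' q' where pq: "p' \<in> \<alpha>" "q' \<in> \<alpha>" "p' \<noteq> q'" and
      p: "p = L p' \<uplus> (if p' \<in> P then {e p'} else {})" and
      q: "q = L q' \<uplus> (if q' \<in> P then {e q'} else {})"
      unfolding half_def by blast
    have "e p' \<noteq> e q'" if "p' \<in> P" "q' \<in> P" using e pq that by (auto simp: bij_betw_def inj_on_def)
    then show "disjnt p q" unfolding p q disjnt_def Plus_Int using L_disj[OF pq] by auto
  qed
  then show ?thesis by (simp add: partition_diagrams_def)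
qed

lemma half_downwards: "downwards_diagram S Y (half \<alpha> L P e)"
  unfolding downwards_diagram_def
proof (intro conjI ballI half_closed)
  fix p assume "p \<in> half \<alpha> L P e"
  then obtain q where q: "q \<in> \<alpha>" "L q \<noteq> {}" and p: "p = L q \<uplus> (if q \<in> P then {e q} else {})"
    unfolding half_def by blast
  have "L q \<subseteq> S" using L_Un q by blast
  then show "p \<inter> Inl ` S \<noteq> {}" using q(2) unfolding p by blast
  have "p \<inter> Inr ` Y = {} \<or> p \<inter> Inr ` Y = {Inr (e q)}" unfolding p by auto
  then show "card (p \<inter> Inr ` Y) \<in> {0, 1}" by (elim disjE) simp_all
qed

text \<open>Quantifying over all of \<alpha> is harmless: an element with empty \<open>L\<close> is
  outside \<open>P\<close> and satisfies the condition trivially. In this form the two halves of one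
  diagram can be compared element by element.\<close>

lemma cut_rel_half_iff:
  "(A, B) \<in> cut_rel S Y (half \<alpha> L P e) \<longleftrightarrow> A \<subseteq> S \<and> B \<subseteq> Y \<and>
    (\<forall>p\<in>\<alpha>. (L p \<subseteq> A \<or> L p \<inter> A = {}) \<and> (p \<in> P \<longrightarrow> (e p \<in> B \<longleftrightarrow> L p \<inter> A \<noteq> {})))"
proof -
  have "(L p \<uplus> (if p \<in> P then {e p} else {}) \<subseteq> A \<uplus> B \<or> (L p \<uplus> (if p \<in> P then {e p} else {})) \<inter> (A \<uplus> B) = {})
    \<longleftrightarrow> (L p \<subseteq> A \<or> L p \<inter> A = {}) \<and> (p \<in> P \<longrightarrow> (e p \<in> B \<longleftrightarrow> L p \<inter> A \<noteq> {}))"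
    if "L p \<noteq> {}" for p
    unfolding Plus_subset_Plus Plus_Int Plus_eq_empty_conv using that by (cases "p \<in> P") auto
  then have "A \<uplus> B \<in> saturated (half \<alpha> L P e) \<longleftrightarrow>
      (\<forall>p\<in>{p\<in>\<alpha>. L p \<noteq> {}}. (L p \<subseteq> A \<or> L p \<inter> A = {}) \<and> (p \<in> P \<longrightarrow> (e p \<in> B \<longleftrightarrow> L p \<inter> A \<noteq> {})))"
    unfolding saturated_def half_def by simp
  also have "\<dots> \<longleftrightarrow> (\<forall>p\<in>\<alpha>. (L p \<subseteq> A \<or> L p \<inter> A = {}) \<and> (p \<in> P \<longrightarrow> (e p \<in> B \<longleftrightarrow> L p \<inter> A \<noteq> {})))"
    using P by blast
  finally show ?thesis by (simp add: cut_rel_def)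
qed

end

definition propagating :: "'a diagram \<Rightarrow> 'a diagram" where
  "propagating \<alpha> = {p \<in> \<alpha>. Inl -` p \<noteq> {} \<and> Inr -` p \<noteq> {}}"

text \<open>Each propagating part is cut in two, and both halves are attached to the same point of
  \<open>Y\<close>. Every other part stays whole on its own side.\<close>

lemma factorisation_exists:
  assumes \<alpha>_pd: "\<alpha> \<in> partition_diagrams S T" and Y: "finite Y" "card Y = card (propagating \<alpha>)"
    and fin: "finite S" "finite T"
  shows "\<exists>\<beta> \<gamma>. upwards_diagram Y T \<beta> \<and> downwards_diagram S Y \<gamma> \<and> diagram_comp \<beta> \<gamma> = \<alpha>"
proof -
  let ?P = "propagating \<alpha>" and ?L = "vimage Inl :: ('a + 'a) set \<Rightarrow> 'a set"
    and ?R = "vimage Inr :: ('a + 'a) set \<Rightarrow> 'a set"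
  have part: "partition_on (S \<uplus> T) \<alpha>" using \<alpha>_pd by (simp add: partition_diagrams_def)
  then have un: "\<Union>\<alpha> = S \<uplus> T" and dj: "disjoint \<alpha>" by (auto simp: partition_on_def)
  have "finite \<alpha>" using part fin by (metis finite_Plus finite_elements)
  then have "finite ?P" by (simp add: propagating_def)
  then obtain e where e: "bij_betw e ?P Y" using Y finite_same_card_bij by metis
  have L_Un: "(\<Union>p\<in>\<alpha>. ?L p) = S" and R_Un: "(\<Union>p\<in>\<alpha>. ?R p) = T"
    unfolding vimage_Union[symmetric] un by auto
  have L_disj: "?L p \<inter> ?L q = {}" and R_disj: "?R p \<inter> ?R q = {}" if "p \<in> \<alpha>" "q \<in> \<alpha>" "p \<noteq> q" for p q
    unfolding vimage_Int[symmetric] using dj that by (auto simp: disjoint_def)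
  have LP: "?P \<subseteq> {p \<in> \<alpha>. ?L p \<noteq> {}}" and RP: "?P \<subseteq> {p \<in> \<alpha>. ?R p \<noteq> {}}" by (auto simp: propagating_def)
  define \<gamma> where "\<gamma> = half \<alpha> ?L ?P e"
  \<comment> \<open>The upper half is built as a downwards diagram starting from \<open>T\<close>,
    with the same labels \<open>e\<close>, and then reversed.\<close>
  define \<beta> where "\<beta> = flip (half \<alpha> ?R ?P e)"
  have \<gamma>_iff: "(A, B) \<in> cut_rel S Y (half \<alpha> ?L ?P e) \<longleftrightarrow> A \<subseteq> S \<and> B \<subseteq> Y \<and>
    (\<forall>p\<in>\<alpha>. (?L p \<subseteq> A \<or> ?L p \<inter> A = {}) \<and> (p \<in> ?P \<longrightarrow> (e p \<in> B \<longleftrightarrow> ?L p \<inter> A \<noteq> {})))" for A B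
    by (rule cut_rel_half_iff[OF L_Un L_disj LP e])
  have \<beta>_iff: "(C, B) \<in> cut_rel T Y (half \<alpha> ?R ?P e) \<longleftrightarrow> C \<subseteq> T \<and> B \<subseteq> Y \<and>
    (\<forall>p\<in>\<alpha>. (?R p \<subseteq> C \<or> ?R p \<inter> C = {}) \<and> (p \<in> ?P \<longrightarrow> (e p \<in> B \<longleftrightarrow> ?R p \<inter> C \<noteq> {})))" for B C
    by (rule cut_rel_half_iff[OF R_Un R_disj RP e])
  have down: "downwards_diagram S Y \<gamma>" unfolding \<gamma>_def by (rule half_downwards[OF L_Un L_disj LP e])
  have up: "upwards_diagram Y T \<beta>"
    using half_downwards[OF R_Un R_disj RP e] unfolding \<beta>_def downwards_iff_upwards_flip .
  interpret composable S Y T \<gamma> \<beta>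
    by standard (use down up in \<open>auto simp: upwards_diagram_def downwards_diagram_def\<close>)
  have split: "p \<subseteq> A \<uplus> C \<longleftrightarrow> ?L p \<subseteq> A \<and> ?R p \<subseteq> C" "p \<inter> (A \<uplus> C) = {} \<longleftrightarrow> ?L p \<inter> A = {} \<and> ?R p \<inter> C = {}"
    for p A C
    using Plus_subset_Plus[of "?L p" "?R p" A C] Plus_Int[of "?L p" "?R p" A C] Plus_vimage[of p]
    by (metis, metis Plus_eq_empty_conv)
  have "(A, C) \<in> cut_rel S Y \<gamma> O cut_rel Y T \<beta> \<longleftrightarrow> (A, C) \<in> cut_rel S T \<alpha>" for A C
  proof
    assume "(A, C) \<in> cut_rel S Y \<gamma> O cut_rel Y T \<beta>"
    then obtain B where "(A, B) \<in> cut_rel S Y \<gamma>" "(C, B) \<in> cut_rel T Y (half \<alpha> ?R ?P e)"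
      unfolding \<beta>_def cut_rel_flip by blast
    then have AC: "A \<subseteq> S" "C \<subseteq> T" and
      *: "\<forall>p\<in>\<alpha>. (?L p \<subseteq> A \<or> ?L p \<inter> A = {}) \<and> (p \<in> ?P \<longrightarrow> (e p \<in> B \<longleftrightarrow> ?L p \<inter> A \<noteq> {}))"
      "\<forall>p\<in>\<alpha>. (?R p \<subseteq> C \<or> ?R p \<inter> C = {}) \<and> (p \<in> ?P \<longrightarrow> (e p \<in> B \<longleftrightarrow> ?R p \<inter> C \<noteq> {}))"
      unfolding \<gamma>_def \<gamma>_iff \<beta>_iff by simp_all
    have "p \<subseteq> A \<uplus> C \<or> p \<inter> (A \<uplus> C) = {}" if p: "p \<in> \<alpha>" for p
    proof (cases "p \<in> ?P")
      case True
      then show ?thesis unfolding split using *(1)[rule_format, OF p] *(2)[rule_format, OF p] by blast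
    next
      case False
      then have "?L p = {} \<or> ?R p = {}" using p by (auto simp: propagating_def)
      then show ?thesis unfolding split using *(1)[rule_format, OF p] *(2)[rule_format, OF p] by blast
    qed
    then show "(A, C) \<in> cut_rel S T \<alpha>" using AC by (simp add: cut_rel_def saturated_def)
  next
    assume AC: "(A, C) \<in> cut_rel S T \<alpha>"
    then have sub: "A \<subseteq> S" "C \<subseteq> T" and sat: "\<And>p. p \<in> \<alpha> \<Longrightarrow> p \<subseteq> A \<uplus> C \<or> p \<inter> (A \<uplus> C) = {}"
      by (auto simp: cut_rel_def saturated_def)
    \<comment> \<open>The only possible middle set: the labels of the propagating parts that lie in
      the cut.\<close>
    define B where "B = e ` {p \<in> ?P. ?L p \<inter> A \<noteq> {}}"
    have B: "B \<subseteq> Y" using e by (auto simp: B_def bij_betw_def)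
    have eB: "e p \<in> B \<longleftrightarrow> ?L p \<inter> A \<noteq> {}" if "p \<in> ?P" for p
      using e that unfolding B_def bij_betw_def by (subst inj_on_image_mem_iff) auto
    \<comment> \<open>A propagating part has points on both sides and lies wholly in or out of the
      cut, so either side decides, and \<open>B\<close> serves both halves.\<close>
    have RL: "?L p \<inter> A \<noteq> {} \<longleftrightarrow> ?R p \<inter> C \<noteq> {}" if "p \<in> ?P" for p
      using sat[of p] that unfolding split propagating_def by blast
    have "(A, B) \<in> cut_rel S Y \<gamma>"
      unfolding \<gamma>_def \<gamma>_iff
    proof (intro conjI ballI impI sub(1) B)
      fix p assume p: "p \<in> \<alpha>"
      show "?L p \<subseteq> A \<or> ?L p \<inter> A = {}" using sat[OF p] unfolding split by (elim disjE conjE) simp_all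
      show "e p \<in> B \<longleftrightarrow> ?L p \<inter> A \<noteq> {}" if "p \<in> ?P" using eB[OF that] .
    qed
    moreover have "(C, B) \<in> cut_rel T Y (half \<alpha> ?R ?P e)"
      unfolding \<beta>_iff
    proof (intro conjI ballI impI sub(2) B)
      fix p assume p: "p \<in> \<alpha>"
      show "?R p \<subseteq> C \<or> ?R p \<inter> C = {}" using sat[OF p] unfolding split by (elim disjE conjE) simp_all
      show "e p \<in> B \<longleftrightarrow> ?R p \<inter> C \<noteq> {}" if "p \<in> ?P" using eB[OF that] RL[OF that] by simp
    qed
    ultimately show "(A, C) \<in> cut_rel S Y \<gamma> O cut_rel Y T \<beta>" unfolding \<beta>_def cut_rel_flip by blast
  qed
  then have "cut_rel S T (diagram_comp \<beta> \<gamma>) = cut_rel S T \<alpha>"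
    unfolding cut_rel_diagram_comp by auto
  then have "diagram_comp \<beta> \<gamma> = \<alpha>" by (rule diagram_eqI[OF diagram_comp_closed \<alpha>_pd])
  with up down show ?thesis by blast
qed

text \<open>A middle set of one factorisation is matched with one of the other when both come from
  the same subset of \<open>S\<close>. \<open>Y\<close> and \<open>Y'\<close> are allowed to differ,
  so the statement yields both the permutation that is moved across a tensor and the equality of the
  sizes of the middle sets.\<close>

lemma factorisation_unique:
  assumes \<gamma>: "downwards_diagram S Y \<gamma>" and \<beta>: "upwards_diagram Y T \<beta>"
    and \<gamma>': "downwards_diagram S Y' \<gamma>'" and \<beta>': "upwards_diagram Y' T \<beta>'"
    and eq: "diagram_comp \<beta> \<gamma> = diagram_comp \<beta>' \<gamma>'"
    and fin: "finite Y" "finite Y'"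
  shows "\<exists>\<sigma>. upwards_diagram Y Y' \<sigma> \<and> diagram_comp \<sigma> \<gamma> = \<gamma>' \<and> diagram_comp \<beta>' \<sigma> = \<beta>"
proof -
  have pd: "\<gamma> \<in> partition_diagrams S Y" "\<beta> \<in> partition_diagrams Y T" "\<gamma>' \<in> partition_diagrams S Y'"
    "\<beta>' \<in> partition_diagrams Y' T"
    using assms by (auto simp: upwards_diagram_def downwards_diagram_def)
  interpret c: composable S Y T \<gamma> \<beta> by standard (use pd in auto)
  interpret c': composable S Y' T \<gamma>' \<beta>' by standard (use pd in auto)
  interpret s: composable Y S Y' "flip \<gamma>" \<gamma>' by standard (use pd flip_closed in auto)
  \<comment> \<open>The choice is forced: a downwards \<gamma> satisfies
    \<open>diagram_comp \<gamma> (flip \<gamma>) = id_diagram Y\<close>, so composing the wanted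
    equation for \<gamma>' with \<open>flip \<gamma>\<close> gives this diagram.\<close>
  define \<sigma> where "\<sigma> = diagram_comp \<gamma>' (flip \<gamma>)"
  have \<sigma>pd: "\<sigma> \<in> partition_diagrams Y Y'" unfolding \<sigma>_def by (rule s.diagram_comp_closed)
  interpret sg: composable S Y Y' \<gamma> \<sigma> by standard (use pd \<sigma>pd in auto)
  interpret bs: composable Y Y' T \<sigma> \<beta>' by standard (use pd \<sigma>pd in auto)
  have R\<sigma>: "(B, B') \<in> cut_rel Y Y' \<sigma> \<longleftrightarrow> (\<exists>A. (A, B) \<in> cut_rel S Y \<gamma> \<and> (A, B') \<in> cut_rel S Y' \<gamma>')" for B B'
    unfolding \<sigma>_def s.cut_rel_diagram_comp cut_rel_flip by blast
  have R: "(\<exists>B. (A, B) \<in> cut_rel S Y \<gamma> \<and> (B, C) \<in> cut_rel Y T \<beta>)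
      \<longleftrightarrow> (\<exists>B'. (A, B') \<in> cut_rel S Y' \<gamma>' \<and> (B', C) \<in> cut_rel Y' T \<beta>')" for A C
  proof -
    have "(A, C) \<in> cut_rel S Y \<gamma> O cut_rel Y T \<beta> \<longleftrightarrow> (A, C) \<in> cut_rel S Y' \<gamma>' O cut_rel Y' T \<beta>'"
      using eq c.cut_rel_diagram_comp c'.cut_rel_diagram_comp by simp
    then show ?thesis by blast
  qed
  have det: "B1 = B2" if "(A, B1) \<in> cut_rel S Y \<gamma>" "(A, B2) \<in> cut_rel S Y \<gamma>" for A B1 B2
    using downwards_single_valued[OF \<gamma> fin(1)] that .
  have det': "B1 = B2" if "(A, B1) \<in> cut_rel S Y' \<gamma>'" "(A, B2) \<in> cut_rel S Y' \<gamma>'" for A B1 B2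
    using downwards_single_valued[OF \<gamma>' fin(2)] that .
  have inj: "B1 = B2" if "(B1, C) \<in> cut_rel Y T \<beta>" "(B2, C) \<in> cut_rel Y T \<beta>" for C B1 B2
    using upwards_injective[OF \<beta> fin(1)] that .
  have inj': "B1 = B2" if "(B1, C) \<in> cut_rel Y' T \<beta>'" "(B2, C) \<in> cut_rel Y' T \<beta>'" for C B1 B2
    using upwards_injective[OF \<beta>' fin(2)] that .
  have surj: "\<exists>A. (A, B) \<in> cut_rel S Y \<gamma>" if "B \<subseteq> Y" for B
    using downwards_surj[OF \<gamma> fin(1) that] by metis
  have tot: "\<exists>C. (B, C) \<in> cut_rel Y T \<beta>" if "B \<subseteq> Y" for B
    using upwards_total[OF \<beta> fin(1) that] by metis
  have tot': "\<exists>C. (B, C) \<in> cut_rel Y' T \<beta>'" if "B \<subseteq> Y'" for B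
    using upwards_total[OF \<beta>' fin(2) that] by metis
  have sub: "B \<subseteq> Y" if "(A, B) \<in> cut_rel S Y \<gamma>" for A B using that by (simp add: cut_rel_def)
  have sub': "B \<subseteq> Y'" if "(A, B) \<in> cut_rel S Y' \<gamma>'" for A B using that by (simp add: cut_rel_def)
  have sub_up: "B \<subseteq> Y" if "(B, C) \<in> cut_rel Y T \<beta>" for B C using that by (simp add: cut_rel_def)
  \<comment> \<open>The matching does not depend on the chosen subset of \<open>S\<close>: two
    subsets with the same \<open>B\<close> reach a common \<open>C\<close> in the composite, and
    injectivity of \<beta>' then makes their middle sets in \<open>Y'\<close> equal.\<close>
  have \<sigma>\<gamma>: "(A, B') \<in> cut_rel S Y' \<gamma>'" if AB: "(A, B) \<in> cut_rel S Y \<gamma>" and BB': "(B, B') \<in> cut_rel Y Y' \<sigma>" for A B B'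
  proof -
    obtain A0 where A0: "(A0, B) \<in> cut_rel S Y \<gamma>" "(A0, B') \<in> cut_rel S Y' \<gamma>'" using BB' R\<sigma> by blast
    obtain C where C: "(B, C) \<in> cut_rel Y T \<beta>" using tot[OF sub[OF AB]] by blast
    obtain B1 where B1: "(A0, B1) \<in> cut_rel S Y' \<gamma>'" "(B1, C) \<in> cut_rel Y' T \<beta>'" using R A0(1) C by blast
    obtain B2 where B2: "(A, B2) \<in> cut_rel S Y' \<gamma>'" "(B2, C) \<in> cut_rel Y' T \<beta>'" using R AB C by blast
    have "B1 = B'" using det'[OF B1(1) A0(2)] .
    moreover have "B1 = B2" using inj'[OF B1(2) B2(2)] .
    ultimately show ?thesis using B2(1) by simp
  qed
  have "Pow Y \<subseteq> Domain (cut_rel Y Y' \<sigma>)"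
  proof
    fix B assume "B \<in> Pow Y"
    then obtain A C where "(A, B) \<in> cut_rel S Y \<gamma>" "(B, C) \<in> cut_rel Y T \<beta>" using surj tot by blast
    then obtain B' where "(A, B') \<in> cut_rel S Y' \<gamma>'" using R by blast
    then show "B \<in> Domain (cut_rel Y Y' \<sigma>)" using R\<sigma> \<open>(A, B) \<in> cut_rel S Y \<gamma>\<close> by blast
  qed
  \<comment> \<open>The same argument with the factorisations exchanged: a common \<open>C\<close>
    beyond \<open>B'\<close> and injectivity of \<beta>.\<close>
  moreover have "B1 = B2" if B1: "(B1, B') \<in> cut_rel Y Y' \<sigma>" and B2: "(B2, B') \<in> cut_rel Y Y' \<sigma>" for B1 B2 B'
  proof -
    obtain A1 where A1: "(A1, B1) \<in> cut_rel S Y \<gamma>" "(A1, B') \<in> cut_rel S Y' \<gamma>'" using B1 R\<sigma> by blast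
    obtain A2 where A2: "(A2, B2) \<in> cut_rel S Y \<gamma>" "(A2, B') \<in> cut_rel S Y' \<gamma>'" using B2 R\<sigma> by blast
    obtain C where C: "(B', C) \<in> cut_rel Y' T \<beta>'" using tot'[OF sub'[OF A1(2)]] by blast
    obtain D1 where D1: "(A1, D1) \<in> cut_rel S Y \<gamma>" "(D1, C) \<in> cut_rel Y T \<beta>" using R A1(2) C by blast
    obtain D2 where D2: "(A2, D2) \<in> cut_rel S Y \<gamma>" "(D2, C) \<in> cut_rel Y T \<beta>" using R A2(2) C by blast
    show ?thesis using det[OF D1(1) A1(1)] det[OF D2(1) A2(1)] inj[OF D1(2) D2(2)] by simp
  qed
  ultimately have \<sigma>: "upwards_diagram Y Y' \<sigma>"
    unfolding upwards_iff_cut_rel[OF fin(1)] single_valued_def using \<sigma>pd by blast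
  have "(A, B') \<in> cut_rel S Y \<gamma> O cut_rel Y Y' \<sigma> \<longleftrightarrow> (A, B') \<in> cut_rel S Y' \<gamma>'" for A B'
  proof
    assume AB': "(A, B') \<in> cut_rel S Y' \<gamma>'"
    obtain C where "(B', C) \<in> cut_rel Y' T \<beta>'" using tot'[OF sub'[OF AB']] by blast
    then obtain B where B: "(A, B) \<in> cut_rel S Y \<gamma>" using R AB' by blast
    then have "(B, B') \<in> cut_rel Y Y' \<sigma>" using R\<sigma> AB' by blast
    with B show "(A, B') \<in> cut_rel S Y \<gamma> O cut_rel Y Y' \<sigma>" by blast
  qed (use \<sigma>\<gamma> in blast)
  then have "cut_rel S Y' (diagram_comp \<sigma> \<gamma>) = cut_rel S Y' \<gamma>'" unfolding sg.cut_rel_diagram_comp by auto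
  then have 1: "diagram_comp \<sigma> \<gamma> = \<gamma>'" by (rule diagram_eqI[OF sg.diagram_comp_closed pd(3)])
  have "(B, C) \<in> cut_rel Y Y' \<sigma> O cut_rel Y' T \<beta>' \<longleftrightarrow> (B, C) \<in> cut_rel Y T \<beta>" for B C
  proof
    assume "(B, C) \<in> cut_rel Y Y' \<sigma> O cut_rel Y' T \<beta>'"
    then obtain A B' where A: "(A, B) \<in> cut_rel S Y \<gamma>" "(A, B') \<in> cut_rel S Y' \<gamma>'" "(B', C) \<in> cut_rel Y' T \<beta>'"
      using R\<sigma> by blast
    then obtain B1 where "(A, B1) \<in> cut_rel S Y \<gamma>" "(B1, C) \<in> cut_rel Y T \<beta>" using R by blast
    then show "(B, C) \<in> cut_rel Y T \<beta>" using det[OF A(1)] by simp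
  next
    assume BC: "(B, C) \<in> cut_rel Y T \<beta>"
    obtain A where A: "(A, B) \<in> cut_rel S Y \<gamma>" using surj[OF sub_up[OF BC]] by blast
    then obtain B' where B': "(A, B') \<in> cut_rel S Y' \<gamma>'" "(B', C) \<in> cut_rel Y' T \<beta>'" using R BC by blast
    then have "(B, B') \<in> cut_rel Y Y' \<sigma>" using R\<sigma> A by blast
    then show "(B, C) \<in> cut_rel Y Y' \<sigma> O cut_rel Y' T \<beta>'" using B'(2) by blast
  qed
  then have "cut_rel Y T (diagram_comp \<beta>' \<sigma>) = cut_rel Y T \<beta>" unfolding bs.cut_rel_diagram_comp by auto
  then have 2: "diagram_comp \<beta>' \<sigma> = \<beta>" by (rule diagram_eqI[OF bs.diagram_comp_closed pd(2)])
  show ?thesis using \<sigma> 1 2 by blast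
qed

subsection \<open>Tensor products\<close>

locale tensor_data =
  fixes A :: "'r set" and M :: "'m::ab_group_add set" and ra :: "'m \<Rightarrow> 'r \<Rightarrow> 'm"
    and N :: "'n::ab_group_add set" and la :: "'r \<Rightarrow> 'n \<Rightarrow> 'n"
  assumes M_zero: "0 \<in> M" and M_add: "\<lbrakk>m \<in> M; m' \<in> M\<rbrakk> \<Longrightarrow> m + m' \<in> M"
    and N_zero: "0 \<in> N" and N_add: "\<lbrakk>n \<in> N; n' \<in> N\<rbrakk> \<Longrightarrow> n + n' \<in> N"
    and ra_closed: "\<lbrakk>m \<in> M; r \<in> A\<rbrakk> \<Longrightarrow> ra m r \<in> M"
    and la_closed: "\<lbrakk>r \<in> A; n \<in> N\<rbrakk> \<Longrightarrow> la r n \<in> N"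
begin

abbreviation F :: "('m \<times> 'n \<Rightarrow>\<^sub>0 int) monoid" where
  "F \<equiv> free_Abelian_group (M \<times> N)"

abbreviation null :: "('m \<times> 'n \<Rightarrow>\<^sub>0 int) set" where
  "null \<equiv> tensor_null A M ra N la"

text \<open>Congruence modulo the tensor relations. Calculating with representatives postpones
  cosets until the factor group itself is mentioned.\<close>

definition teq :: "('m \<times> 'n \<Rightarrow>\<^sub>0 int) \<Rightarrow> ('m \<times> 'n \<Rightarrow>\<^sub>0 int) \<Rightarrow> bool" (infix "\<simeq>" 50) where
  "u \<simeq> v \<longleftrightarrow> u - v \<in> null"

lemma keys_diff_subset: "Poly_Mapping.keys u \<subseteq> K \<Longrightarrow> Poly_Mapping.keys v \<subseteq> K \<Longrightarrow> Poly_Mapping.keys (u - v) \<subseteq> K"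
  for u v :: "'b \<Rightarrow>\<^sub>0 'c::ab_group_add"
  by (auto simp: in_keys_iff lookup_minus subset_iff) (metis diff_zero)

lemma relators_subset: "tensor_relators A M ra N la \<subseteq> carrier F"
proof
  fix u assume "u \<in> tensor_relators A M ra N la"
  then consider m m' n where "u = frag_of (m + m', n) - frag_of (m, n) - frag_of (m', n)" "m \<in> M" "m' \<in> M" "n \<in> N"
    | m n n' where "u = frag_of (m, n + n') - frag_of (m, n) - frag_of (m, n')" "m \<in> M" "n \<in> N" "n' \<in> N"
    | m r n where "u = frag_of (ra m r, n) - frag_of (m, la r n)" "m \<in> M" "r \<in> A" "n \<in> N"
    unfolding tensor_relators_def by blast
  then show "u \<in> carrier F"
    by cases (simp_all add: keys_diff_subset M_add N_add ra_closed la_closed)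
qed

lemma subgroup_null: "subgroup null F"
  unfolding tensor_null_def using group.generate_is_subgroup[OF group_free_Abelian_group relators_subset] .

lemma null_subset: "u \<in> null \<Longrightarrow> Poly_Mapping.keys u \<subseteq> M \<times> N"
  using subsetD[OF subgroup.subset[OF subgroup_null], of u] by (simp only: carrier_free_Abelian_group_iff)

lemma null_zero: "0 \<in> null"
  using subgroup.one_closed[OF subgroup_null] by simp

lemma null_add: "\<lbrakk>u \<in> null; v \<in> null\<rbrakk> \<Longrightarrow> u + v \<in> null"
  using subgroup.m_closed[OF subgroup_null] by simp

lemma null_uminus: "u \<in> null \<Longrightarrow> - u \<in> null"
  using subgroup.m_inv_closed[OF subgroup_null] null_subset by simp

lemma relator_in_null: "u \<in> tensor_relators A M ra N la \<Longrightarrow> u \<in> null"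
  unfolding tensor_null_def by (rule generate.incl)

lemma teq_refl: "u \<simeq> u" by (simp add: teq_def null_zero)

lemma teq_sym: "u \<simeq> v \<Longrightarrow> v \<simeq> u"
  unfolding teq_def using null_uminus by fastforce

lemma teq_trans [trans]: "\<lbrakk>u \<simeq> v; v \<simeq> w\<rbrakk> \<Longrightarrow> u \<simeq> w"
  unfolding teq_def using null_add by fastforce

lemma teq_add: "\<lbrakk>u \<simeq> u'; v \<simeq> v'\<rbrakk> \<Longrightarrow> u + v \<simeq> u' + v'"
  unfolding teq_def using null_add[of "u - u'" "v - v'"] by (simp add: algebra_simps)

lemma teq_diff: "\<lbrakk>u \<simeq> u'; v \<simeq> v'\<rbrakk> \<Longrightarrow> u - v \<simeq> u' - v'"
  unfolding teq_def using null_add[of "u - u'" "- (v - v')"] null_uminus[of "v - v'"] by (simp add: algebra_simps)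

lemma teq_sum: "(\<And>i. i \<in> I \<Longrightarrow> u i \<simeq> v i) \<Longrightarrow> sum u I \<simeq> sum v I"
  by (induction I rule: infinite_finite_induct) (auto simp: teq_refl teq_add)

lemma frag_add_left: "\<lbrakk>m \<in> M; m' \<in> M; n \<in> N\<rbrakk> \<Longrightarrow> frag_of (m + m', n) \<simeq> frag_of (m, n) + frag_of (m', n)"
  unfolding teq_def by (rule relator_in_null) (auto simp: tensor_relators_def algebra_simps)

lemma frag_add_right: "\<lbrakk>m \<in> M; n \<in> N; n' \<in> N\<rbrakk> \<Longrightarrow> frag_of (m, n + n') \<simeq> frag_of (m, n) + frag_of (m, n')"
  unfolding teq_def by (rule relator_in_null) (auto simp: tensor_relators_def algebra_simps)

lemma frag_balanced: "\<lbrakk>m \<in> M; r \<in> A; n \<in> N\<rbrakk> \<Longrightarrow> frag_of (ra m r, n) \<simeq> frag_of (m, la r n)"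
  unfolding teq_def by (rule relator_in_null) (auto simp: tensor_relators_def)

lemma frag_zero_left: "n \<in> N \<Longrightarrow> frag_of (0, n) \<simeq> 0"
  using teq_sym[OF frag_add_left[OF M_zero M_zero]] by (simp add: teq_def)

lemma frag_zero_right: "m \<in> M \<Longrightarrow> frag_of (m, 0) \<simeq> 0"
  using teq_sym[OF frag_add_right[OF _ N_zero N_zero]] by (simp add: teq_def)

lemma teq_zero_iff: "u \<simeq> 0 \<longleftrightarrow> u \<in> null"
  by (simp add: teq_def)

lemma null_normal: "null \<lhd> F"
  by (rule comm_group.subgroup_imp_normal[OF abelian_free_Abelian_group subgroup_null])

lemma group_tensor_product: "group (tensor_product A M ra N la)"
  unfolding tensor_product_def by (rule normal.factorgroup_is_group[OF null_normal])

lemma one_tensor_product: "\<one>\<^bsub>tensor_product A M ra N la\<^esub> = null"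
  by (simp add: tensor_product_def FactGroup_def)

lemma carrier_tensor_product: "carrier (tensor_product A M ra N la) = (\<lambda>u. null #>\<^bsub>F\<^esub> u) ` carrier F"
  by (auto simp: tensor_product_def FactGroup_def RCOSETS_def)

lemma null_coset_eq: "u \<in> null \<Longrightarrow> null #>\<^bsub>F\<^esub> u = null"
  by (rule group.coset_join2[OF group_free_Abelian_group _ subgroup_null]) (use null_subset in auto)

end

subsection \<open>The triangular decomposition\<close>

lemma comm_group_Hom_group:
  assumes "linear_category G" "x \<in> Obj G" "z \<in> Obj G"
  shows "comm_group (Hom_group G x z)"
proof -
  interpret linear_category G by fact
  interpret vector_space "Scale G" by (rule vector_space_Scale)
  have sub: "subspace (Hom G x z)" by (rule subspace_Hom) fact+
  show ?thesis
  proof (rule comm_groupI)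
    show "\<exists>g\<in>carrier (Hom_group G x z). g \<otimes>\<^bsub>Hom_group G x z\<^esub> f = \<one>\<^bsub>Hom_group G x z\<^esub>"
      if "f \<in> carrier (Hom_group G x z)" for f
      using that subspace_neg[OF sub] by (intro bexI[of _ "- f"]) (auto simp: Hom_group_def)
  qed (use subspace_add[OF sub] subspace_0[OF sub] in \<open>auto simp: Hom_group_def add_ac\<close>)
qed

lemma Hom_group_simps [simp]:
  "carrier (Hom_group G x z) = Hom G x z" "monoid.mult (Hom_group G x z) = (+)" "one (Hom_group G x z) = 0"
  by (simp_all add: Hom_group_def)

section \<open>A single summand of (T3): tensors over one middle set\<close>

context
  fixes \<delta> :: complex and S Y T :: "'a set"
  assumes fin: "finite S" "finite Y" "finite T"
begin

text \<open>The possible terms of the composites coming from the summand of \<open>Y\<close>. Middle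
  sets of different sizes have disjoint such sets, and this is how the summands are kept
  apart.\<close>

definition through :: "'a diagram set" where
  "through = {diagram_comp \<beta> \<gamma> | \<beta> \<gamma>. upwards_diagram Y T \<beta> \<and> downwards_diagram S Y \<gamma>}"

lemma finite_through: "finite through"
proof (rule finite_subset)
  show "through \<subseteq> partition_diagrams S T"
    unfolding through_def upwards_diagram_def downwards_diagram_def
    by (auto intro: diagram_comp_in_partition_diagrams)
qed (rule finite_partition_diagrams[OF fin(1,3)])

lemma partition_comp_up_down:
  assumes "upwards_diagram Y T \<beta>" "downwards_diagram S Y \<gamma>"
  shows "partition_comp \<delta> S Y T (Poly_Mapping.single \<beta> b) (Poly_Mapping.single \<gamma> c)
    = Poly_Mapping.single (diagram_comp \<beta> \<gamma>) (b * c)"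
proof -
  have "\<gamma> \<in> partition_diagrams S Y" using assms(2) by (simp add: downwards_diagram_def)
  then show ?thesis using middle_count_upwards[OF fin(2) _ assms(1)] by simp
qed

lemma partition_comp_up_down_closed:
  assumes "g \<in> upwards_Hom \<delta> Y T" "f \<in> downwards_Hom \<delta> S Y"
  shows "Poly_Mapping.keys (partition_comp \<delta> S Y T g f) \<subseteq> through"
  using assms unfolding upwards_Hom_eq downwards_Hom_eq mem_Collect_eq
  by (rule partition_comp_closed) (auto simp: through_def)

interpretation up: wide_subcategory "partition_category \<delta> :: (_, 'a set, _) lincat" "upwards_Hom \<delta>"
  by (rule wide_subcategory_upwards)

interpretation down: wide_subcategory "partition_category \<delta> :: (_, 'a set, _) lincat" "downwards_Hom \<delta>"
  by (rule wide_subcategory_downwards)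

lemma up_down_End: "upwards_Hom \<delta> Y Y = downwards_Hom \<delta> Y Y"
  by (simp add: upwards_Hom_eq downwards_Hom_eq upwards_iff_downwards[OF fin(2)])

lemma tensor_data_through:
  "tensor_data (upwards_Hom \<delta> Y Y) (upwards_Hom \<delta> Y T) (partition_comp \<delta> Y Y T)
     (downwards_Hom \<delta> S Y) (partition_comp \<delta> S Y Y)"
  by standard
    (use fin up.sub_zero up.sub_add down.sub_zero down.sub_add up.sub_Comp[of Y Y T] down.sub_Comp[of S Y Y]
      up_down_End in auto)

interpretation td: tensor_data "upwards_Hom \<delta> Y Y" "upwards_Hom \<delta> Y T" "partition_comp \<delta> Y Y T"
  "downwards_Hom \<delta> S Y" "partition_comp \<delta> S Y Y"
  by (rule tensor_data_through)

notation td.teq (infix "\<simeq>" 50)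

lemma single_up_iff: "Poly_Mapping.single \<beta> b \<in> upwards_Hom \<delta> Y' T' \<longleftrightarrow> b = 0 \<or> upwards_diagram Y' T' \<beta>"
  by (auto simp: upwards_Hom_eq)

lemma single_down_iff: "Poly_Mapping.single \<beta> b \<in> downwards_Hom \<delta> Y' T' \<longleftrightarrow> b = 0 \<or> downwards_diagram Y' T' \<beta>"
  by (auto simp: downwards_Hom_eq)

text \<open>Two elements of the endomorphism ring are moved across the tensor: the scalar
  \<open>c\<close>, as a multiple of the identity, and the permutation that relates the two
  factorisations. Together they replace any factorisation by a chosen one and gather the
  coefficients on the left.\<close>

lemma frag_single_change:
  assumes up: "upwards_diagram Y T \<beta>" "upwards_diagram Y T \<beta>'"
    and down: "downwards_diagram S Y \<gamma>" "downwards_diagram S Y \<gamma>'"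
    and eq: "diagram_comp \<beta> \<gamma> = diagram_comp \<beta>' \<gamma>'"
  shows "frag_of (Poly_Mapping.single \<beta> b, Poly_Mapping.single \<gamma> c)
    \<simeq> frag_of (Poly_Mapping.single \<beta>' (b * c), Poly_Mapping.single \<gamma>' 1)"
proof -
  obtain \<sigma> where \<sigma>: "upwards_diagram Y Y \<sigma>" "diagram_comp \<sigma> \<gamma> = \<gamma>'" "diagram_comp \<beta>' \<sigma> = \<beta>"
    using factorisation_unique[OF down(1) up(1) down(2) up(2) eq fin(2,2)] by blast
  have \<gamma>: "\<gamma> \<in> partition_diagrams S Y" and \<beta>: "\<beta> \<in> partition_diagrams Y T" and \<sigma>pd: "\<sigma> \<in> partition_diagrams Y Y"
    using up down \<sigma> by (auto simp: upwards_diagram_def downwards_diagram_def)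
  have id: "upwards_diagram Y Y (id_diagram Y)" by (rule id_diagram_upwards[OF fin(2)])
  \<comment> \<open>The tensor relations mention no scalars, so \<open>c\<close> has to be written
    as a ring element acting on \<gamma>.\<close>
  have 1: "Poly_Mapping.single \<gamma> c
      = partition_comp \<delta> S Y Y (Poly_Mapping.single (id_diagram Y) c) (Poly_Mapping.single \<gamma> 1)"
    using diagram_comp_id_left[OF \<gamma> fin(1,2)] middle_count_id_left[OF \<gamma> fin(1,2)] by simp
  have 2: "partition_comp \<delta> Y Y T (Poly_Mapping.single \<beta> b) (Poly_Mapping.single (id_diagram Y) c)
      = Poly_Mapping.single \<beta> (b * c)"
    using diagram_comp_id_right[OF \<beta> fin(2,3)] middle_count_id_right[OF \<beta> fin(2,3)] by simp
  have 3: "partition_comp \<delta> Y Y T (Poly_Mapping.single \<beta>' (b * c)) (Poly_Mapping.single \<sigma> 1)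
      = Poly_Mapping.single \<beta> (b * c)"
    using \<sigma> middle_count_upwards[OF fin(2) \<sigma>pd up(2)] by simp
  have 4: "partition_comp \<delta> S Y Y (Poly_Mapping.single \<sigma> 1) (Poly_Mapping.single \<gamma> 1)
      = Poly_Mapping.single \<gamma>' 1"
    using \<sigma> middle_count_upwards[OF fin(2) \<gamma> \<sigma>(1)] by simp
  have "frag_of (Poly_Mapping.single \<beta> (b * c), Poly_Mapping.single \<gamma> 1)
    \<simeq> frag_of (Poly_Mapping.single \<beta> b, Poly_Mapping.single \<gamma> c)"
    unfolding 1 2[symmetric]
    by (rule td.frag_balanced) (simp_all add: single_up_iff single_down_iff up down id)
  moreover have "frag_of (Poly_Mapping.single \<beta> (b * c), Poly_Mapping.single \<gamma> 1)
    \<simeq> frag_of (Poly_Mapping.single \<beta>' (b * c), Poly_Mapping.single \<gamma>' 1)"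
    unfolding 3[symmetric] 4[symmetric]
    by (rule td.frag_balanced) (simp_all add: single_up_iff single_down_iff up down \<sigma>)
  ultimately show ?thesis using td.teq_sym td.teq_trans by blast
qed

text \<open>A normal form for tensors: with a factorisation chosen for every diagram through \<open>Y\<close>, a tensor
  is determined by its composite.\<close>

lemma tensor_eval:
  "\<exists>h \<in> hom td.F (Hom_group (partition_category \<delta>) S T).
    (\<forall>g \<in> upwards_Hom \<delta> Y T. \<forall>f \<in> downwards_Hom \<delta> S Y. h (frag_of (g, f)) = partition_comp \<delta> S Y T g f) \<and>
    (\<forall>u. Poly_Mapping.keys u \<subseteq> upwards_Hom \<delta> Y T \<times> downwards_Hom \<delta> S Y \<longrightarrow>
      Poly_Mapping.keys (h u) \<subseteq> through \<and> (h u = 0 \<longleftrightarrow> u \<in> td.null))"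
proof -
  let ?H = "Hom_group (partition_category \<delta>) S T"
  let ?M = "upwards_Hom \<delta> Y T" and ?N = "downwards_Hom \<delta> S Y" and ?k = "partition_comp \<delta> S Y T"
  have ST: "S \<in> Obj (partition_category \<delta>)" "T \<in> Obj (partition_category \<delta>)"
    "Y \<in> Obj (partition_category \<delta>)" using fin by auto
  interpret H: comm_group ?H
    by (rule comm_group_Hom_group[OF linear_category_partition_category ST(1,2)])
  have upD: "g \<in> Hom (partition_category \<delta>) Y T" if "g \<in> ?M" for g using up.sub_Hom[OF ST(3,2) that] .
  have downD: "f \<in> Hom (partition_category \<delta>) S Y" if "f \<in> ?N" for f using down.sub_Hom[OF ST(1,3) that] .
  have EndD: "r \<in> Hom (partition_category \<delta>) Y Y" if "r \<in> upwards_Hom \<delta> Y Y" for r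
    using up.sub_Hom[OF ST(3,3) that] .
  have "(\<lambda>(g, f). ?k g f) ` (?M \<times> ?N) \<subseteq> carrier ?H"
    using up.Comp_closed[OF ST(1,3,2) downD upD] by auto
  then obtain h where h: "h \<in> hom td.F ?H"
    and h_frag': "\<And>p. p \<in> ?M \<times> ?N \<Longrightarrow> h (frag_of p) = (case p of (g, f) \<Rightarrow> ?k g f)"
    using H.free_Abelian_group_universal[of "\<lambda>(g, f). ?k g f" "?M \<times> ?N"] by blast
  have h_frag: "h (frag_of (g, f)) = ?k g f" if "g \<in> ?M" "f \<in> ?N" for g f using h_frag'[of "(g, f)"] that by simp
  have h_add: "h (u + v) = h u + h v" if "Poly_Mapping.keys u \<subseteq> ?M \<times> ?N" "Poly_Mapping.keys v \<subseteq> ?M \<times> ?N" for u v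
    using hom_mult[OF h, of u v] that by simp
  have h_diff: "h (u - v) = h u - h v" if "Poly_Mapping.keys u \<subseteq> ?M \<times> ?N" "Poly_Mapping.keys v \<subseteq> ?M \<times> ?N" for u v
    using h_add[OF td.keys_diff_subset[OF that] that(2)] by (simp add: algebra_simps)
  have h0: "h 0 = 0" using h_diff[of 0 0] by simp
  \<comment> \<open>The relations are mapped to 0 by bilinearity and associativity of composition,
    and the kernel contains the subgroup that they generate.\<close>
  have h_null: "h u = 0" if "u \<in> td.null" for u
  proof -
    have ker: "h u = 0" if u: "u \<in> tensor_relators (upwards_Hom \<delta> Y Y) ?M (partition_comp \<delta> Y Y T) ?N (partition_comp \<delta> S Y Y)" for u
    proof -
      consider m m' n where "u = frag_of (m + m', n) - frag_of (m, n) - frag_of (m', n)" "m \<in> ?M" "m' \<in> ?M" "n \<in> ?N"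
        | m n n' where "u = frag_of (m, n + n') - frag_of (m, n) - frag_of (m, n')" "m \<in> ?M" "n \<in> ?N" "n' \<in> ?N"
        | m r n where "u = frag_of (partition_comp \<delta> Y Y T m r, n) - frag_of (m, partition_comp \<delta> S Y Y r n)"
          "m \<in> ?M" "r \<in> upwards_Hom \<delta> Y Y" "n \<in> ?N"
        using u unfolding tensor_relators_def by blast
      then show ?thesis
      proof cases
        case 1
        then have "h u = h (frag_of (m + m', n)) - h (frag_of (m, n)) - h (frag_of (m', n))"
          using td.M_add by (simp add: h_diff td.keys_diff_subset)
        then show ?thesis using 1 td.M_add by (simp add: h_frag partition_comp_add_left)
      next
        case 2
        then have "h u = h (frag_of (m, n + n')) - h (frag_of (m, n)) - h (frag_of (m, n'))"
          using td.N_add by (simp add: h_diff td.keys_diff_subset)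
        then show ?thesis using 2 td.N_add by (simp add: h_frag partition_comp_add_right)
      next
        case 3
        then have "h u = h (frag_of (partition_comp \<delta> Y Y T m r, n)) - h (frag_of (m, partition_comp \<delta> S Y Y r n))"
          using td.ra_closed td.la_closed by (simp add: h_diff)
        also have "\<dots> = 0" using up.Comp_assoc[OF ST(1,3,3,2) downD EndD upD, of n r m] 3 td.ra_closed td.la_closed
          by (simp add: h_frag)
        finally show ?thesis .
      qed
    qed
    show ?thesis using that unfolding tensor_null_def
    proof (induction rule: generate.induct)
      case (inv u)
      then have "Poly_Mapping.keys u \<subseteq> ?M \<times> ?N" 
        using subsetD[OF td.relators_subset] by (simp only: carrier_free_Abelian_group_iff)
      then show ?case using h_diff[of 0 u] ker[OF inv] h0 by simp
    next
      case (eng u v)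
      have "u \<in> td.null" "v \<in> td.null" using eng(1,2) unfolding tensor_null_def .
      then show ?case using eng h_add td.null_subset by simp
    qed (use ker h0 in auto)
  qed
  have h_through: "Poly_Mapping.keys (h u) \<subseteq> through" if "Poly_Mapping.keys u \<subseteq> ?M \<times> ?N" for u
    using that
  proof (induction rule: free_Abelian_group_induct[consumes 1, case_names zero diff frag])
    case (diff u v)
    then show ?case by (simp add: h_diff td.keys_diff_subset)
  next
    case (frag p)
    then show ?case using partition_comp_up_down_closed by (auto simp: h_frag')
  qed (simp add: h0)
  have "\<forall>\<alpha>\<in>through. \<exists>\<beta> \<gamma>. upwards_diagram Y T \<beta> \<and> downwards_diagram S Y \<gamma> \<and> diagram_comp \<beta> \<gamma> = \<alpha>"
    by (auto simp: through_def)
  then obtain b c where bc: "\<And>\<alpha>. \<alpha> \<in> through \<Longrightarrow> upwards_diagram Y T (b \<alpha>)"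
    "\<And>\<alpha>. \<alpha> \<in> through \<Longrightarrow> downwards_diagram S Y (c \<alpha>)" "\<And>\<alpha>. \<alpha> \<in> through \<Longrightarrow> diagram_comp (b \<alpha>) (c \<alpha>) = \<alpha>"
    by metis
  \<comment> \<open>A candidate inverse of evaluation: each diagram is written through its chosen
    factorisation, with the coefficient in the left factor. It is additive only up to the tensor
    relations.\<close>
  define E where "E w = (\<Sum>\<alpha>\<in>through. frag_of (Poly_Mapping.single (b \<alpha>) (Poly_Mapping.lookup w \<alpha>),
      Poly_Mapping.single (c \<alpha>) (1 :: complex)))" for w :: "'a diagram \<Rightarrow>\<^sub>0 complex"
  have bM: "Poly_Mapping.single (b \<alpha>) a \<in> ?M" and cN: "Poly_Mapping.single (c \<alpha>) a \<in> ?N" if "\<alpha> \<in> through" for \<alpha> a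
    using bc that by (simp_all add: single_up_iff single_down_iff)
  \<comment> \<open>Not an equality: the terms are generators with left entry 0, which are null but
    not zero in the free group.\<close>
  have E0: "E 0 \<simeq> 0"
  proof -
    have "E 0 \<simeq> (\<Sum>\<alpha>\<in>through. 0)" unfolding E_def
      by (rule td.teq_sum) (simp add: td.frag_zero_left cN)
    then show ?thesis by simp
  qed
  have E_add: "E (v + w) \<simeq> E v + E w" for v w
    unfolding E_def sum.distrib[symmetric] lookup_add single_add
    by (intro td.teq_sum td.frag_add_left bM cN)
  have E_diff: "E (v - w) \<simeq> E v - E w" for v w
  proof -
    have "E v \<simeq> E (v - w) + E w" using E_add[of "v - w" w] by simp
    then have "E v - E w \<simeq> (E (v - w) + E w) - E w" by (rule td.teq_diff[OF _ td.teq_refl])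
    then show ?thesis by (simp add: td.teq_sym)
  qed
  have frag_E: "frag_of (g, f) \<simeq> E (?k g f)" if g: "g \<in> ?M" and f: "f \<in> ?N" for g f
  proof -
    have gK: "Poly_Mapping.keys g \<subseteq> {\<beta>. upwards_diagram Y T \<beta>}" using g by (simp add: upwards_Hom_eq)
    have fK: "Poly_Mapping.keys f \<subseteq> {\<gamma>. downwards_diagram S Y \<gamma>}" using f by (simp add: downwards_Hom_eq)
    show ?thesis using gK
    proof (induction rule: keys_subset_induct)
      case zero
      show ?case using td.teq_trans[OF td.frag_zero_left[OF f] td.teq_sym[OF E0]] by simp
    next
      case (add g g')
      then have "g \<in> ?M" "g' \<in> ?M" by (simp_all add: upwards_Hom_eq)
      then have "frag_of (g + g', f) \<simeq> frag_of (g, f) + frag_of (g', f)" using f by (intro td.frag_add_left)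
      also have "\<dots> \<simeq> E (?k g f) + E (?k g' f)" by (intro td.teq_add add)
      also have "\<dots> \<simeq> E (?k (g + g') f)" unfolding partition_comp_add_left by (rule td.teq_sym[OF E_add])
      finally show ?case .
    next
      case (single \<beta> a)
      then have \<beta>: "upwards_diagram Y T \<beta>" by simp
      have \<beta>M: "Poly_Mapping.single \<beta> a \<in> ?M" using \<beta> by (simp add: single_up_iff)
      show ?case using fK
      proof (induction rule: keys_subset_induct)
        case zero
        show ?case using td.teq_trans[OF td.frag_zero_right[OF \<beta>M] td.teq_sym[OF E0]] by simp
      next
        case (add f f')
        then have "f \<in> ?N" "f' \<in> ?N" by (simp_all add: downwards_Hom_eq)
        then have "frag_of (Poly_Mapping.single \<beta> a, f + f')
            \<simeq> frag_of (Poly_Mapping.single \<beta> a, f) + frag_of (Poly_Mapping.single \<beta> a, f')"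
          using \<beta>M by (intro td.frag_add_right)
        also have "\<dots> \<simeq> E (?k (Poly_Mapping.single \<beta> a) f) + E (?k (Poly_Mapping.single \<beta> a) f')"
          by (intro td.teq_add add)
        also have "\<dots> \<simeq> E (?k (Poly_Mapping.single \<beta> a) (f + f'))"
          unfolding partition_comp_add_right by (rule td.teq_sym[OF E_add])
        finally show ?case .
      next
        case (single \<gamma> d)
        then have \<gamma>: "downwards_diagram S Y \<gamma>" by simp
        let ?\<alpha> = "diagram_comp \<beta> \<gamma>"
        let ?t = "frag_of (Poly_Mapping.single (b ?\<alpha>) (a * d), Poly_Mapping.single (c ?\<alpha>) (1 :: complex))"
        have \<alpha>: "?\<alpha> \<in> through" using \<beta> \<gamma> by (auto simp: through_def)
        have "frag_of (Poly_Mapping.single \<beta> a, Poly_Mapping.single \<gamma> d) \<simeq> ?t"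
          by (rule frag_single_change) (simp_all add: \<beta> \<gamma> bc[OF \<alpha>])
        also have "?t \<simeq> E (Poly_Mapping.single ?\<alpha> (a * d))"
        proof -
          \<comment> \<open>Only the term at the composite diagram survives; all others have left
            entry 0 and are therefore null.\<close>
          have "E (Poly_Mapping.single ?\<alpha> (a * d)) \<simeq> (\<Sum>\<alpha>\<in>through. if \<alpha> = ?\<alpha> then ?t else 0)"
            unfolding E_def
            by (rule td.teq_sum) (auto simp: lookup_single td.teq_refl td.frag_zero_left cN)
          also have "(\<Sum>\<alpha>\<in>through. if \<alpha> = ?\<alpha> then ?t else 0) = ?t"
            using \<alpha> finite_through by simp
          finally show ?thesis by (rule td.teq_sym)
        qed
        also have "Poly_Mapping.single ?\<alpha> (a * d) = ?k (Poly_Mapping.single \<beta> a) (Poly_Mapping.single \<gamma> d)"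
          by (rule partition_comp_up_down[OF \<beta> \<gamma>, symmetric])
        finally show ?case .
      qed
    qed
  qed
  \<comment> \<open>Hence evaluation has no kernel beyond the relations: if \<open>h u\<close> is 0,
    then \<open>u\<close> is congruent to \<open>E 0\<close>, which is null.\<close>
  have normal_form: "u \<simeq> E (h u)" if "Poly_Mapping.keys u \<subseteq> ?M \<times> ?N" for u
    using that
  proof (induction rule: free_Abelian_group_induct[consumes 1, case_names zero diff frag])
    case zero
    show ?case unfolding h0 by (rule td.teq_sym[OF E0])
  next
    case (diff u v)
    then have "u - v \<simeq> E (h u) - E (h v)" by (intro td.teq_diff)
    also have "\<dots> \<simeq> E (h (u - v))" unfolding h_diff[OF diff(1,2)] by (rule td.teq_sym[OF E_diff])
    finally show ?case .
  next
    case (frag p)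
    then show ?case using frag_E h_frag by (cases p) auto
  qed
  have "h u = 0 \<longleftrightarrow> u \<in> td.null" if "Poly_Mapping.keys u \<subseteq> ?M \<times> ?N" for u
  proof
    assume "h u = 0"
    then have "u \<simeq> 0" using td.teq_trans[OF normal_form[OF that]] E0 by simp
    then show "u \<in> td.null" by (simp add: td.teq_zero_iff)
  qed (rule h_null)
  then show ?thesis using h h_frag h_through by (intro bexI[of _ h]) simp_all
qed

text \<open>Evaluation kills the relations and so descends to the quotient; as it kills nothing
  else, the descended map has trivial kernel.\<close>

lemma tensor_hom:
  fixes G U D
  defines "G \<equiv> partition_category \<delta>" and "U \<equiv> upwards_Hom \<delta>" and "D \<equiv> downwards_Hom \<delta>"
  obtains \<phi> where "\<phi> \<in> hom (triangular_tensor G U D S T Y) (Hom_group G S T)"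
    "\<And>g f. \<lbrakk>g \<in> U Y T; f \<in> D S Y\<rbrakk> \<Longrightarrow> \<phi> (triangular_pure G U D S T Y g f) = partition_comp \<delta> S Y T g f"
    "\<And>X. X \<in> carrier (triangular_tensor G U D S T Y) \<Longrightarrow> Poly_Mapping.keys (\<phi> X) \<subseteq> through"
    "\<And>X. X \<in> carrier (triangular_tensor G U D S T Y) \<Longrightarrow> \<phi> X = 0
      \<Longrightarrow> X = \<one>\<^bsub>triangular_tensor G U D S T Y\<^esub>"
proof -
  let ?H = "Hom_group (partition_category \<delta>) S T" and ?T = "triangular_tensor G U D S T Y"
  let ?MN = "upwards_Hom \<delta> Y T \<times> downwards_Hom \<delta> S Y"
  obtain h where h: "h \<in> hom td.F ?H"
    "\<And>g f. \<lbrakk>g \<in> upwards_Hom \<delta> Y T; f \<in> downwards_Hom \<delta> S Y\<rbrakk> \<Longrightarrow> h (frag_of (g, f)) = partition_comp \<delta> S Y T g f"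
    "\<And>u. Poly_Mapping.keys u \<subseteq> ?MN \<Longrightarrow> Poly_Mapping.keys (h u) \<subseteq> through"
    "\<And>u. Poly_Mapping.keys u \<subseteq> ?MN \<Longrightarrow> h u = 0 \<longleftrightarrow> u \<in> td.null"
    using tensor_eval by blast
  have H: "group ?H"
    using comm_group_Hom_group[OF linear_category_partition_category, where x = S and z = T] fin by (simp add: comm_group_def)
  interpret h: group_hom td.F ?H h
    by (rule group_hom.intro[OF group_free_Abelian_group H]) (simp add: group_hom_axioms_def h(1))
  have ker: "td.null \<subseteq> kernel td.F ?H h" using h(4) td.null_subset by (auto simp: kernel_def)
  obtain \<phi> where \<phi>: "\<phi> \<in> hom (td.F Mod td.null) ?H"
    "\<And>u. u \<in> carrier td.F \<Longrightarrow> \<phi> (td.null #>\<^bsub>td.F\<^esub> u) = h u"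
    using h.FactGroup_universal_kernel[OF td.null_normal ker] by blast
  have T: "?T = tensor_product (upwards_Hom \<delta> Y Y) (upwards_Hom \<delta> Y T) (partition_comp \<delta> Y Y T)
      (downwards_Hom \<delta> S Y) (partition_comp \<delta> S Y Y)"
    by (simp add: triangular_tensor_def G_def U_def D_def)
  show thesis
  proof (rule that)
    show "\<phi> \<in> hom ?T (Hom_group G S T)" unfolding T using \<phi>(1) by (simp add: tensor_product_def G_def)
    show "\<phi> (triangular_pure G U D S T Y g f) = partition_comp \<delta> S Y T g f" if "g \<in> U Y T" "f \<in> D S Y" for g f
      using \<phi>(2)[of "frag_of (g, f)"] h(2)[of g f] that
      by (simp add: triangular_pure_def pure_tensor_def G_def U_def D_def)
    fix X assume "X \<in> carrier ?T"
    then obtain u where u: "Poly_Mapping.keys u \<subseteq> ?MN" "X = td.null #>\<^bsub>td.F\<^esub> u"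
      unfolding T td.carrier_tensor_product by auto
    then have \<phi>X: "\<phi> X = h u" using \<phi>(2) by simp
    show "Poly_Mapping.keys (\<phi> X) \<subseteq> through" unfolding \<phi>X by (rule h(3)[OF u(1)])
    assume "\<phi> X = 0"
    then have "u \<in> td.null" using h(4)[OF u(1)] \<phi>X by simp
    then show "X = \<one>\<^bsub>?T\<^esub>" unfolding T td.one_tensor_product u(2) by (rule td.null_coset_eq)
  qed
qed

lemma group_triangular_tensor:
  "group (triangular_tensor (partition_category \<delta>) (upwards_Hom \<delta>) (downwards_Hom \<delta>) S T Y)"
  using td.group_tensor_product by (simp add: triangular_tensor_def)

lemma triangular_pure_closed:
  assumes "g \<in> upwards_Hom \<delta> Y T" "f \<in> downwards_Hom \<delta> S Y"
  shows "triangular_pure (partition_category \<delta>) (upwards_Hom \<delta>) (downwards_Hom \<delta>) S T Y g f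
    \<in> carrier (triangular_tensor (partition_category \<delta>) (upwards_Hom \<delta>) (downwards_Hom \<delta>) S T Y)"
  using assms by (simp add: triangular_tensor_def triangular_pure_def pure_tensor_def td.carrier_tensor_product)

text \<open>Comparing the two factorisations in both orders gives upwards diagrams between the
  middle sets in both directions, and upwards diagrams do not decrease size.\<close>

lemma through_rank:
  assumes "finite Y'" "upwards_diagram Y' T \<beta>'" "downwards_diagram S Y' \<gamma>'" "diagram_comp \<beta>' \<gamma>' \<in> through"
  shows "card Y' = card Y"
proof -
  obtain \<beta> \<gamma> where *: "upwards_diagram Y T \<beta>" "downwards_diagram S Y \<gamma>" "diagram_comp \<beta>' \<gamma>' = diagram_comp \<beta> \<gamma>"
    using assms(4) by (auto simp: through_def)
  obtain \<sigma> \<tau> where "upwards_diagram Y Y' \<sigma>" "upwards_diagram Y' Y \<tau>"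
    using factorisation_unique[OF *(2,1) assms(3,2) *(3)[symmetric] fin(2) assms(1)]
      factorisation_unique[OF assms(3,2) *(2,1) *(3) assms(1) fin(2)] by blast
  then show ?thesis using upwards_card_le fin(2) assms(1) by (metis order_antisym)
qed

end

section \<open>Assembling the direct sum over all middle sets\<close>

lemma finprod_Hom_group:
  assumes "linear_category G" "x \<in> Obj G" "z \<in> Obj G" "finite A" "f \<in> A \<rightarrow> Hom G x z"
  shows "finprod (Hom_group G x z) f A = sum f A"
proof -
  interpret comm_group "Hom_group G x z" by (rule comm_group_Hom_group) fact+
  from assms(4,5) show ?thesis by (induction A rule: finite_induct) auto
qed

text \<open>Each summand embeds into the span of the diagrams through its middle set. For distinct
  representatives these diagrams are disjoint, which gives injectivity; every diagram occurs for
  some representative, which gives surjectivity.\<close>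

lemma triangular_decomposition:
  fixes \<delta> :: complex and G :: "(complex, 'a::infinite set, 'a diagram \<Rightarrow>\<^sub>0 complex) lincat" and U D
  defines "G \<equiv> partition_category \<delta>" and "U \<equiv> upwards_Hom \<delta>" and "D \<equiv> downwards_Hom \<delta>"
  assumes R: "iso_representatives G R" and S: "finite S" and T: "finite T"
  shows "\<exists>\<phi> \<in> iso (sum_group R (triangular_tensor G U D S T)) (Hom_group G S T).
    \<forall>Y \<in> R. \<forall>g \<in> U Y T. \<forall>f \<in> D S Y.
      \<phi> (\<lambda>W \<in> R. if W = Y then triangular_pure G U D S T Y g f
                 else \<one>\<^bsub>triangular_tensor G U D S T W\<^esub>) = Comp G S Y T g f"
proof -
  let ?H = "Hom_group G S T" and ?t = "triangular_tensor G U D S T" and ?p = "triangular_pure G U D S T"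
  let ?S = "sum_group R ?t"
  note defs = G_def U_def D_def
  have finR: "finite Y" if "Y \<in> R" for Y using R that by (auto simp: iso_representatives_def G_def)
  have R_eq: "Y = Y'" if "Y \<in> R" "Y' \<in> R" "card Y = card Y'" for Y Y'
  proof -
    have "isomorphic_in G Y Y'" "isomorphic_in G Y Y"
      unfolding G_def
      using that(3) isomorphic_iff_card_eq[OF finR[OF that(1)] finR[OF that(2)]]
        isomorphic_iff_card_eq[OF finR[OF that(1)] finR[OF that(1)]] by simp_all
    moreover have "Y \<in> Obj G" using finR[OF that(1)] by (simp add: G_def)
    ultimately show ?thesis using R that(1,2) unfolding iso_representatives_def by blast
  qed
  \<comment> \<open>An infinite ground type supplies objects of every size, so every number of
    propagating parts has its representative.\<close>
  have R_ex: "\<exists>Y\<in>R. card Y = n" for n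
  proof -
    obtain X :: "'a set" where X: "finite X" "card X = n" using infinite_arbitrarily_large[OF infinite_UNIV] by blast
    then have "X \<in> Obj G" by (simp add: G_def)
    then obtain Y where "Y \<in> R" "isomorphic_in G X Y" using R unfolding iso_representatives_def by blast
    then show ?thesis using isomorphic_iff_card_eq[OF X(1) finR] X(2) by (auto simp: G_def)
  qed
  have lc: "linear_category G" unfolding G_def by (rule linear_category_partition_category)
  have obj: "S \<in> Obj G" "T \<in> Obj G" using S T by (simp_all add: G_def)
  interpret H: comm_group ?H by (rule comm_group_Hom_group[OF lc obj])
  have grp: "group (?t Y)" if "Y \<in> R" for Y
    unfolding defs by (rule group_triangular_tensor[OF S finR[OF that] T])
  have "\<forall>Y\<in>R. \<exists>\<phi>. \<phi> \<in> hom (?t Y) ?H \<and>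
      (\<forall>g f. g \<in> U Y T \<longrightarrow> f \<in> D S Y \<longrightarrow> \<phi> (?p Y g f) = partition_comp \<delta> S Y T g f) \<and>
      (\<forall>X\<in>carrier (?t Y). Poly_Mapping.keys (\<phi> X) \<subseteq> through S Y T \<and> (\<phi> X = 0 \<longrightarrow> X = \<one>\<^bsub>?t Y\<^esub>))"
  proof
    fix Y assume "Y \<in> R"
    from tensor_hom[OF S finR[OF this] T, of \<delta>] show "\<exists>\<phi>. \<phi> \<in> hom (?t Y) ?H \<and>
      (\<forall>g f. g \<in> U Y T \<longrightarrow> f \<in> D S Y \<longrightarrow> \<phi> (?p Y g f) = partition_comp \<delta> S Y T g f) \<and>
      (\<forall>X\<in>carrier (?t Y). Poly_Mapping.keys (\<phi> X) \<subseteq> through S Y T \<and> (\<phi> X = 0 \<longrightarrow> X = \<one>\<^bsub>?t Y\<^esub>))"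
      unfolding defs by metis
  qed
  from bchoice[OF this] obtain F where F: "\<forall>Y\<in>R. F Y \<in> hom (?t Y) ?H \<and>
      (\<forall>g f. g \<in> U Y T \<longrightarrow> f \<in> D S Y \<longrightarrow> F Y (?p Y g f) = partition_comp \<delta> S Y T g f) \<and>
      (\<forall>X\<in>carrier (?t Y). Poly_Mapping.keys (F Y X) \<subseteq> through S Y T \<and> (F Y X = 0 \<longrightarrow> X = \<one>\<^bsub>?t Y\<^esub>))" ..
  have hom: "\<And>Y. Y \<in> R \<Longrightarrow> F Y \<in> hom (?t Y) ?H"
    and F_pure: "\<And>Y g f. \<lbrakk>Y \<in> R; g \<in> U Y T; f \<in> D S Y\<rbrakk> \<Longrightarrow> F Y (?p Y g f) = partition_comp \<delta> S Y T g f"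
    and F_keys: "\<And>Y X. \<lbrakk>Y \<in> R; X \<in> carrier (?t Y)\<rbrakk> \<Longrightarrow> Poly_Mapping.keys (F Y X) \<subseteq> through S Y T"
    and F_inj: "\<And>Y X. \<lbrakk>Y \<in> R; X \<in> carrier (?t Y); F Y X = 0\<rbrakk> \<Longrightarrow> X = \<one>\<^bsub>?t Y\<^esub>"
    using F by simp_all
  have F_one: "F Y \<one>\<^bsub>?t Y\<^esub> = 0" if "Y \<in> R" for Y
    using hom_one[OF hom[OF that] grp[OF that] H.is_group] by simp
  have F_closed: "F Y X \<in> Hom G S T" if "Y \<in> R" "X \<in> carrier (?t Y)" for Y X
    using hom_in_carrier[OF hom[OF that(1)] that(2)] by simp
  \<comment> \<open>An element of the direct sum has only finitely many nontrivial components, so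
    this product, written multiplicatively in the additive Hom group, is a finite sum.\<close>
  define \<phi> where "\<phi> t = gfinprod ?H (\<lambda>Y. F Y (t Y)) R" for t
  have \<phi>: "\<phi> \<in> hom ?S ?H" unfolding \<phi>_def by (rule H.hom_group_sum[OF hom grp])
  have tD: "t Y \<in> carrier (?t Y)" if "t \<in> carrier ?S" "Y \<in> R" for t Y
    using that by (simp add: carrier_sum_group[OF grp] PiE_iff)
  have \<phi>_sum: "finite {Y \<in> R. F Y (t Y) \<noteq> 0} \<and> \<phi> t = (\<Sum>Y\<in>{Y \<in> R. F Y (t Y) \<noteq> 0}. F Y (t Y))"
    if t: "t \<in> carrier ?S" for t
  proof -
    have "finite {Y \<in> R. t Y \<noteq> \<one>\<^bsub>?t Y\<^esub>}" using t by (simp add: carrier_sum_group[OF grp])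
    then have fin: "finite {Y \<in> R. F Y (t Y) \<noteq> 0}" by (rule rev_finite_subset) (auto simp: F_one)
    moreover have "finprod ?H (\<lambda>Y. F Y (t Y)) {Y \<in> R. F Y (t Y) \<noteq> 0} = (\<Sum>Y\<in>{Y \<in> R. F Y (t Y) \<noteq> 0}. F Y (t Y))"
      by (rule finprod_Hom_group[OF lc obj fin]) (use F_closed tD[OF t] in auto)
    ultimately show ?thesis by (simp add: \<phi>_def gfinprod_def)
  qed
  \<comment> \<open>The coefficient at a diagram through \<open>Y\<close> receives nothing from
    other summands: a diagram through both \<open>Y\<close> and \<open>W\<close> would make them
    equal in size, hence equal as representatives.\<close>
  have \<phi>_lookup: "Poly_Mapping.lookup (\<phi> t) \<alpha> = Poly_Mapping.lookup (F Y (t Y)) \<alpha>"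
    if t: "t \<in> carrier ?S" and Y: "Y \<in> R" and \<alpha>: "\<alpha> \<in> through S Y T" for t Y \<alpha>
  proof -
    let ?K = "{Y \<in> R. F Y (t Y) \<noteq> 0}"
    have "Poly_Mapping.lookup (F W (t W)) \<alpha> = 0" if W: "W \<in> R" "W \<noteq> Y" for W
    proof (rule ccontr)
      assume "Poly_Mapping.lookup (F W (t W)) \<alpha> \<noteq> 0"
      then have "\<alpha> \<in> through S W T" using F_keys[OF W(1) tD[OF t W(1)]] by (auto simp: in_keys_iff)
      moreover from \<alpha> obtain \<beta> \<gamma> where "upwards_diagram Y T \<beta>" "downwards_diagram S Y \<gamma>" "\<alpha> = diagram_comp \<beta> \<gamma>"
        unfolding through_def[OF S finR[OF Y] T] by blast
      ultimately have "card Y = card W" using through_rank[OF S finR[OF W(1)] T finR[OF Y]] by blast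
      then show False using R_eq Y W by blast
    qed
    then have "(\<Sum>W\<in>?K. Poly_Mapping.lookup (F W (t W)) \<alpha>)
        = (\<Sum>W\<in>?K. if W = Y then Poly_Mapping.lookup (F Y (t Y)) \<alpha> else 0)"
      by (intro sum.cong) auto
    also have "\<dots> = Poly_Mapping.lookup (F Y (t Y)) \<alpha>"
      using \<phi>_sum[OF t] Y by (auto simp: sum.delta)
    finally show ?thesis using \<phi>_sum[OF t] by (simp add: lookup_sum)
  qed
  let ?d = "\<lambda>Y X. \<lambda>W\<in>R. if W = Y then X else \<one>\<^bsub>?t W\<^esub>"
  have one_closed: "\<one>\<^bsub>?t W\<^esub> \<in> carrier (?t W)" if "W \<in> R" for W
    using group.is_monoid[OF grp[OF that]] by (rule monoid.one_closed)
  have d_closed: "?d Y X \<in> carrier ?S" if "Y \<in> R" "X \<in> carrier (?t Y)" for Y X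
  proof -
    have "finite {W \<in> R. ?d Y X W \<noteq> \<one>\<^bsub>?t W\<^esub>}" by (rule finite_subset[of _ "{Y}"]) auto
    then show ?thesis using that one_closed by (auto simp: carrier_sum_group[OF grp])
  qed
  have \<phi>_d: "\<phi> (?d Y X) = F Y X" if "Y \<in> R" "X \<in> carrier (?t Y)" for Y X
  proof -
    have K: "{W \<in> R. F W (?d Y X W) \<noteq> 0} = (if F Y X = 0 then {} else {Y})"
      using that F_one by auto
    show ?thesis using \<phi>_sum[OF d_closed[OF that]] that unfolding K by (simp split: if_splits)
  qed
  interpret hom: group_hom ?S ?H \<phi>
    by (rule group_hom.intro[OF sum_group[OF grp] H.is_group]) (simp_all add: group_hom_axioms_def \<phi>)
  have "inj_on \<phi> (carrier ?S)"
    unfolding hom.inj_on_one_iff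
  proof (intro allI impI)
    fix t assume t: "t \<in> carrier ?S" and "\<phi> t = \<one>\<^bsub>?H\<^esub>"
    then have 0: "\<phi> t = 0" by simp
    \<comment> \<open>Diagrams through \<open>Y\<close> have coefficient 0 because the total does,
      all others because the summand of \<open>Y\<close> cannot produce them; so each component
      evaluates to 0 and is trivial.\<close>
    have "t Y = \<one>\<^bsub>?t Y\<^esub>" if Y: "Y \<in> R" for Y
    proof (rule F_inj[OF Y tD[OF t Y]], rule poly_mapping_eqI)
      fix \<alpha> show "Poly_Mapping.lookup (F Y (t Y)) \<alpha> = Poly_Mapping.lookup 0 \<alpha>"
      proof (cases "\<alpha> \<in> through S Y T")
        case True
        then show ?thesis using \<phi>_lookup[OF t Y] 0 by simp
      next
        case False
        then show ?thesis using F_keys[OF Y tD[OF t Y]] by (auto simp: in_keys_iff)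
      qed
    qed
    then show "t = \<one>\<^bsub>?S\<^esub>" using t
      by (auto simp: carrier_sum_group[OF grp] PiE_iff extensional_def fun_eq_iff)
  qed
  moreover have "\<phi> ` carrier ?S = carrier ?H"
  proof
    show "\<phi> ` carrier ?S \<subseteq> carrier ?H" using hom_carrier[OF \<phi>] .
    show "carrier ?H \<subseteq> \<phi> ` carrier ?S"
    proof
      fix w assume "w \<in> carrier ?H"
      then have "Poly_Mapping.keys w \<subseteq> partition_diagrams S T" by (simp add: G_def)
      then show "w \<in> \<phi> ` carrier ?S"
      proof (induction rule: keys_subset_induct)
        case zero
        have "\<phi> \<one>\<^bsub>?S\<^esub> = 0" using hom.hom_one by simp
        from this[symmetric] hom.G.one_closed show ?case by (rule image_eqI)
      next
        case (add w w')
        then obtain t t' where t: "t \<in> carrier ?S" "t' \<in> carrier ?S" "w = \<phi> t" "w' = \<phi> t'" by blast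
        then have "w + w' = \<phi> (t \<otimes>\<^bsub>?S\<^esub> t')" using hom_mult[OF \<phi>] by simp
        then show ?case using hom.G.m_closed[OF t(1,2)] by blast
      next
        case (single \<alpha> c)
        \<comment> \<open>The middle set must have one point for each propagating part; a pure
          tensor over it then hits the given multiple of the basis diagram.\<close>
        obtain Y where Y: "Y \<in> R" "card Y = card (propagating \<alpha>)" using R_ex by blast
        obtain \<beta> \<gamma> where \<beta>\<gamma>: "upwards_diagram Y T \<beta>" "downwards_diagram S Y \<gamma>" "diagram_comp \<beta> \<gamma> = \<alpha>"
          using factorisation_exists[OF single finR[OF Y(1)] Y(2) S T] by blast
        let ?g = "Poly_Mapping.single \<beta> c" and ?f = "Poly_Mapping.single \<gamma> (1 :: complex)"
        have gf: "?g \<in> U Y T" "?f \<in> D S Y" using \<beta>\<gamma> by (auto simp: defs upwards_Hom_eq downwards_Hom_eq)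
        have X: "?p Y ?g ?f \<in> carrier (?t Y)"
          using triangular_pure_closed[OF S finR[OF Y(1)] T] gf unfolding defs by blast
        have "\<phi> (?d Y (?p Y ?g ?f)) = Poly_Mapping.single \<alpha> c"
          unfolding \<phi>_d[OF Y(1) X] F_pure[OF Y(1) gf] partition_comp_up_down[OF S finR[OF Y(1)] T \<beta>\<gamma>(1,2)]
          using \<beta>\<gamma>(3) by simp
        from this[symmetric] d_closed[OF Y(1) X] show ?case by (rule image_eqI)
      qed
    qed
  qed
  ultimately have "\<phi> \<in> iso ?S ?H" using \<phi> by (simp add: iso_def bij_betw_def)
  moreover have "\<phi> (?d Y (?p Y g f)) = Comp G S Y T g f" if "Y \<in> R" "g \<in> U Y T" "f \<in> D S Y" for Y g f
  proof -
    have X: "?p Y g f \<in> carrier (?t Y)"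
      using triangular_pure_closed[OF S finR[OF that(1)] T] that(2,3) unfolding defs by blast
    show ?thesis unfolding \<phi>_d[OF that(1) X] F_pure[OF that] by (simp add: G_def)
  qed
  ultimately show ?thesis by blast
qed

theorem proposition6p3:
  fixes \<delta> :: complex
  shows "triangular_category TYPE(nat)
    (partition_category \<delta> :: (complex, 'a::infinite set, 'a diagram \<Rightarrow>\<^sub>0 complex) lincat)
    (upwards_Hom \<delta>) (downwards_Hom \<delta>)"
proof -
  interpret up: wide_subcategory "partition_category \<delta> :: (_, 'a set, _) lincat" "upwards_Hom \<delta>"
    by (rule wide_subcategory_upwards)
  interpret down: wide_subcategory "partition_category \<delta> :: (_, 'a set, _) lincat" "downwards_Hom \<delta>"
    by (rule wide_subcategory_downwards)
  show ?thesis
  proof (unfold_locales)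
    fix R :: "'a set set" and S T :: "'a set"
    assume "iso_representatives (partition_category \<delta>) R" "S \<in> Obj (partition_category \<delta>)"
      "T \<in> Obj (partition_category \<delta>)"
    then show "\<exists>\<phi> \<in> iso (sum_group R (triangular_tensor (partition_category \<delta>) (upwards_Hom \<delta>) (downwards_Hom \<delta>) S T))
          (Hom_group (partition_category \<delta>) S T).
        \<forall>Y \<in> R. \<forall>g \<in> upwards_Hom \<delta> Y T. \<forall>f \<in> downwards_Hom \<delta> S Y.
          \<phi> (\<lambda>W \<in> R. if W = Y
              then triangular_pure (partition_category \<delta>) (upwards_Hom \<delta>) (downwards_Hom \<delta>) S T Y g f
              else \<one>\<^bsub>triangular_tensor (partition_category \<delta>) (upwards_Hom \<delta>) (downwards_Hom \<delta>) S T W\<^esub>)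
          = Comp (partition_category \<delta>) S Y T g f"
      by (intro triangular_decomposition) simp_all
  next
    fix S :: "'a set" assume "S \<in> Obj (partition_category \<delta>)"
    then have S: "finite S" by simp
    show "upwards_Hom \<delta> S S = downwards_Hom \<delta> S S"
      by (simp add: upwards_Hom_eq downwards_Hom_eq upwards_iff_downwards[OF S])
    show "semisimple_ring (End_ring (partition_category \<delta>) (upwards_Hom \<delta>) S)"
      by (rule semisimple_End_upwards[OF S])
  qed (use essentially_small_partition_category partition_category_order[of \<delta>] in
      \<open>auto intro!: finite_dim_partition_category\<close>)
qed

end
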